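(* The limit-strategy upper-bound problem under the excess perturbation semantics is undecidable for robust priced timed automata (in the class of robust priced timed games in which every cycle has non-negative accumulated cost) with $5$ clocks, all location prices in $\{0,1\}$, and the cost function of every target location equal to the constant function $0$.
   Context: Clocks are real-valued variables; a valuation is a map $\nu$ from the finite clock set $X$ to $\mathbb{R}_{\ge 0}$, $\nu+t$ adds $t$ to every clock and $\nu[r:=0]$ resets the clocks in $r\subseteq X$ to $0$. A rectangular guard is a finite conjunction of constraints $x\bowtie k$ with $x\in X$, $k\in\mathbb{Z}$, $\bowtie\in\{<,\le,=,>,\ge\}$. A robust priced timed game (RPTG) is a tuple $(L_1,L_2,L_{init},X,E,\eta,T,f_{goal})$: $L_1$ are controller locations, $L_2$ perturbator locations, $L_{init}\subseteq L_1\cup L_2$ initial locations, $E\subseteq L\times \mathrm{Rect}(X)\times 2^X\times (L\cup T)$ transitions (with $L=L_1\cup L_2$), $\eta:L\to\mathbb{Z}$ location prices, $T$ target locations disjoint from $L$, and $f_{goal}$ assigns to each target a piecewise-affine continuous cost function $\mathbb{R}_{\ge0}^{|X|}\to\mathbb{R}\cup\{\pm\infty\}$. A robust priced timed automaton (RPTA) is an RPTG with only controller locations. Excess perturbation semantics for a fixed $\delta>0$: from a state $(l,\nu)$ with $l\in L_1$, the controller chooses a delay $t$ and a transition $e=(l,g,r,l')$ with $\nu+t$ satisfying $g$; the perturbator then chooses $\varepsilon\in[-\delta,\delta]$, the new state is $(l',(\nu+t+\varepsilon)[r:=0])$ and the cost $(t+\varepsilon)\eta(l)$ is incurred (the guard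 is checked before perturbation, the reset and clock update after). From $(l,\nu)$ with $l\in L_2$ the perturbator chooses $t$ and $e=(l,g,r,l')$ with $\nu+t$ satisfying $g$, moving to $(l',(\nu+t)[r:=0])$ with cost $t\,\eta(l)$. Delays at all locations are required to be at least $\delta$. The cost $\mathrm{cost}^\delta$ of a play that first reaches a target $l_n$ with valuation $\nu_n$ is the sum of its transition costs plus $f_{goal}(l_n)(\nu_n)$; a play never reaching a target has cost $+\infty$. Strategies map finite plays to moves of the respective player. The class considered consists of games in which the accumulated cost of every cycle is non-negative. The limit-cost of a controller strategy $\sigma_1$ from state $s$ is $\mathrm{limcost}(s,\sigma_1)=\lim_{\delta\to0}\sup_{\sigma_2}\mathrm{cost}^\delta(\mathrm{outcome}(s,\sigma_1,\sigma_2))$. The limit-strategy upper-bound problem: given such a game, a state $s=(l,\mathbf{0})$ with $l$ initial and accumulated cost $0$, and a rational $K$, decide whether there is a controller strategy $\sigma_1$ with $\mathrm{limcost}(s,\sigma_1)\le K$. *)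

theory Defs
  imports "HOL-Analysis.Analysis" "HOL-Library.Nat_Bijection"
begin

datatype recf = Zero | Succ | Proj nat | Comp recf "recf list" | Prim recf recf | Mini recf

inductive reval :: "recf \<Rightarrow> nat list \<Rightarrow> nat \<Rightarrow> bool" where
  reval_zero: "reval Zero xs 0"
| reval_succ: "reval Succ (x # xs) (Suc x)"
| reval_proj: "i < length xs \<Longrightarrow> reval (Proj i) xs (xs ! i)"
| reval_comp: "list_all2 (\<lambda>g y. reval g xs y) gs ys \<Longrightarrow> reval f ys z \<Longrightarrow> reval (Comp f gs) xs z"
| reval_prim0: "reval f xs z \<Longrightarrow> reval (Prim f g) (0 # xs) z"
| reval_primS: "reval (Prim f g) (y # xs) r \<Longrightarrow> reval g (y # r # xs) z
                 \<Longrightarrow> reval (Prim f g) (Suc y # xs) z"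
| reval_mini: "reval f (y # xs) 0 \<Longrightarrow> (\<forall>z<y. \<exists>v. reval f (z # xs) v \<and> 0 < v)
                 \<Longrightarrow> reval (Mini f) xs y"

definition decidable_on :: "('a \<Rightarrow> nat) \<Rightarrow> 'a set \<Rightarrow> 'a set \<Rightarrow> bool" where
  "decidable_on enc D P \<longleftrightarrow>
     (\<exists>f. \<forall>x\<in>D. reval f [enc x] (if x \<in> P then 1 else 0))"

datatype cmp = CLt | CLe | CEq | CGt | CGe

text \<open>Rectangular guard: conjunction of atoms (clock, comparison, integer constant).\<close>
type_synonym guard = "(nat \<times> cmp \<times> int) list"

text \<open>Locations are Loc 0 .. Loc (nlocs-1), target locations Tgt 0 .. Tgt (ntargets-1).\<close>
datatype node = Loc nat | Tgt nat

text \<open>Transition (source location, guard, reset set, destination).\<close>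
type_synonym edge = "nat \<times> guard \<times> nat list \<times> node"

text \<open>An RPTA (all locations are controller locations); the cost functions of the targets
  are not part of the syntax since in the class considered they are all the constant 0.\<close>
record rpta =
  nlocs :: nat
  ntargets :: nat
  inits :: "nat list"
  edges :: "edge list"
  prices :: "int list"

text \<open>Problem instance: automaton, initial location, bound K = p / q.\<close>
datatype inst = Inst rpta nat int nat

definition nclocks :: nat where "nclocks = 5"

fun node_ok :: "rpta \<Rightarrow> node \<Rightarrow> bool" where
  "node_ok A (Loc i) = (i < nlocs A)"
| "node_ok A (Tgt j) = (j < ntargets A)"

definition edge_ok :: "rpta \<Rightarrow> edge \<Rightarrow> bool" where
  "edge_ok A e = (case e of (l, g, r, d) \<Rightarrow>
      l < nlocs A \<and> (\<forall>(x, c, k) \<in> set g. x < nclocks) \<and> (\<forall>x\<in>set r. x < nclocks) \<and> node_ok A d)"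

text \<open>Well-formed instance in the class of the theorem: 5 clocks, prices in {0,1},
  target cost functions 0 (implicit), initial location among the initial locations.
  (Non-negative prices imply that every cycle has non-negative accumulated cost.)\<close>
fun valid_inst :: "inst \<Rightarrow> bool" where
  "valid_inst (Inst A l0 p q) \<longleftrightarrow>
     0 < q \<and> l0 \<in> set (inits A) \<and> (\<forall>l\<in>set (inits A). l < nlocs A)
     \<and> length (prices A) = nlocs A \<and> (\<forall>c\<in>set (prices A). c = 0 \<or> c = 1)
     \<and> (\<forall>e\<in>set (edges A). edge_ok A e)"

type_synonym valuation = "nat \<Rightarrow> real"
type_synonym state = "node \<times> valuation"

fun sat_atom :: "valuation \<Rightarrow> nat \<times> cmp \<times> int \<Rightarrow> bool" where
  "sat_atom \<nu> (x, CLt, k) = (\<nu> x < of_int k)"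
| "sat_atom \<nu> (x, CLe, k) = (\<nu> x \<le> of_int k)"
| "sat_atom \<nu> (x, CEq, k) = (\<nu> x = of_int k)"
| "sat_atom \<nu> (x, CGt, k) = (\<nu> x > of_int k)"
| "sat_atom \<nu> (x, CGe, k) = (\<nu> x \<ge> of_int k)"

definition sat_guard :: "valuation \<Rightarrow> guard \<Rightarrow> bool" where
  "sat_guard \<nu> g = (\<forall>a\<in>set g. sat_atom \<nu> a)"

definition reset :: "nat list \<Rightarrow> valuation \<Rightarrow> valuation" where
  "reset r \<nu> = (\<lambda>x. if x \<in> set r then 0 else \<nu> x)"

text \<open>Finite play: initial state followed by the list of steps
  (delay t, index of transition e, perturbation \<epsilon>, resulting state).\<close>
type_synonym play = "state \<times> (real \<times> nat \<times> real \<times> state) list"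

definition cur :: "play \<Rightarrow> state" where
  "cur h = (if snd h = [] then fst h else snd (snd (snd (last (snd h)))))"

text \<open>Controller strategy: finite play \<mapsto> (delay, transition index).
  Perturbator strategy: finite play and controller move \<mapsto> perturbation.\<close>
type_synonym ctrl_strat = "play \<Rightarrow> real \<times> nat"
type_synonym pert_strat = "play \<Rightarrow> real \<times> nat \<Rightarrow> real"

text \<open>One step of the play. None: the play has stopped (target reached, or the controller
  proposed a move that is not allowed: not an outgoing transition, delay below \<delta>,
  or guard not satisfied).\<close>
definition step :: "rpta \<Rightarrow> real \<Rightarrow> ctrl_strat \<Rightarrow> pert_strat \<Rightarrow> play \<Rightarrow> play option" where
  "step A \<delta> \<sigma>1 \<sigma>2 h =
     (case cur h of (Tgt _, _) \<Rightarrow> None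
      | (Loc l, \<nu>) \<Rightarrow>
         (case \<sigma>1 h of (t, i) \<Rightarrow>
           if i < length (edges A) \<and> fst (edges A ! i) = l \<and> \<delta> \<le> t
              \<and> sat_guard (\<lambda>x. \<nu> x + t) (fst (snd (edges A ! i)))
           then (let \<epsilon> = \<sigma>2 h (t, i);
                     r = fst (snd (snd (edges A ! i)));
                     d = snd (snd (snd (edges A ! i)))
                 in Some (fst h, snd h @ [(t, i, \<epsilon>, (d, reset r (\<lambda>x. \<nu> x + t + \<epsilon>)))]))
           else None))"

fun run :: "rpta \<Rightarrow> real \<Rightarrow> state \<Rightarrow> ctrl_strat \<Rightarrow> pert_strat \<Rightarrow> nat \<Rightarrow> play option" where
  "run A \<delta> s \<sigma>1 \<sigma>2 0 = Some (s, [])"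
| "run A \<delta> s \<sigma>1 \<sigma>2 (Suc n) =
     (case run A \<delta> s \<sigma>1 \<sigma>2 n of None \<Rightarrow> None | Some h \<Rightarrow> step A \<delta> \<sigma>1 \<sigma>2 h)"

fun is_tgt :: "node \<Rightarrow> bool" where
  "is_tgt (Tgt _) = True" | "is_tgt (Loc _) = False"

definition reaches_at :: "rpta \<Rightarrow> real \<Rightarrow> state \<Rightarrow> ctrl_strat \<Rightarrow> pert_strat \<Rightarrow> nat \<Rightarrow> bool" where
  "reaches_at A \<delta> s \<sigma>1 \<sigma>2 n =
     (\<exists>h. run A \<delta> s \<sigma>1 \<sigma>2 n = Some h \<and> is_tgt (fst (cur h)))"

definition play_cost :: "rpta \<Rightarrow> play \<Rightarrow> real" where
  "play_cost A h = (\<Sum>(t, i, \<epsilon>, s') \<leftarrow> snd h. (t + \<epsilon>) * of_int (prices A ! fst (edges A ! i)))"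

text \<open>cost^\<delta> of the outcome: accumulated cost plus f_goal = 0 at the first target reached;
  +\<infinity> if no target is ever reached.\<close>
definition cost :: "rpta \<Rightarrow> real \<Rightarrow> state \<Rightarrow> ctrl_strat \<Rightarrow> pert_strat \<Rightarrow> ereal" where
  "cost A \<delta> s \<sigma>1 \<sigma>2 =
     (if \<exists>n. reaches_at A \<delta> s \<sigma>1 \<sigma>2 n
      then ereal (play_cost A (the (run A \<delta> s \<sigma>1 \<sigma>2 (LEAST n. reaches_at A \<delta> s \<sigma>1 \<sigma>2 n))) + 0)
      else \<infinity>)"

definition pert_strats :: "real \<Rightarrow> pert_strat set" where
  "pert_strats \<delta> = {\<sigma>2. \<forall>h m. \<bar>\<sigma>2 h m\<bar> \<le> \<delta>}"

definition limcost :: "rpta \<Rightarrow> state \<Rightarrow> ctrl_strat \<Rightarrow> ereal" where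
  "limcost A s \<sigma>1 =
     Lim (at_right (0::real)) (\<lambda>\<delta>. SUP \<sigma>2 \<in> pert_strats \<delta>. cost A \<delta> s \<sigma>1 \<sigma>2)"

fun yes_inst :: "inst \<Rightarrow> bool" where
  "yes_inst (Inst A l0 p q) \<longleftrightarrow>
     (\<exists>\<sigma>1. limcost A (Loc l0, \<lambda>_. 0) \<sigma>1 \<le> ereal (of_int p / of_nat q))"

fun enc_cmp :: "cmp \<Rightarrow> nat" where
  "enc_cmp CLt = 0" | "enc_cmp CLe = 1" | "enc_cmp CEq = 2" | "enc_cmp CGt = 3" | "enc_cmp CGe = 4"

definition enc_guard :: "guard \<Rightarrow> nat" where
  "enc_guard g = list_encode (map (\<lambda>(x, c, k). prod_encode (x, prod_encode (enc_cmp c, int_encode k))) g)"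

fun enc_node :: "node \<Rightarrow> nat" where
  "enc_node (Loc i) = prod_encode (0, i)" | "enc_node (Tgt j) = prod_encode (1, j)"

definition enc_edge :: "edge \<Rightarrow> nat" where
  "enc_edge e = (case e of (l, g, r, d) \<Rightarrow> list_encode [l, enc_guard g, list_encode r, enc_node d])"

fun enc_inst :: "inst \<Rightarrow> nat" where
  "enc_inst (Inst A l0 p q) = list_encode
     [nlocs A, ntargets A, list_encode (inits A), list_encode (map enc_edge (edges A)),
      list_encode (map int_encode (prices A)), l0, int_encode p, q]"

end

theory Submission
  imports Defs "HOL-Computational_Algebra.Primes" "HOL-Library.Infinite_Set"
begin

text \<open>
  A controller strategy does not know \<open>\<delta>\<close>, and the cost is monotone in \<open>\<delta>\<close>, so the limit cost is the
  infimum over \<open>\<delta>\<close> and the play without perturbations is a single fixed play with exact real clock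
  values. A counter \<open>c\<close> is stored as the value \<open>1 + 4 / 2^c\<close> of a clock. In every phase of a two-counter
  machine the controller resets a fresh clock at a time of its own choice, thereby guessing the new
  value \<open>u'\<close> of a counter whose old value is \<open>u\<close>; a perturbation, however small, of the next move (taken at a
  prescribed time) leads to a deterministic check whose cost is \<open>11\<close> plus a positive multiple of
  \<open>\<plusminus>(u' - \<phi> u)\<close>, where \<open>\<phi> u\<close> is the correct value and the sign is that of the perturbation. Hence limit
  cost at most 11 forces the unperturbed play to simulate the machine faithfully up to a target,
  whereas for a halting machine the honest strategy exceeds 11 only by a multiple of \<open>\<delta>\<close>.

  No universal machine is needed: a decision procedure, composed with the map from an edge list to
  the instance that runs this edge list on its own code, is a recursive function; it is compiled
  non-uniformly into a two-counter machine that reaches the goal iff the procedure answers no. Running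
  the resulting automaton on its own code gives a contradiction. The code is loaded into the counter by a chain
  of increments, which makes the encoded instance a computable function of the code.
\<close>

section \<open>Computable functions\<close>

text \<open>A guess needs a clock that is free while both old values are still running, so three
  clocks rotate through the roles of front, back and fresh value; this is why a machine step may
  change only the front counter and then swaps the two. The values \<open>1 + 4 / 2^c\<close> keep
  the honest reset before phase time 7, the moment at which a challenge can be raised. The remaining
  gap is \<open>4 / 2^c\<close>: never zero, but arbitrarily small. So no single \<delta> suits all
  runs, and completeness takes \<delta> small relative to the one finite halting run. A stored value
  lives for two further phases only, and the honest reset times are fixed in advance rather than
  computed from the clocks, so errors from earlier perturbations are forgotten instead of being
  amplified by the doubling in a decrement. A decision procedure answers on every valid instance;
  hence only forward simulations are proved for recursive functions, register programs and machines,
  and nothing is claimed about diverging computations.\<close>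

definition computable :: "nat \<Rightarrow> (nat list \<Rightarrow> nat) \<Rightarrow> bool" where
  "computable n F \<longleftrightarrow> (\<exists>r. \<forall>xs. length xs = n \<longrightarrow> reval r xs (F xs))"

lemma computable_nth: "i < n \<Longrightarrow> computable n (\<lambda>xs. xs ! i)"
  unfolding computable_def by (intro exI[of _ "Proj i"]) (auto intro: reval_proj)

lemma computable_comp1:
  assumes "computable 1 F" "computable n g"
  shows "computable n (\<lambda>xs. F [g xs])"
proof -
  from assms obtain f r where "\<And>xs. length xs = 1 \<Longrightarrow> reval f xs (F xs)" "\<And>xs. length xs = n \<Longrightarrow> reval r xs (g xs)"
    unfolding computable_def by blast
  then show ?thesis unfolding computable_def
    by (intro exI[of _ "Comp f [r]"]) (auto intro!: reval_comp[where ys = "[_]"])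
qed

lemma computable_comp2:
  assumes "computable 2 F" "computable n g" "computable n h"
  shows "computable n (\<lambda>xs. F [g xs, h xs])"
proof -
  from assms obtain f r s where "\<And>xs. length xs = 2 \<Longrightarrow> reval f xs (F xs)"
    "\<And>xs. length xs = n \<Longrightarrow> reval r xs (g xs)" "\<And>xs. length xs = n \<Longrightarrow> reval s xs (h xs)"
    unfolding computable_def by blast
  then show ?thesis unfolding computable_def
    by (intro exI[of _ "Comp f [r, s]"]) (auto intro!: reval_comp[where ys = "[_, _]"])
qed

lemma computable_Suc:
  assumes "computable n g"
  shows "computable n (\<lambda>xs. Suc (g xs))"
proof -
  from assms obtain r where "\<And>xs. length xs = n \<Longrightarrow> reval r xs (g xs)" unfolding computable_def by blast
  then show ?thesis unfolding computable_def
    by (intro exI[of _ "Comp Succ [r]"]) (auto intro!: reval_comp[where ys = "[_]"] reval_succ)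
qed

lemma computable_const: "computable n (\<lambda>_. c)"
proof (induction c)
  case 0
  show ?case unfolding computable_def by (intro exI[of _ Zero]) (simp add: reval_zero)
qed (rule computable_Suc)

lemma computable_rec:
  assumes "computable n F" "computable (Suc (Suc n)) G"
  shows "computable (Suc n) (\<lambda>xs. rec_nat (F (tl xs)) (\<lambda>i r. G (i # r # tl xs)) (hd xs))"
proof -
  from assms obtain f g where f: "\<And>xs. length xs = n \<Longrightarrow> reval f xs (F xs)"
    and g: "\<And>xs. length xs = Suc (Suc n) \<Longrightarrow> reval g xs (G xs)" unfolding computable_def by blast
  have "reval (Prim f g) (y # xs) (rec_nat (F xs) (\<lambda>i r. G (i # r # xs)) y)" if "length xs = n" for y xs
    using that by (induction y) (auto intro!: reval_prim0 f reval_primS g)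
  then have "reval (Prim f g) xs (rec_nat (F (tl xs)) (\<lambda>i r. G (i # r # tl xs)) (hd xs))" if "length xs = Suc n" for xs
    using that by (cases xs) auto
  then show ?thesis unfolding computable_def by blast
qed

lemma computable_cong: "computable n F \<Longrightarrow> (\<And>xs. length xs = n \<Longrightarrow> F xs = G xs) \<Longrightarrow> computable n G"
  unfolding computable_def by auto

lemma computable_rec1:
  assumes "computable 2 G" "computable n g"
  shows "computable n (\<lambda>xs. rec_nat c (\<lambda>i r. G [i, r]) (g xs))"
proof -
  have "computable (Suc 0) (\<lambda>xs. rec_nat c (\<lambda>i r. G (i # r # [])) (hd xs))"
    by (rule computable_cong[OF computable_rec[OF computable_const]])
      (use assms(1) in \<open>auto simp: numeral_2_eq_2 length_Suc_conv\<close>)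
  then show ?thesis
    using computable_comp1[of "\<lambda>xs. rec_nat c (\<lambda>i r. G [i, r]) (hd xs)", OF _ assms(2)] by simp
qed

lemma computable_add:
  assumes "computable n g" "computable n h"
  shows "computable n (\<lambda>xs. g xs + h xs)"
proof -
  have "computable (Suc 1) (\<lambda>xs. rec_nat (tl xs ! 0) (\<lambda>i r. Suc ((i # r # tl xs) ! 1)) (hd xs))"
    by (intro computable_rec computable_Suc computable_nth) auto
  moreover have "rec_nat b (\<lambda>i r. Suc r) a = a + b" for a b :: nat by (induction a) auto
  ultimately have "computable 2 (\<lambda>xs. hd xs + tl xs ! 0)" by (simp add: numeral_2_eq_2)
  from computable_comp2[OF this assms] show ?thesis by simp
qed

lemma computable_mult_const: "computable n g \<Longrightarrow> computable n (\<lambda>xs. c * g xs)"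
  by (induction c) (simp_all add: computable_const computable_add)

lemma computable_power:
  assumes "computable n g"
  shows "computable n (\<lambda>xs. c ^ g xs)"
proof -
  have "rec_nat 1 (\<lambda>i r. c * [i, r] ! 1) a = c ^ a" for a by (induction a) auto
  moreover have "computable 2 (\<lambda>xs. c * xs ! 1)" by (intro computable_mult_const computable_nth) auto
  ultimately show ?thesis using computable_rec1[OF _ assms, of "\<lambda>xs. c * xs ! 1" 1] by simp
qed

lemma computable_triangle:
  assumes "computable n g"
  shows "computable n (\<lambda>xs. triangle (g xs))"
proof -
  have "rec_nat 0 (\<lambda>i r. [i, r] ! 1 + Suc ([i, r] ! 0)) a = triangle a" for a by (induction a) auto
  moreover have "computable 2 (\<lambda>xs. xs ! 1 + Suc (xs ! 0))"
    by (intro computable_add computable_Suc computable_nth) auto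
  ultimately show ?thesis using computable_rec1[OF _ assms, of "\<lambda>xs. xs ! 1 + Suc (xs ! 0)" 0] by simp
qed

lemma computable_prod_encode:
  "computable n g \<Longrightarrow> computable n h \<Longrightarrow> computable n (\<lambda>xs. prod_encode (g xs, h xs))"
  unfolding prod_encode_def by (simp add: computable_add computable_triangle)

lemma computable_list_encode_Nil: "computable n (\<lambda>_. list_encode [])"
  by (rule computable_const)

lemma computable_list_encode_Cons:
  "computable n g \<Longrightarrow> computable n (\<lambda>xs. list_encode (H xs)) \<Longrightarrow> computable n (\<lambda>xs. list_encode (g xs # H xs))"
  by (simp add: computable_Suc computable_prod_encode)

text \<open>Codes dominate what they code; later this lets the code of an edge list serve as a bound
  on the location numbers in it.\<close>

lemma list_encode_mem: "x \<in> set xs \<Longrightarrow> x < list_encode xs"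
proof (induction xs)
  case (Cons y xs)
  have "y \<le> prod_encode (y, list_encode xs)" "list_encode xs \<le> prod_encode (y, list_encode xs)"
    by (rule le_prod_encode_1, rule le_prod_encode_2)
  then show ?case using Cons by auto
qed simp

section \<open>Register programs\<close>

text \<open>\<open>Loop r c\<close> stands for: while register \<open>r\<close> is nonzero,
  decrement it and run \<open>c\<close>. The body may write to \<open>r\<close> again, so this one
  construct covers counted loops and unbounded search.\<close>

datatype com = Skip | Incr nat | Seq com com | Loop nat com

inductive exec :: "com \<Rightarrow> (nat \<Rightarrow> nat) \<Rightarrow> (nat \<Rightarrow> nat) \<Rightarrow> bool" where
  exec_Skip: "exec Skip s s"
| exec_Incr: "exec (Incr r) s (s(r := Suc (s r)))"
| exec_Seq: "exec c s s' \<Longrightarrow> exec d s' s'' \<Longrightarrow> exec (Seq c d) s s''"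
| exec_Loop_zero: "s r = 0 \<Longrightarrow> exec (Loop r c) s s"
| exec_Loop_Suc: "s r = Suc k \<Longrightarrow> exec c (s(r := k)) s' \<Longrightarrow> exec (Loop r c) s' s'' \<Longrightarrow> exec (Loop r c) s s''"

section \<open>Clearing, moving and copying registers\<close>

definition clear :: "nat \<Rightarrow> com" where
  "clear r = Loop r Skip"

lemma exec_clear: "exec (clear r) s (s(r := 0))"
proof (induction "s r" arbitrary: s)
  case 0
  then show ?case using exec_Loop_zero[of s r Skip] by (simp add: clear_def fun_upd_idem)
next
  case (Suc k)
  have "exec (clear r) (s(r := k)) ((s(r := k))(r := 0))"
    by (rule Suc(1)) simp
  then show ?case
    using Suc(2) exec_Loop_Suc[of s r k Skip "s(r := k)"] exec_Skip by (simp add: clear_def)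
qed

definition move2 :: "nat \<Rightarrow> nat \<Rightarrow> nat \<Rightarrow> com" where
  "move2 r x y = Loop r (Seq (Incr x) (Incr y))"

lemma exec_move2:
  assumes "r \<noteq> x" "r \<noteq> y" "x \<noteq> y"
  shows "exec (move2 r x y) s (s(x := s x + s r, y := s y + s r, r := 0))"
proof (induction "s r" arbitrary: s)
  case 0
  then have "s(x := s x + s r, y := s y + s r, r := 0) = s" by auto
  then show ?case using exec_Loop_zero[of s r] 0 by (simp add: move2_def)
next
  case (Suc k)
  define s' where "s' = s(r := k, x := Suc (s x), y := Suc (s y))"
  have b: "exec (Seq (Incr x) (Incr y)) (s(r := k)) s'"
    using exec_Seq[OF exec_Incr[of x "s(r := k)"] exec_Incr[of y]] assms by (simp add: s'_def)
  have "exec (move2 r x y) s' (s'(x := s' x + s' r, y := s' y + s' r, r := 0))"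
    by (rule Suc(1)) (use assms in \<open>simp add: s'_def\<close>)
  moreover have "s'(x := s' x + s' r, y := s' y + s' r, r := 0) = s(x := s x + s r, y := s y + s r, r := 0)"
    using Suc(2) assms by (auto simp: s'_def fun_eq_iff)
  ultimately show ?case using exec_Loop_Suc[OF Suc(2)[symmetric] b] by (simp add: move2_def)
qed

definition move1 :: "nat \<Rightarrow> nat \<Rightarrow> com" where
  "move1 r x = Loop r (Incr x)"

lemma exec_move1:
  assumes "r \<noteq> x"
  shows "exec (move1 r x) s (s(x := s x + s r, r := 0))"
proof (induction "s r" arbitrary: s)
  case 0
  then have "s(x := s x + s r, r := 0) = s" by auto
  then show ?case using exec_Loop_zero[of s r] 0 by (simp add: move1_def)
next
  case (Suc k)
  define s' where "s' = s(r := k, x := Suc (s x))"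
  have b: "exec (Incr x) (s(r := k)) s'"
    using exec_Incr[of x "s(r := k)"] assms by (simp add: s'_def)
  have "exec (move1 r x) s' (s'(x := s' x + s' r, r := 0))"
    by (rule Suc(1)) (use assms in \<open>simp add: s'_def\<close>)
  moreover have "s'(x := s' x + s' r, r := 0) = s(x := s x + s r, r := 0)"
    using Suc(2) assms by (auto simp: s'_def fun_eq_iff)
  ultimately show ?case using exec_Loop_Suc[OF Suc(2)[symmetric] b] by (simp add: move1_def)
qed

definition copy :: "nat \<Rightarrow> nat \<Rightarrow> nat \<Rightarrow> com" where
  "copy r x tmp = Seq (clear x) (Seq (clear tmp) (Seq (move2 r x tmp) (move1 tmp r)))"

lemma exec_copy:
  assumes "r \<noteq> x" "r \<noteq> tmp" "x \<noteq> tmp"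
  shows "exec (copy r x tmp) s (s(x := s r, tmp := 0))"
proof -
  define s1 where "s1 = s(x := 0, tmp := 0)"
  define s2 where "s2 = s1(x := s1 x + s1 r, tmp := s1 tmp + s1 r, r := 0)"
  have "exec (copy r x tmp) s (s2(r := s2 r + s2 tmp, tmp := 0))"
    unfolding copy_def
    apply (rule exec_Seq[OF exec_clear])
    apply (rule exec_Seq[OF exec_clear])
    apply (rule exec_Seq[of _ _ s2])
     apply (use exec_move2[OF assms, of s1] in \<open>simp add: s1_def s2_def\<close>)
    apply (rule exec_move1)
    using assms by auto
  moreover have "s2(r := s2 r + s2 tmp, tmp := 0) = s(x := s r, tmp := 0)"
    using assms by (auto simp: s1_def s2_def fun_eq_iff)
  ultimately show ?thesis by simp
qed

text \<open>Registers from \<open>n\<close> on are scratch space with arbitrary content at entry, so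
  a program can be embedded in another one by raising \<open>n\<close>. Only values produced by
  \<open>reval\<close> are promised.\<close>

definition implements :: "recf \<Rightarrow> nat list \<Rightarrow> nat \<Rightarrow> nat \<Rightarrow> com \<Rightarrow> bool" where
  "implements h ins out n c \<longleftrightarrow>
     (\<forall>s v. reval h (map s ins) v \<longrightarrow> (\<exists>t. exec c s t \<and> t out = v \<and> (\<forall>x<n. x \<noteq> out \<longrightarrow> t x = s x)))"

lemma implementsD:
  assumes "implements h ins out n c" "reval h (map s ins) v"
  obtains t where "exec c s t" "t out = v" "\<And>x. x < n \<Longrightarrow> x \<noteq> out \<Longrightarrow> t x = s x"
  using assms unfolding implements_def by blast

inductive_cases revalE_Zero: "reval Zero xs v"
inductive_cases revalE_Succ: "reval Succ xs v"
inductive_cases revalE_Proj: "reval (Proj i) xs v"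
inductive_cases revalE_Comp: "reval (Comp f gs) xs v"
inductive_cases revalE_Prim: "reval (Prim f g) xs v"
inductive_cases revalE_Mini: "reval (Mini f) xs v"

text \<open>\<open>reval\<close> is a relation, so the loop that evaluates a primitive recursion is
  verified against one coherent sequence \<open>R\<close> of intermediate results, read off a single
  derivation.\<close>

lemma reval_Prim_sequence:
  assumes "reval (Prim f g) (y # xs) z"
  obtains R where "reval f xs (R 0)" "\<And>i. i < y \<Longrightarrow> reval g (i # R i # xs) (R (Suc i))" "R y = z"
proof -
  have "\<exists>R. reval f xs (R 0) \<and> (\<forall>i<y. reval g (i # R i # xs) (R (Suc i))) \<and> R y = z"
    using assms
  proof (induction y arbitrary: z)
    case 0
    then show ?case by (auto elim: revalE_Prim)
  next
    case (Suc y)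
    from Suc.prems obtain r where r: "reval (Prim f g) (y # xs) r" "reval g (y # r # xs) z"
      by (auto elim: revalE_Prim)
    from Suc.IH[OF r(1)] obtain R where R: "reval f xs (R 0)" "R y = r"
      "\<forall>i<y. reval g (i # R i # xs) (R (Suc i))" by blast
    show ?case
      by (rule exI[of _ "R(Suc y := z)"]) (use R r(2) in \<open>auto simp: less_Suc_eq\<close>)
  qed
  then show ?thesis using that by blast
qed

text \<open>Each result is stored in the next register and the scratch bound is raised past it, so
  later programs cannot overwrite earlier results.\<close>

lemma implement_list:
  assumes "\<And>g ins out n. g \<in> set gs \<Longrightarrow> set ins \<subseteq> {..<n} \<Longrightarrow> out < n \<Longrightarrow> out \<notin> set ins
             \<Longrightarrow> \<exists>c. implements g ins out n c"
    and "set ins \<subseteq> {..<n}" "n \<le> m"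
  shows "\<exists>c. \<forall>s vs. list_all2 (\<lambda>g y. reval g (map s ins) y) gs vs \<longrightarrow>
           (\<exists>t. exec c s t \<and> map t [m..<m + length gs] = vs \<and> (\<forall>x<m. t x = s x))"
  using assms
proof (induction gs arbitrary: m)
  case Nil
  then show ?case by (auto intro!: exI[of _ Skip] exec_Skip)
next
  case (Cons g gs)
  have "\<exists>c. implements g ins m (Suc m) c"
    by (rule Cons.prems(1)) (use Cons.prems(2,3) in auto)
  then obtain c where c: "implements g ins m (Suc m) c" by blast
  have "\<exists>d. \<forall>s vs. list_all2 (\<lambda>g y. reval g (map s ins) y) gs vs \<longrightarrow>
           (\<exists>t. exec d s t \<and> map t [Suc m..<Suc m + length gs] = vs \<and> (\<forall>x<Suc m. t x = s x))"
    by (rule Cons.IH) (use Cons.prems in auto)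
  then obtain d where d: "\<And>s vs. list_all2 (\<lambda>g y. reval g (map s ins) y) gs vs \<Longrightarrow>
           (\<exists>t. exec d s t \<and> map t [Suc m..<Suc m + length gs] = vs \<and> (\<forall>x<Suc m. t x = s x))"
    by blast
  show ?case
  proof (rule exI[of _ "Seq c d"], intro allI impI)
    fix s vs assume "list_all2 (\<lambda>g y. reval g (map s ins) y) (g # gs) vs"
    then obtain v vs' where vs: "vs = v # vs'" "reval g (map s ins) v"
      "list_all2 (\<lambda>g y. reval g (map s ins) y) gs vs'" by (auto simp: list_all2_Cons1)
    from c vs(2) obtain s1 where s1: "exec c s s1" "s1 m = v" "\<And>x. x < Suc m \<Longrightarrow> x \<noteq> m \<Longrightarrow> s1 x = s x"
      by (rule implementsD) blast
    have "map s1 ins = map s ins" using Cons.prems(2,3) s1(3) by (auto simp: subset_iff)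
    with vs(3) d[of s1 vs'] obtain t where t: "exec d s1 t"
      "map t [Suc m..<Suc m + length gs] = vs'" "\<forall>x<Suc m. t x = s1 x" by auto
    have "map t [m..<m + length (g # gs)] = vs"
      using t(2,3) s1(2) vs(1) by (simp add: upt_conv_Cons del: upt_Suc)
    then show "\<exists>t. exec (Seq c d) s t \<and> map t [m..<m + length (g # gs)] = vs \<and> (\<forall>x<m. t x = s x)"
      using exec_Seq[OF s1(1) t(1)] t(3) s1(3) by (intro exI[of _ t]) auto
  qed
qed

text \<open>Invariant: \<open>i\<close> counts the finished rounds, \<open>cnt\<close> the remaining
  ones, and \<open>out\<close> holds \<open>R\<close> at the number of finished rounds. The new
  result goes to \<open>tmp\<close> first, because \<open>out\<close> is an argument of
  \<open>g\<close> and an output register must differ from the inputs.\<close>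

lemma exec_Prim_loop:
  assumes cg: "implements g (i # out # xs) tmp n' cg"
    and ord: "n = i" "cnt = Suc i" "tmp = Suc (Suc i)" "n' = Suc (Suc (Suc i))" "out < n" "set xs \<subseteq> {..<n}" "out \<notin> set xs"
    and R: "\<And>j. j < y \<Longrightarrow> reval g (j # R j # map s0 xs) (R (Suc j))"
    and s: "s i + s cnt = y" "s out = R (s i)" "\<forall>x<n. x \<noteq> out \<longrightarrow> s x = s0 x"
  shows "\<exists>t. exec (Loop cnt (Seq cg (Seq (copy tmp out n') (Incr i)))) s t \<and> t out = R y \<and> (\<forall>x<n. x \<noteq> out \<longrightarrow> t x = s0 x)"
  using s
proof (induction "s cnt" arbitrary: s)
  case 0
  then show ?case by (intro exI[of _ s]) (auto intro: exec_Loop_zero)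
next
  case (Suc k)
  define s1 where "s1 = s(cnt := k)"
  have m: "map s1 (i # out # xs) = s i # R (s i) # map s0 xs"
    using Suc.prems(2,3) ord by (auto simp: s1_def subset_iff)
  have "reval g (map s1 (i # out # xs)) (R (Suc (s i)))"
    unfolding m using Suc by (intro R) auto
  with cg obtain s2 where s2: "exec cg s1 s2" "s2 tmp = R (Suc (s i))"
    "\<And>x. x < n' \<Longrightarrow> x \<noteq> tmp \<Longrightarrow> s2 x = s1 x" by (rule implementsD) blast
  define s3 where "s3 = s2(out := s2 tmp, n' := 0)"
  have e3: "exec (copy tmp out n') s2 s3"
    unfolding s3_def by (rule exec_copy) (use ord in auto)
  define s4 where "s4 = s3(i := Suc (s3 i))"
  have e: "exec (Seq cg (Seq (copy tmp out n') (Incr i))) s1 s4"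
    by (rule exec_Seq[OF s2(1) exec_Seq[OF e3]]) (simp add: s4_def exec_Incr)
  have v: "s4 i = Suc (s i)" "s4 cnt = k" "s4 out = R (Suc (s i))" "\<forall>x<n. x \<noteq> out \<longrightarrow> s4 x = s0 x"
    using ord s2 Suc.prems(3) by (auto simp: s4_def s3_def s1_def)
  have "\<exists>t. exec (Loop cnt (Seq cg (Seq (copy tmp out n') (Incr i)))) s4 t \<and> t out = R y \<and> (\<forall>x<n. x \<noteq> out \<longrightarrow> t x = s0 x)"
    by (rule Suc.hyps(1)) (use v Suc in auto)
  then show ?case using exec_Loop_Suc[OF Suc.hyps(2)[symmetric] e[unfolded s1_def]] by blast
qed

lemma recf_implementable:
  "set ins \<subseteq> {..<n} \<Longrightarrow> out < n \<Longrightarrow> out \<notin> set ins \<Longrightarrow> \<exists>c. implements h ins out n c"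
proof (induction h arbitrary: ins out n)
  case Zero
  show ?case
    by (rule exI[of _ "clear out"]) (auto simp: implements_def elim!: revalE_Zero intro!: exI[of _ "_(out := 0)"] exec_clear)
next
  case Succ
  show ?case
  proof (cases ins)
    case Nil
    then show ?thesis by (intro exI[of _ Skip]) (auto simp: implements_def elim!: revalE_Succ)
  next
    case (Cons y xs)
    have "exec (Seq (copy y out n) (Incr out)) s (s(n := 0, out := Suc (s y)))" for s
    proof -
      have "y \<noteq> out" "y \<noteq> n" "out \<noteq> n" using Succ Cons by auto
      then show ?thesis
        using exec_Seq[OF exec_copy[of y out n s] exec_Incr[of out]] by (simp add: fun_upd_twist)
    qed
    then show ?thesis using Cons Succ
      by (intro exI[of _ "Seq (copy y out n) (Incr out)"])
        (fastforce simp: implements_def elim!: revalE_Succ)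
  qed
next
  case (Proj i)
  show ?case
  proof (cases "i < length ins")
    case True
    then have m: "ins ! i \<in> set ins" by simp
    then have "exec (copy (ins ! i) out n) s (s(out := s (ins ! i), n := 0))" for s
      using Proj by (intro exec_copy) auto
    moreover have "out \<noteq> n" using Proj by auto
    ultimately show ?thesis using True
      by (intro exI[of _ "copy (ins ! i) out n"]) (fastforce simp: implements_def elim!: revalE_Proj)
  next
    case False
    then show ?thesis by (intro exI[of _ Skip]) (auto simp: implements_def elim!: revalE_Proj)
  qed
next
  case (Comp f gs)
  define k where "k = length gs"
  have "\<exists>c. \<forall>s vs. list_all2 (\<lambda>g y. reval g (map s ins) y) gs vs \<longrightarrow>
           (\<exists>t. exec c s t \<and> map t [n..<n + length gs] = vs \<and> (\<forall>x<n. t x = s x))"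
    by (rule implement_list) (use Comp in auto)
  then obtain c where c: "\<And>s vs. list_all2 (\<lambda>g y. reval g (map s ins) y) gs vs \<Longrightarrow>
           (\<exists>t. exec c s t \<and> map t [n..<n + k] = vs \<and> (\<forall>x<n. t x = s x))" unfolding k_def by blast
  have "\<exists>d. implements f [n..<n+k] out (n+k) d"
    by (rule Comp.IH(1)) (use Comp.prems in auto)
  then obtain d where d: "implements f [n..<n+k] out (n+k) d" by blast
  show ?case
  proof (rule exI[of _ "Seq c d"], unfold implements_def, intro allI impI)
    fix s v assume "reval (Comp f gs) (map s ins) v"
    then obtain ys where ys: "list_all2 (\<lambda>g y. reval g (map s ins) y) gs ys" "reval f ys v"
      by (auto elim: revalE_Comp)
    from c[OF ys(1)] obtain s1 where s1: "exec c s s1" "map s1 [n..<n+k] = ys" "\<forall>x<n. s1 x = s x" by blast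
    from d ys(2)[folded s1(2)] obtain t where "exec d s1 t" "t out = v" "\<And>x. x < n+k \<Longrightarrow> x \<noteq> out \<Longrightarrow> t x = s1 x"
      by (rule implementsD) blast
    then show "\<exists>t. exec (Seq c d) s t \<and> t out = v \<and> (\<forall>x<n. x \<noteq> out \<longrightarrow> t x = s x)"
      using exec_Seq[OF s1(1)] s1(3) by (intro exI[of _ t]) auto
  qed
next
  case (Prim f g)
  show ?case
  proof (cases ins)
    case Nil
    then show ?thesis by (intro exI[of _ Skip]) (auto simp: implements_def elim!: revalE_Prim)
  next
    case (Cons y xs)
    define cnt tmp n' where "cnt = Suc n" and "tmp = Suc (Suc n)" and "n' = Suc (Suc (Suc n))"
    have xs: "set xs \<subseteq> {..<n}" "y < n" "out \<notin> set xs" "out \<noteq> y" using Prim.prems Cons by auto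
    have "\<exists>c. implements f xs out n' c"
      by (rule Prim.IH(1)) (use Prim.prems xs in \<open>auto simp: n'_def\<close>)
    then obtain cf where cf: "implements f xs out n' cf" by blast
    have "\<exists>c. implements g (n # out # xs) tmp n' c"
      by (rule Prim.IH(2)) (use Prim.prems xs in \<open>auto simp: n'_def tmp_def\<close>)
    then obtain cg where cg: "implements g (n # out # xs) tmp n' cg" by blast
    let ?L = "Loop cnt (Seq cg (Seq (copy tmp out n') (Incr n)))"
    show ?thesis
    proof (rule exI[of _ "Seq cf (Seq (clear n) (Seq (copy y cnt tmp) ?L))"], unfold implements_def, intro allI impI)
      fix s v assume "reval (Prim f g) (map s ins) v"
      then have "reval (Prim f g) (s y # map s xs) v" by (simp add: Cons)
      then obtain R where R: "reval f (map s xs) (R 0)"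
        "\<And>j. j < s y \<Longrightarrow> reval g (j # R j # map s xs) (R (Suc j))" "R (s y) = v"
        by (rule reval_Prim_sequence) blast
      from cf R(1) obtain s1 where s1: "exec cf s s1" "s1 out = R 0"
        "\<And>x. x < n' \<Longrightarrow> x \<noteq> out \<Longrightarrow> s1 x = s x" by (rule implementsD) blast
      define s2 where "s2 = s1(n := 0, cnt := s1 y, tmp := 0)"
      have e2: "exec (copy y cnt tmp) (s1(n := 0)) s2"
        using exec_copy[of y cnt tmp "s1(n := 0)"] xs by (auto simp: s2_def cnt_def tmp_def)
      have "\<exists>t. exec ?L s2 t \<and> t out = R (s y) \<and> (\<forall>x<n. x \<noteq> out \<longrightarrow> t x = s x)"
        by (rule exec_Prim_loop[OF cg, of n]) (use Prim.prems xs s1 R in \<open>auto simp: s2_def cnt_def tmp_def n'_def\<close>)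
      then obtain t where "exec ?L s2 t" "t out = R (s y)" "\<forall>x<n. x \<noteq> out \<longrightarrow> t x = s x" by blast
      then show "\<exists>t. exec (Seq cf (Seq (clear n) (Seq (copy y cnt tmp) ?L))) s t \<and> t out = v \<and> (\<forall>x<n. x \<noteq> out \<longrightarrow> t x = s x)"
        using exec_Seq[OF s1(1) exec_Seq[OF exec_clear exec_Seq[OF e2]]] R(3) by blast
    qed
  qed
next
  case (Mini f)
  have "\<exists>c. implements f (out # ins) n (Suc n) c"
    by (rule Mini.IH) (use Mini.prems in auto)
  then obtain cf where cf: "implements f (out # ins) n (Suc n) cf" by blast
  \<comment> \<open>Register \<open>n\<close> holds the value of \<open>f\<close> at the candidate
    in \<open>out\<close>, so the loop stops exactly at a zero of \<open>f\<close>. Its own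
    decrement of \<open>n\<close> is harmless, since \<open>cf\<close> overwrites
    \<open>n\<close>.\<close>
  let ?L = "Loop n (Seq (Incr out) cf)"
  show ?case
  proof (rule exI[of _ "Seq (clear out) (Seq cf ?L)"], unfold implements_def, intro allI impI)
    fix s v assume "reval (Mini f) (map s ins) v"
    then have v0: "reval f (v # map s ins) 0" and vz: "\<forall>z<v. \<exists>w. reval f (z # map s ins) w \<and> 0 < w"
      by (auto elim: revalE_Mini)
    obtain W where W: "\<And>z. z < v \<Longrightarrow> reval f (z # map s ins) (W z) \<and> 0 < W z" using vz by metis
    define V where "V z = (if z < v then W z else 0)" for z
    have V: "reval f (z # map s ins) (V z)" if "z \<le> v" for z
      using W v0 that by (cases "z = v") (auto simp: V_def)
    have run: "\<exists>t. exec cf s1 t \<and> t n = V (s1 out) \<and> t out = s1 out \<and> (\<forall>x<n. x \<noteq> out \<longrightarrow> t x = s x)"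
      if "s1 out \<le> v" "\<forall>x<n. x \<noteq> out \<longrightarrow> s1 x = s x" for s1
    proof -
      have m: "map s1 (out # ins) = s1 out # map s ins" using that(2) Mini.prems by auto
      have "reval f (map s1 (out # ins)) (V (s1 out))" unfolding m by (rule V[OF that(1)])
      with cf obtain t where "exec cf s1 t" "t n = V (s1 out)" "\<And>x. x < Suc n \<Longrightarrow> x \<noteq> n \<Longrightarrow> t x = s1 x"
        by (rule implementsD) blast
      then show ?thesis using that(2) Mini.prems by (intro exI[of _ t]) auto
    qed
    have loop: "\<exists>t. exec ?L s1 t \<and> t out = v \<and> (\<forall>x<n. x \<noteq> out \<longrightarrow> t x = s x)"
      if "s1 out \<le> v" "s1 n = V (s1 out)" "\<forall>x<n. x \<noteq> out \<longrightarrow> s1 x = s x" for s1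
      using that
    proof (induction "v - s1 out" arbitrary: s1)
      case 0
      then show ?case by (intro exI[of _ s1]) (auto simp: V_def intro!: exec_Loop_zero)
    next
      case (Suc k)
      then have lt: "s1 out < v" by auto
      then obtain j where j: "s1 n = Suc j" using W[OF lt] Suc.prems(2) by (auto simp: V_def gr0_conv_Suc)
      define s2 where "s2 = s1(n := j, out := Suc (s1 out))"
      have e: "exec (Incr out) (s1(n := j)) s2"
        using exec_Incr[of out "s1(n := j)"] Mini.prems by (auto simp: s2_def)
      from run[of s2] lt Suc.prems(3) Mini.prems obtain s3 where s3: "exec cf s2 s3" "s3 n = V (s2 out)"
        "s3 out = s2 out" "\<forall>x<n. x \<noteq> out \<longrightarrow> s3 x = s x" by (auto simp: s2_def)
      have "\<exists>t. exec ?L s3 t \<and> t out = v \<and> (\<forall>x<n. x \<noteq> out \<longrightarrow> t x = s x)"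
        by (rule Suc.hyps(1)) (use Suc.hyps(2) s3 lt in \<open>auto simp: s2_def\<close>)
      then show ?case using exec_Loop_Suc[OF j exec_Seq[OF e s3(1)]] by blast
    qed
    from run[of "s(out := 0)"] obtain s1 where s1: "exec cf (s(out := 0)) s1" "s1 n = V 0" "s1 out = 0"
      "\<forall>x<n. x \<noteq> out \<longrightarrow> s1 x = s x" by auto
    from loop[of s1] s1 obtain t where "exec ?L s1 t" "t out = v" "\<forall>x<n. x \<noteq> out \<longrightarrow> t x = s x" by auto
    then show "\<exists>t. exec (Seq (clear out) (Seq cf ?L)) s t \<and> t out = v \<and> (\<forall>x<n. x \<noteq> out \<longrightarrow> t x = s x)"
      using exec_Seq[OF exec_clear exec_Seq[OF s1(1)]] by blast
  qed
qed

section \<open>Two-counter machines\<close>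

datatype op = Keep | Up | Down

fun app_op :: "op \<Rightarrow> nat \<Rightarrow> nat" where
  "app_op Keep a = a"
| "app_op Up a = Suc a"
| "app_op Down a = a - 1"

type_synonym instr = "nat \<times> op \<times> nat \<times> nat"
type_synonym config = "nat \<times> nat \<times> nat"

text \<open>Every step changes the front counter, exchanges the two, and branches on the counter
  that comes to the front. Thus a phase of the game has one new value to guess, and the zero test
  reads a counter that the step leaves unchanged.\<close>

inductive mstep :: "instr set \<Rightarrow> config \<Rightarrow> config \<Rightarrow> bool" for Q where
  "(l, f, j, k) \<in> Q \<Longrightarrow> f = Down \<longrightarrow> 0 < a \<Longrightarrow> mstep Q (l, a, b) (if b = 0 then j else k, b, app_op f a)"

lemma mstep_mono: "mstep Q c d \<Longrightarrow> Q \<subseteq> Q' \<Longrightarrow> mstep Q' c d"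
  by (induction rule: mstep.induct) (blast intro: mstep.intros)

lemma msteps_mono: "Q \<subseteq> Q' \<Longrightarrow> (mstep Q)\<^sup>*\<^sup>* c d \<Longrightarrow> (mstep Q')\<^sup>*\<^sup>* c d"
  using mono_rtranclp[of "mstep Q" "mstep Q'"] mstep_mono by blast

lemma mstep_Keep: "(l, Keep, j, j) \<in> Q \<Longrightarrow> mstep Q (l, a, b) (j, b, a)"
  using mstep.intros[of l Keep j j Q a b] by simp

lemma mstep_Up: "(l, Up, j, k) \<in> Q \<Longrightarrow> mstep Q (l, a, b) (if b = 0 then j else k, b, Suc a)"
  using mstep.intros[of l Up j k Q a b] by simp

lemma mstep_Down: "(l, Down, j, j) \<in> Q \<Longrightarrow> mstep Q (l, Suc a, b) (j, b, a)"
  using mstep.intros[of l Down j j Q "Suc a" b] by simp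

section \<open>Code blocks for multiplication, exact division and divisibility\<close>

definition block :: "nat \<Rightarrow> nat \<Rightarrow> (nat \<Rightarrow> op \<times> nat \<times> nat) \<Rightarrow> instr set" where
  "block n len F = (\<lambda>x. (n + x, F x)) ` {..<len}"

lemma blockI: "x < len \<Longrightarrow> F x = (f, j, k) \<Longrightarrow> (n + x, f, j, k) \<in> block n len F"
  by (force simp: block_def)

lemma single_valued_block: "single_valued (block n len F)"
proof (rule single_valuedI)
  fix l y z assume "(l, y) \<in> block n len F" "(l, z) \<in> block n len F"
  then have "y = F (l - n)" "z = F (l - n)" unfolding block_def image_iff by fastforce+
  then show "y = z" by simp
qed

lemma Domain_block: "Domain (block n len F) \<subseteq> {n..<n + len}"
  by (auto simp: block_def)

lemma finite_block: "finite (block n len F)"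
  by (simp add: block_def)

lemma single_valued_Un_disjoint:
  "single_valued R \<Longrightarrow> single_valued S \<Longrightarrow> Domain R \<inter> Domain S = {} \<Longrightarrow> single_valued (R \<union> S)"
  unfolding single_valued_def by blast

text \<open>One round takes \<alpha> from the front and adds \<beta> to the back. As every step
  swaps, each change is paired with a \<open>Keep\<close>. Only the last \<open>Up\<close> of a
  round branches, on what is left of the front counter; the final offset swaps the result to the
  front and leaves for \<open>e\<close>. The pair \<open>(1, p)\<close> multiplies by
  \<open>p\<close>, and \<open>(p, 1)\<close> divides a multiple of \<open>p\<close>.\<close>

definition loop_code :: "nat \<Rightarrow> nat \<Rightarrow> nat \<Rightarrow> nat \<Rightarrow> nat \<Rightarrow> op \<times> nat \<times> nat" where
  "loop_code \<alpha> \<beta> n e x =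
     (if x = 2 * (\<alpha> + \<beta>) then (Keep, e, e)
      else (if x < 2 * \<alpha> then (if even x then Down else Keep) else (if even x then Keep else Up),
            if Suc x = 2 * (\<alpha> + \<beta>) then n + 2 * (\<alpha> + \<beta>) else n + Suc x,
            if Suc x = 2 * (\<alpha> + \<beta>) then n else n + Suc x))"

definition loop_block :: "nat \<Rightarrow> nat \<Rightarrow> nat \<Rightarrow> nat \<Rightarrow> instr set" where
  "loop_block \<alpha> \<beta> n e = block n (Suc (2 * (\<alpha> + \<beta>))) (loop_code \<alpha> \<beta> n e)"

lemma loop_block_dec:
  assumes "loop_block \<alpha> \<beta> n e \<subseteq> Q" "0 < \<beta>" "i \<le> \<alpha>"
  shows "(mstep Q)\<^sup>*\<^sup>* (n, \<alpha> + x, y) (n + 2 * i, \<alpha> - i + x, y)"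
  using assms(3)
proof (induction i)
  case (Suc i)
  let ?a = "\<alpha> - Suc i + x"
  have a: "\<alpha> - i + x = Suc ?a" using Suc.prems by auto
  have "(n + 2 * i, Down, Suc (n + 2 * i), Suc (n + 2 * i)) \<in> loop_block \<alpha> \<beta> n e"
    unfolding loop_block_def by (rule blockI) (use Suc.prems assms(2) in \<open>auto simp: loop_code_def\<close>)
  then have 1: "mstep Q (n + 2 * i, Suc ?a, y) (Suc (n + 2 * i), y, ?a)"
    using assms(1) by (intro mstep_Down) auto
  have "(n + Suc (2 * i), Keep, n + 2 * Suc i, n + 2 * Suc i) \<in> loop_block \<alpha> \<beta> n e"
    unfolding loop_block_def by (rule blockI) (use Suc.prems assms(2) in \<open>auto simp: loop_code_def\<close>)
  then have 2: "mstep Q (Suc (n + 2 * i), y, ?a) (n + 2 * Suc i, ?a, y)"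
    using assms(1) by (intro mstep_Keep) auto
  from Suc have "(mstep Q)\<^sup>*\<^sup>* (n, \<alpha> + x, y) (n + 2 * i, Suc ?a, y)" by (simp add: a)
  with 1 2 show ?case by (meson rtranclp.rtrancl_into_rtrancl)
qed simp

lemma loop_block_inc:
  assumes "loop_block \<alpha> \<beta> n e \<subseteq> Q" "i < \<beta>"
  shows "(mstep Q)\<^sup>*\<^sup>* (n + 2 * \<alpha>, x, y) (n + 2 * \<alpha> + 2 * i, x, y + i)"
  using assms(2)
proof (induction i)
  case (Suc i)
  have "(n + (2 * \<alpha> + 2 * i), Keep, n + (2 * \<alpha> + Suc (2 * i)), n + (2 * \<alpha> + Suc (2 * i))) \<in> loop_block \<alpha> \<beta> n e"
    unfolding loop_block_def by (rule blockI) (use Suc.prems in \<open>auto simp: loop_code_def\<close>)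
  then have 1: "mstep Q (n + (2 * \<alpha> + 2 * i), x, y + i) (n + (2 * \<alpha> + Suc (2 * i)), y + i, x)"
    using assms(1) by (intro mstep_Keep) auto
  have "(n + (2 * \<alpha> + Suc (2 * i)), Up, n + (2 * \<alpha> + 2 * Suc i), n + (2 * \<alpha> + 2 * Suc i)) \<in> loop_block \<alpha> \<beta> n e"
    unfolding loop_block_def by (rule blockI) (use Suc.prems in \<open>auto simp: loop_code_def\<close>)
  then have 2: "mstep Q (n + (2 * \<alpha> + Suc (2 * i)), y + i, x) (n + (2 * \<alpha> + 2 * Suc i), x, Suc (y + i))"
    using assms(1) mstep_Up[of _ "n + (2 * \<alpha> + 2 * Suc i)" "n + (2 * \<alpha> + 2 * Suc i)" Q "y + i" x] by auto
  from Suc have "(mstep Q)\<^sup>*\<^sup>* (n + 2 * \<alpha>, x, y) (n + (2 * \<alpha> + 2 * i), x, y + i)" by (simp add: add.assoc)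
  with 1 2 show ?case by (simp add: add.assoc)
qed simp

lemma loop_block_round:
  assumes "loop_block \<alpha> \<beta> n e \<subseteq> Q" "0 < \<beta>"
  shows "(mstep Q)\<^sup>*\<^sup>* (n, \<alpha> + x, y) (if x = 0 then n + 2 * (\<alpha> + \<beta>) else n, x, y + \<beta>)"
proof -
  let ?i = "\<beta> - 1"
  have "(mstep Q)\<^sup>*\<^sup>* (n, \<alpha> + x, y) (n + 2 * \<alpha>, x, y)"
    using loop_block_dec[OF assms, of \<alpha> x y] by simp
  also have "(mstep Q)\<^sup>*\<^sup>* (n + 2 * \<alpha>, x, y) (n + (2 * \<alpha> + 2 * ?i), x, y + ?i)"
    using loop_block_inc[OF assms(1), of ?i x y] assms(2) by (simp add: add.assoc)
  finally have A: "(mstep Q)\<^sup>*\<^sup>* (n, \<alpha> + x, y) (n + (2 * \<alpha> + 2 * ?i), x, y + ?i)" .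
  have "(n + (2 * \<alpha> + 2 * ?i), Keep, n + (2 * \<alpha> + Suc (2 * ?i)), n + (2 * \<alpha> + Suc (2 * ?i))) \<in> loop_block \<alpha> \<beta> n e"
    unfolding loop_block_def by (rule blockI) (use assms(2) in \<open>auto simp: loop_code_def\<close>)
  then have 1: "mstep Q (n + (2 * \<alpha> + 2 * ?i), x, y + ?i) (n + (2 * \<alpha> + Suc (2 * ?i)), y + ?i, x)"
    using assms(1) by (intro mstep_Keep) auto
  have "(n + (2 * \<alpha> + Suc (2 * ?i)), Up, n + 2 * (\<alpha> + \<beta>), n) \<in> loop_block \<alpha> \<beta> n e"
    unfolding loop_block_def by (rule blockI) (use assms(2) in \<open>auto simp: loop_code_def\<close>)
  then have "mstep Q (n + (2 * \<alpha> + Suc (2 * ?i)), y + ?i, x) (if x = 0 then n + 2 * (\<alpha> + \<beta>) else n, x, Suc (y + ?i))"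
    using assms(1) by (intro mstep_Up) auto
  moreover have "Suc (y + ?i) = y + \<beta>" using assms(2) by simp
  ultimately show ?thesis using A 1 by (metis rtranclp.rtrancl_into_rtrancl)
qed

lemma loop_block_correct:
  assumes "loop_block \<alpha> \<beta> n e \<subseteq> Q" "0 < \<alpha>" "0 < \<beta>"
  shows "(mstep Q)\<^sup>*\<^sup>* (n, \<alpha> * Suc M, y) (e, y + \<beta> * Suc M, 0)"
proof (induction M arbitrary: y)
  case 0
  have "(n + 2 * (\<alpha> + \<beta>), Keep, e, e) \<in> loop_block \<alpha> \<beta> n e"
    unfolding loop_block_def by (rule blockI) (auto simp: loop_code_def)
  then have "mstep Q (n + 2 * (\<alpha> + \<beta>), 0, y + \<beta>) (e, y + \<beta>, 0)"
    using assms(1) by (intro mstep_Keep) auto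
  with loop_block_round[OF assms(1,3), of 0 y] show ?case by simp
next
  case (Suc M)
  have "(mstep Q)\<^sup>*\<^sup>* (n, \<alpha> + \<alpha> * Suc M, y) (n, \<alpha> * Suc M, y + \<beta>)"
    using loop_block_round[OF assms(1,3), of "\<alpha> * Suc M" y] assms(2) by simp
  with Suc[of "y + \<beta>"] show ?case by (simp add: algebra_simps)
qed

text \<open>Being at offset \<open>2 * i\<close> records that the amount taken so far is
  \<open>i\<close> modulo \<open>p\<close>. Each unit taken from the front is added to the back, so
  the tested number survives, and the exits at \<open>2 * p\<close> and \<open>Suc (2 * p)\<close>
  swap it to the front again.\<close>

definition divisibility_code :: "nat \<Rightarrow> nat \<Rightarrow> nat \<Rightarrow> nat \<Rightarrow> nat \<Rightarrow> op \<times> nat \<times> nat" where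
  "divisibility_code p n e0 e1 x =
     (if x = 2 * p then (Keep, e0, e0) else if x = Suc (2 * p) then (Keep, e1, e1)
      else if even x then (Down, n + Suc x, n + Suc x)
      else (Up, if Suc x = 2 * p then n + 2 * p else n + Suc (2 * p), if Suc x = 2 * p then n else n + Suc x))"

definition test_block :: "nat \<Rightarrow> nat \<Rightarrow> nat \<Rightarrow> nat \<Rightarrow> instr set" where
  "test_block p n e0 e1 = block n (2 * p + 2) (divisibility_code p n e0 e1)"

lemma test_block_correct:
  assumes "test_block p n e0 e1 \<subseteq> Q" "i < p"
  shows "(mstep Q)\<^sup>*\<^sup>* (n + 2 * i, Suc a, b) (if p dvd i + Suc a then e0 else e1, Suc a + b, 0)"
  using assms(2)
proof (induction a arbitrary: i b)
  case (0 i b)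
  have "(n + 2 * i, Down, n + Suc (2 * i), n + Suc (2 * i)) \<in> test_block p n e0 e1"
    unfolding test_block_def by (rule blockI) (use 0 in \<open>auto simp: divisibility_code_def\<close>)
  then have 1: "mstep Q (n + 2 * i, Suc 0, b) (n + Suc (2 * i), b, 0)"
    using assms(1) by (intro mstep_Down) auto
  let ?X = "if Suc i = p then 2 * p else Suc (2 * p)"
  have "(n + Suc (2 * i), Up, n + ?X, if Suc i = p then n else n + Suc (Suc (2 * i))) \<in> test_block p n e0 e1"
    unfolding test_block_def by (rule blockI) (use 0 in \<open>auto simp: divisibility_code_def\<close>)
  then have 2: "mstep Q (n + Suc (2 * i), b, 0) (n + ?X, 0, Suc b)"
    using assms(1) mstep_Up[of _ "n + ?X" _ Q b 0] by auto
  let ?e = "if Suc i = p then e0 else e1"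
  have "(n + ?X, Keep, ?e, ?e) \<in> test_block p n e0 e1"
    unfolding test_block_def by (rule blockI) (use 0 in \<open>auto simp: divisibility_code_def\<close>)
  then have 3: "mstep Q (n + ?X, 0, Suc b) (?e, Suc b, 0)"
    using assms(1) by (intro mstep_Keep) auto
  have "p dvd i + Suc 0 \<longleftrightarrow> Suc i = p" using 0 by (auto dest: dvd_imp_le)
  then have eq: "(if p dvd i + Suc 0 then e0 else e1, Suc 0 + b, 0) = (?e, Suc b, 0)" by simp
  show ?case unfolding eq
    by (rule converse_rtranclp_into_rtranclp[of "mstep Q", OF 1 converse_rtranclp_into_rtranclp[of "mstep Q", OF 2 r_into_rtranclp[of "mstep Q", OF 3]]])
next
  case (Suc a i b)
  have "(n + 2 * i, Down, n + Suc (2 * i), n + Suc (2 * i)) \<in> test_block p n e0 e1"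
    unfolding test_block_def by (rule blockI) (use Suc.prems in \<open>auto simp: divisibility_code_def\<close>)
  then have 1: "mstep Q (n + 2 * i, Suc (Suc a), b) (n + Suc (2 * i), b, Suc a)"
    using assms(1) by (intro mstep_Down) auto
  define i' where "i' = (if Suc i = p then 0 else Suc i)"
  have "(n + Suc (2 * i), Up, n + (if Suc i = p then 2 * p else Suc (2 * p)), n + 2 * i') \<in> test_block p n e0 e1"
    unfolding test_block_def by (rule blockI) (use Suc.prems in \<open>auto simp: divisibility_code_def i'_def\<close>)
  then have "mstep Q (n + Suc (2 * i), b, Suc a) (n + 2 * i', Suc a, Suc b)"
    using assms(1) mstep_Up[of _ _ "n + 2 * i'" Q b "Suc a"] by auto
  then have "(mstep Q)\<^sup>*\<^sup>* (n + 2 * i, Suc (Suc a), b) (n + 2 * i', Suc a, Suc b)"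
    by (intro converse_rtranclp_into_rtranclp[of "mstep Q", OF 1] r_into_rtranclp)
  also have "(mstep Q)\<^sup>*\<^sup>* \<dots> (if p dvd i' + Suc a then e0 else e1, Suc a + Suc b, 0)"
    by (rule Suc.IH) (use Suc.prems in \<open>auto simp: i'_def\<close>)
  also have "p dvd i' + Suc a \<longleftrightarrow> p dvd i + Suc (Suc a)"
  proof (cases "Suc i = p")
    case True
    then have "i + Suc (Suc a) = Suc a + p" by simp
    then show ?thesis using True by (simp only: i'_def if_True add_0 dvd_add_triv_right_iff refl)
  qed (simp add: i'_def)
  finally show ?case by simp
qed

section \<open>Registers as exponents of a Goedel number\<close>

definition nth_prime :: "nat \<Rightarrow> nat" where
  "nth_prime = enumerate {p. prime p}"

lemma prime_nth_prime: "prime (nth_prime r)"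
  using enumerate_in_set[OF primes_infinite] by (simp add: nth_prime_def)

lemma inj_nth_prime: "inj nth_prime"
  using strict_mono_enumerate[OF primes_infinite] strict_mono_imp_inj_on nth_prime_def by metis

lemma nth_prime_pos: "0 < nth_prime r"
  using prime_nth_prime prime_gt_0_nat by blast

definition goedel :: "nat \<Rightarrow> (nat \<Rightarrow> nat) \<Rightarrow> nat" where
  "goedel k s = (\<Prod>r<k. nth_prime r ^ s r)"

lemma goedel_pos: "0 < goedel k s"
  by (auto simp: goedel_def nth_prime_pos intro!: prod_pos)

lemma goedel_incr:
  assumes "r < k"
  shows "goedel k (s(r := Suc x)) = nth_prime r * goedel k (s(r := x))"
proof -
  have "goedel k (s(r := y)) = nth_prime r ^ y * (\<Prod>i\<in>{..<k} - {r}. nth_prime i ^ s i)" for y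
    unfolding goedel_def using assms by (subst prod.remove[of _ r]) (auto intro!: prod.cong)
  then show ?thesis by simp
qed

lemma nth_prime_dvd_goedel:
  assumes "r < k"
  shows "nth_prime r dvd goedel k s \<longleftrightarrow> 0 < s r"
proof
  assume "nth_prime r dvd goedel k s"
  then obtain i where i: "i < k" "nth_prime r dvd nth_prime i ^ s i"
    unfolding goedel_def
    using prime_dvd_prod_iff[of "{..<k}" "nth_prime r" "\<lambda>i. nth_prime i ^ s i"] prime_nth_prime[of r] by auto
  then have "nth_prime r dvd nth_prime i" using prime_dvd_power prime_nth_prime by blast
  then have "r = i" using primes_dvd_imp_eq prime_nth_prime inj_nth_prime by (metis injD)
  then show "0 < s r" using i by (intro Nat.gr0I) (use prime_nth_prime[of i] in auto)
next
  assume "0 < s r"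
  then have "goedel k s = nth_prime r * goedel k (s(r := s r - 1))"
    using goedel_incr[OF assms, of s "s r - 1"] by simp
  then show "nth_prime r dvd goedel k s" by simp
qed

fun regs_below :: "nat \<Rightarrow> com \<Rightarrow> bool" where
  "regs_below k Skip = True"
| "regs_below k (Incr r) = (r < k)"
| "regs_below k (Seq c d) = (regs_below k c \<and> regs_below k d)"
| "regs_below k (Loop r c) = (r < k \<and> regs_below k c)"

lemma regs_below_mono: "regs_below k c \<Longrightarrow> k \<le> k' \<Longrightarrow> regs_below k' c"
  by (induction c) auto

lemma regs_below_exists: "\<exists>k. regs_below k c"
proof (induction c)
  case (Incr r)
  then show ?case by auto
next
  case (Seq c d)
  then obtain k k' where "regs_below k c" "regs_below k' d" by blast
  then have "regs_below (max k k') (Seq c d)" using regs_below_mono by auto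
  then show ?case ..
next
  case (Loop r c)
  then obtain k where "regs_below k c" by blast
  then have "regs_below (max k (Suc r)) (Loop r c)" by (auto intro: regs_below_mono)
  then show ?case ..
qed auto

definition code_in :: "nat \<Rightarrow> nat \<Rightarrow> instr set \<Rightarrow> bool" where
  "code_in n m Q \<longleftrightarrow> finite Q \<and> single_valued Q \<and> Domain Q \<subseteq> {n..<m}"

lemma code_in_block: "n + len \<le> m \<Longrightarrow> code_in n m (block n len F)"
  using Domain_block[of n len F] by (auto simp: code_in_def finite_block single_valued_block)

lemma code_in_Un: "code_in n m Q \<Longrightarrow> code_in m m' Q' \<Longrightarrow> n \<le> m \<Longrightarrow> m \<le> m' \<Longrightarrow> code_in n m' (Q \<union> Q')"
proof -
  assume A: "code_in n m Q" "code_in m m' Q'" "n \<le> m" "m \<le> m'"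
  have "{n..<m} \<inter> {m..<m'} = {}" by auto
  then have "Domain Q \<inter> Domain Q' = {}" using A(1,2) unfolding code_in_def by blast
  moreover have "Domain (Q \<union> Q') \<subseteq> {n..<m'}" using A by (fastforce simp: code_in_def)
  ultimately show ?thesis using A(1,2) by (auto simp: code_in_def intro: single_valued_Un_disjoint)
qed

definition compiles :: "nat \<Rightarrow> com \<Rightarrow> nat \<Rightarrow> nat \<Rightarrow> instr set \<Rightarrow> bool" where
  "compiles k c n e Q \<longleftrightarrow>
     (\<forall>s t. exec c s t \<longrightarrow> (mstep Q)\<^sup>*\<^sup>* (n, goedel k s, 0) (e, goedel k t, 0))"

inductive_cases execE_Skip: "exec Skip s t"
inductive_cases execE_Incr: "exec (Incr r) s t"
inductive_cases execE_Seq: "exec (Seq c d) s t"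

lemma test_block_goedel:
  assumes "test_block (nth_prime r) n e0 e1 \<subseteq> Q" "r < k"
  shows "(mstep Q)\<^sup>*\<^sup>* (n, goedel k s, 0) (if 0 < s r then e0 else e1, goedel k s, 0)"
proof -
  obtain a where "goedel k s = Suc a" using goedel_pos gr0_conv_Suc by blast
  then show ?thesis
    using test_block_correct[OF assms(1) nth_prime_pos, of a 0] nth_prime_dvd_goedel[OF assms(2), of s] by simp
qed

text \<open>On Goedel numbers, testing a register for being nonzero is divisibility by its prime,
  and decrementing it is exact division; the body then exits to the test at
  \<open>n\<close>.\<close>

lemma compiles_Loop:
  assumes "test_block (nth_prime r) n n1 e \<subseteq> Q" "loop_block (nth_prime r) 1 n1 n2 \<subseteq> Q"
    and "compiles k c n2 n Q" "r < k"
  shows "compiles k (Loop r c) n e Q"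
  unfolding compiles_def
proof (intro allI impI)
  fix s t assume "exec (Loop r c) s t"
  then show "(mstep Q)\<^sup>*\<^sup>* (n, goedel k s, 0) (e, goedel k t, 0)"
  proof (induction "Loop r c" s t rule: exec.induct)
    case (exec_Loop_zero s)
    then show ?case using test_block_goedel[OF assms(1,4), of s] by simp
  next
    case (exec_Loop_Suc s x s' s'')
    obtain M where M: "goedel k (s(r := x)) = Suc M" using goedel_pos gr0_conv_Suc by blast
    have "goedel k s = nth_prime r * goedel k (s(r := x))"
      using goedel_incr[OF assms(4), of s x] exec_Loop_Suc(1) fun_upd_idem[of s r "Suc x"] by simp
    then have "(mstep Q)\<^sup>*\<^sup>* (n1, goedel k s, 0) (n2, goedel k (s(r := x)), 0)"
      using loop_block_correct[OF assms(2) nth_prime_pos, of M 0] M by simp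
    moreover have "(mstep Q)\<^sup>*\<^sup>* (n, goedel k s, 0) (n1, goedel k s, 0)"
      using test_block_goedel[OF assms(1,4), of s] exec_Loop_Suc(1) by simp
    moreover have "(mstep Q)\<^sup>*\<^sup>* (n2, goedel k (s(r := x)), 0) (n, goedel k s', 0)"
      using assms(3) exec_Loop_Suc(2) by (auto simp: compiles_def)
    ultimately show ?case using exec_Loop_Suc(5) by (meson rtranclp_trans)
  qed
qed

lemma compiles_mono: "compiles k c n e Q \<Longrightarrow> Q \<subseteq> Q' \<Longrightarrow> compiles k c n e Q'"
  unfolding compiles_def using msteps_mono by blast

text \<open>The end \<open>m\<close> of the code is fixed before the exit label \<open>e\<close> is
  chosen: in a sequence the first part must exit to its own end, and the body of a loop exits to a
  label in front of it.\<close>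

lemma com_compilable:
  "regs_below k c \<Longrightarrow> \<exists>m\<ge>n. \<forall>e. \<exists>Q. code_in n m Q \<and> compiles k c n e Q"
proof (induction c arbitrary: n)
  case Skip
  have "\<exists>Q. code_in n (n + 2) Q \<and> compiles k Skip n e Q" for e
  proof (intro exI conjI)
    \<comment> \<open>Two \<open>Keep\<close> instructions, since a single one would leave the
      counters exchanged.\<close>
    let ?Q = "block n 2 (\<lambda>x. if x = 0 then (Keep, n + 1, n + 1) else (Keep, e, e))"
    show "code_in n (n + 2) ?Q" by (simp add: code_in_block)
    have "(n + 0, Keep, n + 1, n + 1) \<in> ?Q" "(n + 1, Keep, e, e) \<in> ?Q" by (rule blockI; simp)+
    then have "mstep ?Q (n, a, 0) (n + 1, 0, a)" "mstep ?Q (n + 1, 0, a) (e, a, 0)" for a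
      by (auto intro: mstep_Keep)
    then show "compiles k Skip n e ?Q"
      by (auto simp: compiles_def elim!: execE_Skip) (meson rtranclp.rtrancl_into_rtrancl rtranclp.rtrancl_refl)
  qed
  then show ?case by (intro exI[of _ "n + 2"]) auto
next
  case (Incr r)
  let ?m = "n + Suc (2 * (1 + nth_prime r))"
  have "\<exists>Q. code_in n ?m Q \<and> compiles k (Incr r) n e Q" for e
  proof (intro exI conjI)
    let ?Q = "loop_block 1 (nth_prime r) n e"
    show "code_in n ?m ?Q" by (simp add: code_in_block loop_block_def)
    show "compiles k (Incr r) n e ?Q"
      unfolding compiles_def
    proof (intro allI impI)
      fix s t assume "exec (Incr r) s t"
      then have t: "t = s(r := Suc (s r))" by (auto elim: execE_Incr)
      obtain M where M: "goedel k s = Suc M" using goedel_pos gr0_conv_Suc by blast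
      show "(mstep ?Q)\<^sup>*\<^sup>* (n, goedel k s, 0) (e, goedel k t, 0)"
        using loop_block_correct[of 1 "nth_prime r" n e ?Q M 0] nth_prime_pos goedel_incr[of r k s "s r"] Incr M t
        by simp
    qed
  qed
  then show ?case by (intro exI[of _ ?m]) auto
next
  case (Seq c d)
  from Seq.IH(1)[of n] Seq.prems obtain m where m: "n \<le> m" "\<And>e. \<exists>Q. code_in n m Q \<and> compiles k c n e Q" by auto
  from Seq.IH(2)[of m] Seq.prems obtain m' where m': "m \<le> m'" "\<And>e. \<exists>Q. code_in m m' Q \<and> compiles k d m e Q" by auto
  have "\<exists>Q. code_in n m' Q \<and> compiles k (Seq c d) n e Q" for e
  proof -
    from m(2)[of m] obtain Q where Q: "code_in n m Q" "compiles k c n m Q" by blast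
    from m'(2)[of e] obtain Q' where Q': "code_in m m' Q'" "compiles k d m e Q'" by blast
    have "compiles k c n m (Q \<union> Q')" "compiles k d m e (Q \<union> Q')"
      using Q(2) Q'(2) by (auto intro: compiles_mono)
    then have "compiles k (Seq c d) n e (Q \<union> Q')"
      unfolding compiles_def by (auto elim!: execE_Seq) (meson rtranclp_trans)
    with code_in_Un[OF Q(1) Q'(1) m(1) m'(1)] show ?thesis by blast
  qed
  then show ?case using m(1) m'(1) by (intro exI[of _ m']) auto
next
  case (Loop r c)
  define n1 where "n1 = n + (2 * nth_prime r + 2)"
  define n2 where "n2 = n1 + Suc (2 * (nth_prime r + 1))"
  from Loop.IH[of n2] Loop.prems obtain m where m: "n2 \<le> m" "\<And>e. \<exists>Q. code_in n2 m Q \<and> compiles k c n2 e Q" by auto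
  have "\<exists>Q. code_in n m Q \<and> compiles k (Loop r c) n e Q" for e
  proof -
    from m(2)[of n] obtain Q where Q: "code_in n2 m Q" "compiles k c n2 n Q" by blast
    let ?T = "test_block (nth_prime r) n n1 e" and ?D = "loop_block (nth_prime r) 1 n1 n2"
    have TD: "code_in n n1 ?T" "code_in n1 n2 ?D"
      by (auto simp: test_block_def loop_block_def n1_def n2_def code_in_block)
    have "code_in n m (?T \<union> (?D \<union> Q))"
      by (rule code_in_Un[OF TD(1) code_in_Un[OF TD(2) Q(1)]]) (use m(1) in \<open>auto simp: n1_def n2_def\<close>)
    moreover have "compiles k (Loop r c) n e (?T \<union> (?D \<union> Q))"
      by (rule compiles_Loop[where ?n1.0 = n1 and ?n2.0 = n2])
        (use Loop.prems compiles_mono[OF Q(2), of "?T \<union> (?D \<union> Q)"] in auto)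
    ultimately show ?thesis by blast
  qed
  then show ?case using m(1) by (intro exI[of _ m]) (auto simp: n1_def n2_def)
qed

section \<open>Plays and limit costs\<close>

lemma cur_snoc: "cur (a, xs @ [(t, i, \<epsilon>, s)]) = s"
  by (simp add: cur_def)

lemma play_cost_snoc:
  "play_cost A (a, xs @ [(t, i, \<epsilon>, s)]) = play_cost A (a, xs) + (t + \<epsilon>) * of_int (prices A ! fst (edges A ! i))"
  by (simp add: play_cost_def)

definition allowed :: "rpta \<Rightarrow> real \<Rightarrow> nat \<Rightarrow> valuation \<Rightarrow> real \<Rightarrow> edge \<Rightarrow> bool" where
  "allowed A \<delta> l \<nu> t e \<longleftrightarrow>
     e \<in> set (edges A) \<and> fst e = l \<and> \<delta> \<le> t \<and> sat_guard (\<lambda>x. \<nu> x + t) (fst (snd e))"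

lemma step_SomeE:
  assumes "step A \<delta> \<sigma>1 \<sigma>2 h = Some h'"
  obtains l \<nu> t i g r d \<epsilon> where "cur h = (Loc l, \<nu>)" "\<sigma>1 h = (t, i)" "edges A ! i = (l, g, r, d)"
    "allowed A \<delta> l \<nu> t (l, g, r, d)" "\<epsilon> = \<sigma>2 h (\<sigma>1 h)"
    "cur h' = (d, reset r (\<lambda>x. \<nu> x + t + \<epsilon>))"
    "play_cost A h' = play_cost A h + (t + \<epsilon>) * of_int (prices A ! l)"
    "length (snd h') = Suc (length (snd h))"
proof -
  obtain n \<nu> where c: "cur h = (n, \<nu>)" by (cases "cur h")
  obtain t i where s: "\<sigma>1 h = (t, i)" by (cases "\<sigma>1 h")
  obtain l' g r d where e: "edges A ! i = (l', g, r, d)" by (cases "edges A ! i")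
  obtain l where n: "n = Loc l" using assms c by (cases n) (auto simp: step_def)
  define \<epsilon> where "\<epsilon> = \<sigma>2 h (t, i)"
  have i: "i < length (edges A)" "l' = l" "\<delta> \<le> t" "sat_guard (\<lambda>x. \<nu> x + t) g"
    and h': "h' = (fst h, snd h @ [(t, i, \<epsilon>, (d, reset r (\<lambda>x. \<nu> x + t + \<epsilon>)))])"
    using assms by (simp_all add: step_def c n s e Let_def \<epsilon>_def split: if_splits)
  show ?thesis
  proof (rule that)
    show "cur h = (Loc l, \<nu>)" "\<sigma>1 h = (t, i)" "edges A ! i = (l, g, r, d)" using c n s e i(2) by simp_all
    have "(l, g, r, d) \<in> set (edges A)" using i(1,2) e nth_mem by fastforce
    then show "allowed A \<delta> l \<nu> t (l, g, r, d)" using i(3,4) by (simp add: allowed_def)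
    show "\<epsilon> = \<sigma>2 h (\<sigma>1 h)" by (simp add: \<epsilon>_def s)
    show "cur h' = (d, reset r (\<lambda>x. \<nu> x + t + \<epsilon>))" by (simp add: h' cur_snoc)
    show "play_cost A h' = play_cost A h + (t + \<epsilon>) * of_int (prices A ! l)"
      using play_cost_snoc[of A "fst h" "snd h"] by (simp add: h' e i(2))
    show "length (snd h') = Suc (length (snd h))" by (simp add: h')
  qed
qed

lemma step_NoneD:
  assumes "step A \<delta> \<sigma>1 \<sigma>2 h = None" "cur h = (Loc l, \<nu>)" "\<sigma>1 h = (t, i)" "i < length (edges A)"
  shows "\<not> allowed A \<delta> l \<nu> t (edges A ! i)"
  using assms by (auto simp: step_def allowed_def Let_def split: if_splits)

lemma step_target: "is_tgt (fst (cur h)) \<Longrightarrow> step A \<delta> \<sigma>1 \<sigma>2 h = None"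
  by (cases "cur h"; cases "fst (cur h)") (auto simp: step_def)

lemma run_length: "run A \<delta> s \<sigma>1 \<sigma>2 n = Some h \<Longrightarrow> length (snd h) = n"
proof (induction n arbitrary: h)
  case (Suc n)
  then obtain h0 where "run A \<delta> s \<sigma>1 \<sigma>2 n = Some h0" "step A \<delta> \<sigma>1 \<sigma>2 h0 = Some h" by (auto split: option.splits)
  then show ?case using Suc.IH by (auto elim!: step_SomeE)
qed auto

lemma run_None_mono: "run A \<delta> s \<sigma>1 \<sigma>2 n = None \<Longrightarrow> n \<le> m \<Longrightarrow> run A \<delta> s \<sigma>1 \<sigma>2 m = None"
  by (induction m) (auto simp: le_Suc_eq)

text \<open>A smaller \<delta> only relaxes the lower bound on delays, and the controller does not
  see it; the perturbator is consulted only on histories shorter than \<open>n\<close>. So a finite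
  play found for one \<delta> can be reused, with a deviation planted at its end.\<close>

lemma run_cong:
  assumes "run A \<delta> s \<sigma>1 \<sigma>2 n = Some h" "\<delta>' \<le> \<delta>"
    and "\<And>h' m. length (snd h') < n \<Longrightarrow> \<sigma>2' h' m = \<sigma>2 h' m"
  shows "run A \<delta>' s \<sigma>1 \<sigma>2' n = Some h"
  using assms(1,3)
proof (induction n arbitrary: h)
  case (Suc n)
  then obtain h0 where h0: "run A \<delta> s \<sigma>1 \<sigma>2 n = Some h0" "step A \<delta> \<sigma>1 \<sigma>2 h0 = Some h" by (auto split: option.splits)
  with Suc have "run A \<delta>' s \<sigma>1 \<sigma>2' n = Some h0" by simp
  moreover have "step A \<delta>' \<sigma>1 \<sigma>2' h0 = Some h"
    using h0(2) assms(2) Suc.prems(2)[of h0] run_length[OF h0(1)]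
    by (auto simp: step_def split: node.splits prod.splits if_splits)
  ultimately show ?case by simp
qed simp

lemma reaches_at_unique:
  assumes "reaches_at A \<delta> s \<sigma>1 \<sigma>2 n" "reaches_at A \<delta> s \<sigma>1 \<sigma>2 m"
  shows "n = m"
proof -
  have "\<not> a < b" if ab: "reaches_at A \<delta> s \<sigma>1 \<sigma>2 a" "reaches_at A \<delta> s \<sigma>1 \<sigma>2 b" for a b
  proof
    assume "a < b"
    from ab(1) have "run A \<delta> s \<sigma>1 \<sigma>2 (Suc a) = None" by (auto simp: reaches_at_def step_target)
    then have "run A \<delta> s \<sigma>1 \<sigma>2 b = None" by (rule run_None_mono) (use \<open>a < b\<close> in auto)
    with ab(2) show False by (auto simp: reaches_at_def)
  qed
  then show ?thesis using assms by (meson linorder_neqE_nat)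
qed

lemma cost_reached:
  assumes "run A \<delta> s \<sigma>1 \<sigma>2 n = Some h" "is_tgt (fst (cur h))"
  shows "cost A \<delta> s \<sigma>1 \<sigma>2 = ereal (play_cost A h)"
proof -
  have r: "reaches_at A \<delta> s \<sigma>1 \<sigma>2 n" using assms by (auto simp: reaches_at_def)
  then have "(LEAST n. reaches_at A \<delta> s \<sigma>1 \<sigma>2 n) = n"
    using LeastI[of "reaches_at A \<delta> s \<sigma>1 \<sigma>2" n] reaches_at_unique[OF _ r] by blast
  then show ?thesis using r assms(1) by (auto simp: cost_def)
qed

lemma cost_finiteE:
  assumes "cost A \<delta> s \<sigma>1 \<sigma>2 \<le> ereal c"
  obtains n h where "run A \<delta> s \<sigma>1 \<sigma>2 n = Some h" "is_tgt (fst (cur h))" "play_cost A h \<le> c"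
proof -
  have "\<exists>n. reaches_at A \<delta> s \<sigma>1 \<sigma>2 n" using assms by (auto simp: cost_def split: if_splits)
  then obtain n h where "run A \<delta> s \<sigma>1 \<sigma>2 n = Some h" "is_tgt (fst (cur h))" by (auto simp: reaches_at_def)
  moreover from this have "play_cost A h \<le> c" using assms cost_reached[of A \<delta> s \<sigma>1 \<sigma>2 n h] by simp
  ultimately show ?thesis using that by blast
qed

lemma cost_mono:
  assumes "\<delta>' \<le> \<delta>"
  shows "cost A \<delta>' s \<sigma>1 \<sigma>2 \<le> cost A \<delta> s \<sigma>1 \<sigma>2"
proof (cases "\<exists>n. reaches_at A \<delta> s \<sigma>1 \<sigma>2 n")
  case True
  then obtain n h where "run A \<delta> s \<sigma>1 \<sigma>2 n = Some h" "is_tgt (fst (cur h))" by (auto simp: reaches_at_def)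
  moreover from this have "run A \<delta>' s \<sigma>1 \<sigma>2 n = Some h" using run_cong[OF _ assms] by blast
  ultimately show ?thesis by (simp add: cost_reached)
qed (simp add: cost_def)

lemma pert_strats_mono: "\<delta>' \<le> \<delta> \<Longrightarrow> pert_strats \<delta>' \<subseteq> pert_strats \<delta>"
proof
  fix \<sigma>2 assume "\<delta>' \<le> \<delta>" "\<sigma>2 \<in> pert_strats \<delta>'"
  then have "\<bar>\<sigma>2 h m\<bar> \<le> \<delta>" for h m unfolding pert_strats_def using order_trans by blast
  then show "\<sigma>2 \<in> pert_strats \<delta>" by (simp add: pert_strats_def)
qed

text \<open>Both the set of perturbation strategies and the cost against each of them grow with
  \<delta>, so the supremum is monotone and its limit from the right at 0 is an infimum.\<close>

lemma limcost_eq_INF: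
  "limcost A s \<sigma>1 = (INF \<delta>\<in>{0<..}. SUP \<sigma>2\<in>pert_strats \<delta>. cost A \<delta> s \<sigma>1 \<sigma>2)"
proof -
  let ?F = "\<lambda>\<delta>. SUP \<sigma>2\<in>pert_strats \<delta>. cost A \<delta> s \<sigma>1 \<sigma>2"
  have mono: "?F \<delta>' \<le> ?F \<delta>" if "\<delta>' \<le> \<delta>" for \<delta>' \<delta>
    by (rule SUP_subset_mono[OF pert_strats_mono[OF that] cost_mono[OF that]])
  have "(?F \<longlongrightarrow> (INF \<delta>\<in>{0<..}. ?F \<delta>)) (at_right 0)"
  proof (rule decreasing_tendsto)
    show "\<forall>\<^sub>F \<delta> in at_right 0. (INF \<delta>\<in>{0<..}. ?F \<delta>) \<le> ?F \<delta>"
      by (auto simp: eventually_at_right_less intro!: eventually_mono[OF eventually_at_right_less] INF_lower)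
  next
    fix c assume "(INF \<delta>\<in>{0<..}. ?F \<delta>) < c"
    then obtain \<delta>0 where d: "0 < \<delta>0" "?F \<delta>0 < c" by (auto simp: INF_less_iff)
    have "\<forall>\<^sub>F \<delta> in at_right 0. \<delta> < \<delta>0"
      using d(1) by (auto simp: eventually_at_right_field)
    then show "\<forall>\<^sub>F \<delta> in at_right 0. ?F \<delta> < c"
      by eventually_elim (use mono d(2) in \<open>meson less_imp_le order_le_less_trans\<close>)
  qed
  then show ?thesis unfolding limcost_def by (intro tendsto_Lim) auto
qed

lemma limcost_le_imp:
  assumes "limcost A s \<sigma>1 \<le> ereal c" "0 < \<eta>"
  obtains \<delta>0 where "0 < \<delta>0"
    "\<And>\<delta> \<sigma>2. \<delta> \<le> \<delta>0 \<Longrightarrow> \<sigma>2 \<in> pert_strats \<delta> \<Longrightarrow> cost A \<delta> s \<sigma>1 \<sigma>2 \<le> ereal (c + \<eta>)"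
proof -
  have "limcost A s \<sigma>1 < ereal (c + \<eta>)" using assms by (auto intro: order_le_less_trans)
  then obtain \<delta>0 where d: "0 < \<delta>0" "(SUP \<sigma>2\<in>pert_strats \<delta>0. cost A \<delta>0 s \<sigma>1 \<sigma>2) < ereal (c + \<eta>)"
    by (auto simp: limcost_eq_INF INF_less_iff)
  have "cost A \<delta> s \<sigma>1 \<sigma>2 \<le> ereal (c + \<eta>)" if "\<delta> \<le> \<delta>0" "\<sigma>2 \<in> pert_strats \<delta>" for \<delta> \<sigma>2
  proof -
    have "\<sigma>2 \<in> pert_strats \<delta>0" using that pert_strats_mono[OF that(1)] by blast
    then have "cost A \<delta>0 s \<sigma>1 \<sigma>2 \<le> (SUP \<sigma>2\<in>pert_strats \<delta>0. cost A \<delta>0 s \<sigma>1 \<sigma>2)" by (rule SUP_upper)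
    then show ?thesis using cost_mono[OF that(1)] d(2) by (meson less_imp_le order_trans)
  qed
  then show ?thesis using that d(1) by blast
qed

lemma limcost_leI:
  assumes "0 < \<delta>0" "\<And>\<delta> \<sigma>2. 0 < \<delta> \<Longrightarrow> \<delta> \<le> \<delta>0 \<Longrightarrow> \<sigma>2 \<in> pert_strats \<delta> \<Longrightarrow> cost A \<delta> s \<sigma>1 \<sigma>2 \<le> ereal (c + C * \<delta>)"
    and "0 < C"
  shows "limcost A s \<sigma>1 \<le> ereal c"
proof (rule ereal_le_epsilon2)
  fix e :: real assume "0 < e"
  define \<delta> where "\<delta> = min \<delta>0 (e / C)"
  have d: "0 < \<delta>" "\<delta> \<le> \<delta>0" "C * \<delta> \<le> e" using \<open>0 < e\<close> assms by (auto simp: \<delta>_def min_def field_simps)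
  have "limcost A s \<sigma>1 \<le> (SUP \<sigma>2\<in>pert_strats \<delta>. cost A \<delta> s \<sigma>1 \<sigma>2)"
    unfolding limcost_eq_INF by (rule INF_lower) (use d in auto)
  also have "\<dots> \<le> ereal (c + C * \<delta>)" by (rule SUP_least) (use assms(2) d in auto)
  also have "\<dots> \<le> ereal c + ereal e" using d by simp
  finally show "limcost A s \<sigma>1 \<le> ereal c + ereal e" .
qed

text \<open>A stopped play never resumes, so a play that reaches a target has made a move from each
  earlier position. This is how a finite cost forces the controller to keep moving.\<close>

lemma run_progress:
  assumes "run A \<delta> s \<sigma>1 \<sigma>2 N = Some hN" "is_tgt (fst (cur hN))"
    and "run A \<delta> s \<sigma>1 \<sigma>2 n = Some h" "\<not> is_tgt (fst (cur h))"
  obtains h' where "run A \<delta> s \<sigma>1 \<sigma>2 (Suc n) = Some h'" "step A \<delta> \<sigma>1 \<sigma>2 h = Some h'"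
proof -
  have "run A \<delta> s \<sigma>1 \<sigma>2 (Suc N) = None" using assms(1,2) by (simp add: step_target)
  then have "n \<le> N" using assms(3) run_None_mono[of A \<delta> s \<sigma>1 \<sigma>2 "Suc N" n] by (cases "n \<le> N") auto
  moreover have "n \<noteq> N" using assms by auto
  ultimately have "run A \<delta> s \<sigma>1 \<sigma>2 (Suc n) \<noteq> None"
    using assms(1) run_None_mono[of A \<delta> s \<sigma>1 \<sigma>2 "Suc n" N] by (metis Suc_leI le_neq_implies_less option.distinct(1))
  then obtain h' where "run A \<delta> s \<sigma>1 \<sigma>2 (Suc n) = Some h'" by blast
  then show ?thesis using that assms(3) by simp
qed

section \<open>The automaton\<close>

text \<open>In mode \<open>m < 3\<close> the clocks \<open>m\<close> and \<open>qclk m\<close> hold the front counter (offset by the period 8) and the back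
  counter, and \<open>fclk m\<close> is reset to receive the new front value; the mode then advances to \<open>qclk m\<close>. Clock 3
  measures the phase, and clock 4 the unit delay after which a perturbation is detected.\<close>

definition fclk :: "nat \<Rightarrow> nat" where "fclk m = (m + 2) mod 3"
definition qclk :: "nat \<Rightarrow> nat" where "qclk m = (m + 1) mod 3"

text \<open>Triples (rate, clock, bound): stay at a location of price \<open>rate\<close> until the clock reaches the bound. A
  check starts with the new value \<open>u'\<close> on \<open>fclk m\<close>, \<open>16 + u\<close> on \<open>m\<close> and 8 on clock 3. No clock is reset, so
  perturbations do not accumulate; the bounds make the events occur in the listed order, at an honest total cost of 11.\<close>

fun check_seq :: "op \<Rightarrow> nat \<Rightarrow> nat \<Rightarrow> (nat \<times> nat \<times> int) list" where
  "check_seq Keep s m = (if s = 0 then [(0, fclk m, 6), (1, m, 33)] else [(0, m, 22), (1, fclk m, 17)])"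
| "check_seq Up s m = (if s = 0 then [(0, fclk m, 6), (1, m, 28), (0, fclk m, 18), (1, 3, 30)]
     else [(1, fclk m, 6), (0, m, 28), (1, fclk m, 18)])"
| "check_seq Down s m = (if s = 0 then [(1, m, 22), (0, fclk m, 12), (1, m, 34)]
     else [(0, m, 22), (1, fclk m, 12), (0, m, 34), (1, 3, 30)])"

fun op_num :: "op \<Rightarrow> nat" where
  "op_num Keep = 0" | "op_num Up = 1" | "op_num Down = 2"

text \<open>A mixed-radix numeral with digits for operation, sign, mode and position, and the price
  as lowest bit; there are \<open>3 * 2 * 3 * 4 * 2 = 144\<close> such numerals.\<close>

definition check_loc :: "op \<Rightarrow> nat \<Rightarrow> nat \<Rightarrow> nat \<Rightarrow> nat" where
  "check_loc f s m k = 2 * (((op_num f * 2 + s) * 3 + m) * 4 + k) + fst (check_seq f s m ! k)"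

text \<open>The price of a location is the parity of its number: check locations are those below 144.\<close>

definition main_loc :: "nat \<Rightarrow> nat \<Rightarrow> nat \<Rightarrow> nat" where
  "main_loc l m ph = 148 + 2 * (9 * l + 3 * m + ph)"

definition check_edge :: "op \<Rightarrow> nat \<Rightarrow> nat \<Rightarrow> nat \<Rightarrow> edge" where
  "check_edge f s m k = (case check_seq f s m ! k of (_, x, c) \<Rightarrow>
     (check_loc f s m k, [(x, CEq, c)], [],
      if Suc k < length (check_seq f s m) then Loc (check_loc f s m (Suc k)) else Tgt 0))"

definition check_edges :: "edge list" where
  "check_edges = concat (map (\<lambda>(f, s, m). map (check_edge f s m) [0..<length (check_seq f s m)])
     (List.product [Keep, Up, Down] (List.product [0, 1] [0, 1, 2])))"

text \<open>Label 0 is the halting label. Clock 3 reads 0 on arrival, so waiting for 1 gives a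
  forced delay that is admissible whenever \<delta> is at most 1.\<close>

definition goal_edge :: "nat \<Rightarrow> edge" where
  "goal_edge m = (main_loc 0 m 0, [(3, CEq, 1)], [], Tgt 0)"

text \<open>Clock 1 was reset when clock 0 read 8. Hence at 13 they hold \<open>8 + 5\<close> and
  \<open>5\<close>, the front and back values of two empty counters in mode 0.\<close>

definition start_edge :: "nat \<Rightarrow> edge" where
  "start_edge l = (146, [(0, CEq, 13)], [3], Loc (main_loc l 0 0))"

definition common_edges :: "edge list" where
  "common_edges = (144, [(0, CEq, 8)], [1], Loc 146) # map goal_edge [0, 1, 2] @ check_edges"

text \<open>Only the first edge leaves the delay open; it is the guess. At the end clock 3 reads 8
  plus the perturbation made at time 7, so its three guards let the perturbator decide between
  simulation and check. The threshold 12 separates an empty back counter, read as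
  \<open>8 + 5\<close>, from a positive one, read as at most \<open>8 + 3\<close>.\<close>

definition phase_edges :: "instr \<Rightarrow> nat \<Rightarrow> edge list" where
  "phase_edges q m = (case q of (l, f, j, k) \<Rightarrow>
    [(main_loc l m 0, [], [fclk m], Loc (main_loc l m 1)),
     (main_loc l m 1, [(3, CEq, 7)], [4], Loc (main_loc l m 2)),
     (main_loc l m 2, [(4, CEq, 1), (3, CEq, 8), (qclk m, CGt, 12)], [3], Loc (main_loc j (qclk m) 0)),
     (main_loc l m 2, [(4, CEq, 1), (3, CEq, 8), (qclk m, CLt, 12)], [3], Loc (main_loc k (qclk m) 0)),
     (main_loc l m 2, [(4, CEq, 1), (3, CGt, 8)], [], Loc (check_loc f 0 m 0)),
     (main_loc l m 2, [(4, CEq, 1), (3, CLt, 8)], [], Loc (check_loc f 1 m 0))])"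

definition instr_edges :: "instr \<Rightarrow> edge list" where
  "instr_edges q = phase_edges q 0 @ phase_edges q 1 @ phase_edges q 2"

section \<open>Injectivity of the location numbering\<close>

lemma main_loc_inject:
  assumes "m < 3" "ph < 3" "m' < 3" "ph' < 3" "main_loc l m ph = main_loc l' m' ph'"
  shows "l = l' \<and> m = m' \<and> ph = ph'"
proof -
  have split: "x = y \<and> i = j" if "3 * x + i = 3 * y + j" "i < 3" "j < 3" for x y i j :: nat
    using that by presburger
  have "3 * (3 * l + m) + ph = 3 * (3 * l' + m') + ph'" using assms(5) by (simp add: main_loc_def)
  from split[OF this assms(2,4)] split[of l m l' m'] assms(1,3) show ?thesis by blast
qed

lemma length_check_seq: "length (check_seq f s m) \<le> 4" "0 < length (check_seq f s m)"
  by (cases f; simp)+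

lemma check_rate: "k < length (check_seq f s m) \<Longrightarrow> fst (check_seq f s m ! k) < 2"
  by (cases f) (auto simp: less_Suc_eq numeral_eq_Suc split: if_splits)

lemma op_num_inject: "op_num f = op_num f' \<Longrightarrow> f = f'"
  by (cases f; cases f') auto

lemma check_loc_inject:
  assumes "s < 2" "m < 3" "k < length (check_seq f s m)"
    and "s' < 2" "m' < 3" "k' < length (check_seq f' s' m')"
    and "check_loc f s m k = check_loc f' s' m' k'"
  shows "f = f' \<and> s = s' \<and> m = m' \<and> k = k'"
proof -
  have k: "k < 4" "k' < 4" using assms(3,6) length_check_seq(1) order_less_le_trans by blast+
  define x y where "x = (op_num f * 2 + s) * 3 + m" and "y = (op_num f' * 2 + s') * 3 + m'"
  have split: "u = v \<and> i = j" if "u * d + i = v * d + j" "i < d" "j < d" for u v i j d :: nat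
  proof -
    have "(u * d + i) div d = u" "(v * d + j) div d = v" "(u * d + i) mod d = i" "(v * d + j) mod d = j"
      using that(2,3) by simp_all
    then show ?thesis using that(1) by metis
  qed
  have "(x * 4 + k) * 2 + fst (check_seq f s m ! k) = (y * 4 + k') * 2 + fst (check_seq f' s' m' ! k')"
    using assms(7) by (simp add: check_loc_def x_def y_def)
  from split[OF this check_rate[OF assms(3)] check_rate[OF assms(6)]] have eq: "x * 4 + k = y * 4 + k'" by blast
  have xy: "x = y" "k = k'" using split[OF eq k] by simp_all
  have fm: "op_num f * 2 + s = op_num f' * 2 + s'" "m = m'"
    using split[OF xy(1)[unfolded x_def y_def] assms(2,5)] by simp_all
  have "op_num f = op_num f'" "s = s'" using split[OF fm(1) assms(1,4)] by simp_all
  then show ?thesis using op_num_inject xy fm by blast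
qed

lemma check_loc_less:
  assumes "s < 2" "m < 3" "k < length (check_seq f s m)"
  shows "check_loc f s m k < 144"
proof -
  have "op_num f \<le> 2" by (cases f) auto
  moreover have "k < 4" using assms(3) length_check_seq(1) order_less_le_trans by blast
  then have "k \<le> 3" by simp
  moreover have "s \<le> 1" "m \<le> 2" "fst (check_seq f s m ! k) \<le> 1" using assms check_rate[OF assms(3)] by simp_all
  moreover have "2 * (((a * 2 + b) * 3 + c) * 4 + d) + e < 144"
    if "a \<le> 2" "b \<le> 1" "c \<le> 2" "d \<le> 3" "e \<le> 1" for a b c d e :: nat
    using that by (simp add: algebra_simps)
  ultimately show ?thesis unfolding check_loc_def by blast
qed

lemma main_loc_ge: "148 \<le> main_loc l m ph"
  by (simp add: main_loc_def)

lemma set_check_edges: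
  "e \<in> set check_edges \<longleftrightarrow> (\<exists>f s m k. s < 2 \<and> m < 3 \<and> k < length (check_seq f s m) \<and> e = check_edge f s m k)"
proof -
  have "set (List.product [Keep, Up, Down] (List.product [0, 1] [0, 1, 2])) = {(f, s :: nat, m :: nat). s < 2 \<and> m < 3}"
  proof (rule set_eqI)
    fix x :: "op \<times> nat \<times> nat"
    obtain f s m where "x = (f, s, m)" by (cases x)
    then show "x \<in> set (List.product [Keep, Up, Down] (List.product [0, 1] [0, 1, 2])) \<longleftrightarrow>
        x \<in> {(f, s, m). s < 2 \<and> m < 3}"
      by (cases f) auto
  qed
  then have "set check_edges = (\<Union>(f, s, m)\<in>{(f, s, m). s < 2 \<and> m < 3}. check_edge f s m ` {..<length (check_seq f s m)})"
    unfolding check_edges_def set_concat set_map by (simp add: image_image case_prod_unfold atLeast0LessThan)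
  then show ?thesis by (simp add: image_iff) blast
qed

lemma ex_less_3: "(\<exists>m<3. P m) \<longleftrightarrow> P 0 \<or> P 1 \<or> P (2::nat)"
  by (auto simp: less_Suc_eq numeral_3_eq_3 numeral_2_eq_2)

text \<open>The edges are fixed only as a set, which separates the game argument from the list order
  chosen for the encoding. Later \<open>Q\<close> joins a compiled machine with the chain that loads
  its input.\<close>

locale swap_game =
  fixes A :: rpta and Q :: "instr set" and start :: nat
  assumes edges_A: "set (edges A) = insert (start_edge start) (set common_edges) \<union> (\<Union>q\<in>Q. set (instr_edges q))"
    and single_valued_Q: "single_valued Q"
    and goal_not_in_Q: "0 \<notin> Domain Q"
    and prices_A: "\<And>e. e \<in> set (edges A) \<Longrightarrow> prices A ! fst e = (if odd (fst e) then 1 else 0)"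
begin

section \<open>Edges available at each location\<close>

lemma edge_cases:
  assumes "e \<in> set (edges A)"
  obtains "e = (144, [(0, CEq, 8)], [1], Loc 146)" | "e = start_edge start"
  | m where "m < 3" "e = goal_edge m"
  | f s m k where "s < 2" "m < 3" "k < length (check_seq f s m)" "e = check_edge f s m k"
  | q m where "q \<in> Q" "m < 3" "e \<in> set (phase_edges q m)"
proof -
  have "e = (144, [(0, CEq, 8)], [1], Loc 146) \<or> e = start_edge start \<or> (\<exists>m<3. e = goal_edge m) \<or>
      e \<in> set check_edges \<or> (\<exists>q\<in>Q. \<exists>m<3. e \<in> set (phase_edges q m))"
    using assms unfolding edges_A common_edges_def instr_edges_def ex_less_3 by auto
  then show ?thesis using that unfolding set_check_edges by blast
qed

lemma fst_check_edge: "fst (check_edge f s m k) = check_loc f s m k"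
  by (simp add: check_edge_def case_prod_unfold)

lemma phase_edge_source:
  assumes "e \<in> set (phase_edges (l, f, j, k) m)"
  obtains ph where "ph < 3" "fst e = main_loc l m ph"
  using assms that[of 0] that[of 1] that[of 2] by (auto simp: phase_edges_def)

lemma edge_from_main:
  assumes "e \<in> set (edges A)" "fst e = main_loc l m ph" "m < 3" "ph < 3"
  shows "(l = 0 \<and> e = goal_edge m) \<or> (\<exists>f j k. (l, f, j, k) \<in> Q \<and> e \<in> set (phase_edges (l, f, j, k) m))"
  using assms(1)
proof (cases rule: edge_cases)
  case (3 m')
  then show ?thesis using assms(2-4) main_loc_inject[of m' 0 m ph 0 l] by (auto simp: goal_edge_def)
next
  case (4 f s m' k)
  then show ?thesis using assms(2) check_loc_less[of s m' k f] main_loc_ge[of l m ph] by (simp add: fst_check_edge)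
next
  case (5 q m')
  obtain l' f j k where q: "q = (l', f, j, k)" by (cases q)
  from 5(3) obtain ph' where "ph' < 3" "fst e = main_loc l' m' ph'" unfolding q by (rule phase_edge_source)
  with assms(2-4) 5(2) have "l' = l" "m' = m" using main_loc_inject by metis+
  then show ?thesis using 5 q by blast
qed (use assms(2) main_loc_ge[of l m ph] in \<open>auto simp: start_edge_def\<close>)

lemma edge_from_instr:
  assumes "e \<in> set (edges A)" "fst e = main_loc l m ph" "m < 3" "ph < 3" "(l, f, j, k) \<in> Q"
  shows "e \<in> set (phase_edges (l, f, j, k) m)"
proof -
  have "l \<noteq> 0" using goal_not_in_Q DomainI[OF assms(5)] by metis
  then obtain f' j' k' where q: "(l, f', j', k') \<in> Q" "e \<in> set (phase_edges (l, f', j', k') m)"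
    using edge_from_main[OF assms(1-4)] by blast
  have "(f', j', k') = (f, j, k)" by (rule single_valuedD[OF single_valued_Q q(1) assms(5)])
  then show ?thesis using q(2) by simp
qed

lemma edge_from_check:
  assumes "e \<in> set (edges A)" "fst e = check_loc f s m k" "s < 2" "m < 3" "k < length (check_seq f s m)"
  shows "e = check_edge f s m k"
proof -
  have less: "check_loc f s m k < 144" by (rule check_loc_less[OF assms(3-5)])
  show ?thesis using assms(1)
  proof (cases rule: edge_cases)
    case (4 f' s' m' k')
    then have "f' = f \<and> s' = s \<and> m' = m \<and> k' = k"
      using assms(2) by (intro check_loc_inject[OF 4(1-3) assms(3-5)]) (simp add: fst_check_edge)
    then show ?thesis using 4 by simp
  next
    case (5 q m')
    obtain l' f' j' k' where q: "q = (l', f', j', k')" by (cases q)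
    from 5(3) obtain ph' where "fst e = main_loc l' m' ph'" unfolding q by (rule phase_edge_source)
    then show ?thesis using less assms(2) main_loc_ge[of l' m' ph'] by simp
  next
    case (3 m')
    then show ?thesis using less assms(2) main_loc_ge[of 0 m' 0] by (simp add: goal_edge_def)
  qed (use less assms(2) in \<open>auto simp: start_edge_def\<close>)
qed

lemma edge_from_init:
  assumes "e \<in> set (edges A)"
  shows "fst e = 144 \<Longrightarrow> e = (144, [(0, CEq, 8)], [1], Loc 146)" "fst e = 146 \<Longrightarrow> e = start_edge start"
proof -
  have "e = (144, [(0, CEq, 8)], [1], Loc 146) \<or> e = start_edge start \<or> fst e < 144 \<or> fst e > 146"
    using assms
  proof (cases rule: edge_cases)
    case (3 m')
    then show ?thesis using main_loc_ge[of 0 m' 0] by (simp add: goal_edge_def)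
  next
    case (4 f s m k)
    then show ?thesis using check_loc_less[of s m k f] by (simp add: fst_check_edge)
  next
    case (5 q m')
    obtain l' f' j' k' where q: "q = (l', f', j', k')" by (cases q)
    from 5(3) obtain ph' where "fst e = main_loc l' m' ph'" unfolding q by (rule phase_edge_source)
    then show ?thesis using main_loc_ge[of l' m' ph'] by simp
  qed auto
  then show "fst e = 144 \<Longrightarrow> e = (144, [(0, CEq, 8)], [1], Loc 146)" "fst e = 146 \<Longrightarrow> e = start_edge start"
    by (auto simp: start_edge_def)
qed

lemma instr_edge_mem:
  "q \<in> Q \<Longrightarrow> m < 3 \<Longrightarrow> e \<in> set (phase_edges q m) \<Longrightarrow> e \<in> set (edges A)"
  unfolding edges_A instr_edges_def
  using ex_less_3[of "\<lambda>i. m = i"] by (intro UnI2 UN_I[of q]) auto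

lemma check_edge_mem:
  "s < 2 \<Longrightarrow> m < 3 \<Longrightarrow> k < length (check_seq f s m) \<Longrightarrow> check_edge f s m k \<in> set (edges A)"
  unfolding edges_A common_edges_def using set_check_edges by auto

lemma goal_edge_mem: "m < 3 \<Longrightarrow> goal_edge m \<in> set (edges A)"
  unfolding edges_A common_edges_def using ex_less_3[of "\<lambda>i. m = i"] by auto

lemma init_edge_mem: "(144, [(0, CEq, 8)], [1], Loc 146) \<in> set (edges A)" "start_edge start \<in> set (edges A)"
  unfolding edges_A common_edges_def by auto

lemma price_main: "e \<in> set (edges A) \<Longrightarrow> fst e = main_loc l m ph \<Longrightarrow> prices A ! main_loc l m ph = 0"
  using prices_A[of e] by (simp add: main_loc_def)

lemma price_check:
  assumes "s < 2" "m < 3" "k < length (check_seq f s m)"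
  shows "prices A ! check_loc f s m k = int (fst (check_seq f s m ! k))"
proof -
  have "fst (check_seq f s m ! k) = 0 \<or> fst (check_seq f s m ! k) = 1" using check_rate[OF assms(3)] by auto
  then show ?thesis
    using prices_A[OF check_edge_mem[OF assms]] unfolding fst_check_edge by (auto simp: check_loc_def)
qed

end

text \<open>The last two equations are the handover to mode \<open>qclk m\<close>: the fresh clock
  becomes the back clock, and the old front clock becomes the one to be reset.\<close>

lemma clocks_distinct:
  assumes "m < 3"
  shows "fclk m < 3" "qclk m < 3" "fclk m \<noteq> m" "qclk m \<noteq> m" "fclk m \<noteq> qclk m"
    "qclk (qclk m) = fclk m" "fclk (qclk m) = m"
proof -
  have "m = 0 \<or> m = 1 \<or> m = 2" using assms by auto
  then show "fclk m < 3" "qclk m < 3" "fclk m \<noteq> m" "qclk m \<noteq> m" "fclk m \<noteq> qclk m"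
    "qclk (qclk m) = fclk m" "fclk (qclk m) = m"
    by (elim disjE; simp add: fclk_def qclk_def)+
qed

context swap_game
begin

section \<open>Inversion of single moves\<close>

lemma step_init:
  assumes "step A \<delta> \<sigma>1 \<sigma>2 h = Some h'" "cur h = (Loc 144, \<nu>)"
  shows "\<delta> \<le> 8 - \<nu> 0" "play_cost A h' = play_cost A h"
    "cur h' = (Loc 146, \<lambda>x. if x = 1 then 0 else \<nu> x + (8 - \<nu> 0) + \<sigma>2 h (\<sigma>1 h))"
proof -
  obtain l \<nu>' t i g r d \<epsilon> where *: "cur h = (Loc l, \<nu>')" "\<sigma>1 h = (t, i)" "allowed A \<delta> l \<nu>' t (l, g, r, d)" "\<epsilon> = \<sigma>2 h (\<sigma>1 h)"
    "cur h' = (d, reset r (\<lambda>x. \<nu>' x + t + \<epsilon>))"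
    "play_cost A h' = play_cost A h + (t + \<epsilon>) * of_int (prices A ! l)"
    using assms(1) by (rule step_SomeE)
  have l: "l = 144" "\<nu>' = \<nu>" using *(1) assms(2) by simp_all
  have e: "(l, g, r, d) = (144, [(0, CEq, 8)], [1], Loc 146)"
    by (rule edge_from_init(1)) (use *(3) l in \<open>auto simp: allowed_def\<close>)
  have "prices A ! l = 0" using prices_A[OF init_edge_mem(1)] l by simp
  moreover have t: "t = 8 - \<nu> 0" "\<delta> \<le> t" using *(3) e l by (simp_all add: allowed_def sat_guard_def)
  ultimately show "\<delta> \<le> 8 - \<nu> 0" "play_cost A h' = play_cost A h"
     "cur h' = (Loc 146, \<lambda>x. if x = 1 then 0 else \<nu> x + (8 - \<nu> 0) + \<sigma>2 h (\<sigma>1 h))"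
    using *(5,6)[unfolded *(4)] e l t by (simp_all add: reset_def)
qed

lemma step_start:
  assumes "step A \<delta> \<sigma>1 \<sigma>2 h = Some h'" "cur h = (Loc 146, \<nu>)"
  shows "\<delta> \<le> 13 - \<nu> 0" "play_cost A h' = play_cost A h"
    "cur h' = (Loc (main_loc start 0 0), \<lambda>x. if x = 3 then 0 else \<nu> x + (13 - \<nu> 0) + \<sigma>2 h (\<sigma>1 h))"
proof -
  obtain l \<nu>' t i g r d \<epsilon> where *: "cur h = (Loc l, \<nu>')" "\<sigma>1 h = (t, i)" "allowed A \<delta> l \<nu>' t (l, g, r, d)" "\<epsilon> = \<sigma>2 h (\<sigma>1 h)"
    "cur h' = (d, reset r (\<lambda>x. \<nu>' x + t + \<epsilon>))"
    "play_cost A h' = play_cost A h + (t + \<epsilon>) * of_int (prices A ! l)"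
    using assms(1) by (rule step_SomeE)
  have l: "l = 146" "\<nu>' = \<nu>" using *(1) assms(2) by simp_all
  have e: "(l, g, r, d) = start_edge start"
    by (rule edge_from_init(2)) (use *(3) l in \<open>auto simp: allowed_def\<close>)
  have "prices A ! l = 0" using prices_A[OF init_edge_mem(2)] l by (simp add: start_edge_def)
  moreover have t: "t = 13 - \<nu> 0" "\<delta> \<le> t" using *(3) e l by (simp_all add: allowed_def sat_guard_def start_edge_def)
  ultimately show "\<delta> \<le> 13 - \<nu> 0" "play_cost A h' = play_cost A h"
     "cur h' = (Loc (main_loc start 0 0), \<lambda>x. if x = 3 then 0 else \<nu> x + (13 - \<nu> 0) + \<sigma>2 h (\<sigma>1 h))"
    using *(5,6)[unfolded *(4)] e l t by (simp_all add: reset_def start_edge_def)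
qed

lemma step_main:
  assumes "step A \<delta> \<sigma>1 \<sigma>2 h = Some h'" "cur h = (Loc (main_loc l m ph), \<nu>)" "m < 3" "ph < 3" "(l, f, j, k) \<in> Q"
  obtains t i g r d where "\<sigma>1 h = (t, i)" "edges A ! i = (main_loc l m ph, g, r, d)"
    "(main_loc l m ph, g, r, d) \<in> set (phase_edges (l, f, j, k) m)"
    "\<delta> \<le> t" "sat_guard (\<lambda>x. \<nu> x + t) g" "play_cost A h' = play_cost A h"
    "cur h' = (d, reset r (\<lambda>x. \<nu> x + t + \<sigma>2 h (\<sigma>1 h)))"
  using assms(1)
proof (rule step_SomeE)
  fix l' \<nu>' t i g r d \<epsilon>
  assume *: "cur h = (Loc l', \<nu>')" "\<sigma>1 h = (t, i)" "edges A ! i = (l', g, r, d)"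
    "allowed A \<delta> l' \<nu>' t (l', g, r, d)" "\<epsilon> = \<sigma>2 h (\<sigma>1 h)"
    "cur h' = (d, reset r (\<lambda>x. \<nu>' x + t + \<epsilon>))"
    "play_cost A h' = play_cost A h + (t + \<epsilon>) * of_int (prices A ! l')"
  have l: "l' = main_loc l m ph" "\<nu>' = \<nu>" using *(1) assms(2) by simp_all
  have e: "(l', g, r, d) \<in> set (phase_edges (l, f, j, k) m)"
    by (rule edge_from_instr[OF _ _ assms(3-5)]) (use *(4) l in \<open>simp_all add: allowed_def\<close>)
  have "prices A ! l' = 0" using price_main[of "(l', g, r, d)"] *(4) l by (auto simp: allowed_def)
  then show thesis
    by (intro that[of t i g r d]) (use * e l in \<open>simp_all add: allowed_def\<close>)
qed

lemma main_loc_phase_neq: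
  "main_loc l m 0 \<noteq> main_loc l m (Suc 0)" "main_loc l m 0 \<noteq> main_loc l m 2" "main_loc l m (Suc 0) \<noteq> main_loc l m 2"
  by (simp_all add: main_loc_def)

lemma step_A:
  assumes "step A \<delta> \<sigma>1 \<sigma>2 h = Some h'" "cur h = (Loc (main_loc l m 0), \<nu>)" "m < 3" "(l, f, j, k) \<in> Q"
  obtains t i r d where "\<sigma>1 h = (t, i)" "edges A ! i = (main_loc l m 0, [], r, d)"
    "\<delta> \<le> t" "play_cost A h' = play_cost A h"
    "cur h' = (Loc (main_loc l m 1), \<lambda>x. if x = fclk m then 0 else \<nu> x + t + \<sigma>2 h (\<sigma>1 h))"
proof (rule step_main[OF assms(1-3) _ assms(4)])
  fix t i g r d
  assume *: "\<sigma>1 h = (t, i)" "edges A ! i = (main_loc l m 0, g, r, d)"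
    "(main_loc l m 0, g, r, d) \<in> set (phase_edges (l, f, j, k) m)"
    "\<delta> \<le> t" "sat_guard (\<lambda>x. \<nu> x + t) g" "play_cost A h' = play_cost A h"
    "cur h' = (d, reset r (\<lambda>x. \<nu> x + t + \<sigma>2 h (\<sigma>1 h)))"
  have e: "g = []" "r = [fclk m]" "d = Loc (main_loc l m 1)"
    using *(3) main_loc_phase_neq[of l m] by (auto simp: phase_edges_def)
  show thesis by (rule that[OF *(1) *(2)[unfolded e] *(4,6)]) (use *(7) e in \<open>simp add: reset_def\<close>)
qed simp

text \<open>Clock 4 is reset after the perturbation has been added, whereas clock 3 keeps it. The
  offset between these two clocks is what the guards of the next move detect.\<close>

lemma step_B:
  assumes "step A \<delta> \<sigma>1 \<sigma>2 h = Some h'" "cur h = (Loc (main_loc l m 1), \<nu>)" "m < 3" "(l, f, j, k) \<in> Q"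
  shows "\<delta> \<le> 7 - \<nu> 3" "play_cost A h' = play_cost A h"
    "cur h' = (Loc (main_loc l m 2), \<lambda>x. if x = 4 then 0 else \<nu> x + (7 - \<nu> 3) + \<sigma>2 h (\<sigma>1 h))"
proof -
  obtain t i g r d where *: "\<sigma>1 h = (t, i)" "edges A ! i = (main_loc l m 1, g, r, d)"
    "(main_loc l m 1, g, r, d) \<in> set (phase_edges (l, f, j, k) m)"
    "\<delta> \<le> t" "sat_guard (\<lambda>x. \<nu> x + t) g" "play_cost A h' = play_cost A h"
    "cur h' = (d, reset r (\<lambda>x. \<nu> x + t + \<sigma>2 h (\<sigma>1 h)))"
    by (rule step_main[OF assms(1-3) _ assms(4)]) simp
  have e: "g = [(3, CEq, 7)]" "r = [4]" "d = Loc (main_loc l m 2)"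
    using *(3) main_loc_phase_neq[of l m] by (auto simp: phase_edges_def)
  have t: "t = 7 - \<nu> 3" using *(5) by (simp add: e sat_guard_def)
  show "\<delta> \<le> 7 - \<nu> 3" "play_cost A h' = play_cost A h"
    "cur h' = (Loc (main_loc l m 2), \<lambda>x. if x = 4 then 0 else \<nu> x + (7 - \<nu> 3) + \<sigma>2 h (\<sigma>1 h))"
    using *(4,6,7) e t by (simp_all add: reset_def)
qed

lemma step_D:
  assumes "step A \<delta> \<sigma>1 \<sigma>2 h = Some h'" "cur h = (Loc (main_loc l m 2), \<nu>)" "m < 3" "(l, f, j, k) \<in> Q"
  defines "t \<equiv> 1 - \<nu> 4"
  shows "\<delta> \<le> t" "play_cost A h' = play_cost A h"
    "\<nu> 3 + t = 8 \<Longrightarrow> \<exists>n. (n = j \<and> \<nu> (qclk m) + t > 12 \<or> n = k \<and> \<nu> (qclk m) + t < 12) \<and>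
       cur h' = (Loc (main_loc n (qclk m) 0), \<lambda>x. if x = 3 then 0 else \<nu> x + t + \<sigma>2 h (\<sigma>1 h))"
    "\<nu> 3 + t > 8 \<Longrightarrow> cur h' = (Loc (check_loc f 0 m 0), \<lambda>x. \<nu> x + t + \<sigma>2 h (\<sigma>1 h))"
    "\<nu> 3 + t < 8 \<Longrightarrow> cur h' = (Loc (check_loc f 1 m 0), \<lambda>x. \<nu> x + t + \<sigma>2 h (\<sigma>1 h))"
proof -
  obtain t' i g r d where *: "\<sigma>1 h = (t', i)" "edges A ! i = (main_loc l m 2, g, r, d)"
    "(main_loc l m 2, g, r, d) \<in> set (phase_edges (l, f, j, k) m)"
    "\<delta> \<le> t'" "sat_guard (\<lambda>x. \<nu> x + t') g" "play_cost A h' = play_cost A h"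
    "cur h' = (d, reset r (\<lambda>x. \<nu> x + t' + \<sigma>2 h (\<sigma>1 h)))"
    by (rule step_main[OF assms(1-3) _ assms(4)]) simp
  have e: "(g, r, d) = ([(4, CEq, 1), (3, CEq, 8), (qclk m, CGt, 12)], [3], Loc (main_loc j (qclk m) 0))
     \<or> (g, r, d) = ([(4, CEq, 1), (3, CEq, 8), (qclk m, CLt, 12)], [3], Loc (main_loc k (qclk m) 0))
     \<or> (g, r, d) = ([(4, CEq, 1), (3, CGt, 8)], [], Loc (check_loc f 0 m 0))
     \<or> (g, r, d) = ([(4, CEq, 1), (3, CLt, 8)], [], Loc (check_loc f 1 m 0))"
    using *(3) main_loc_phase_neq[of l m] by (auto simp: phase_edges_def)
  have t: "t' = t" using *(5) e by (auto simp: sat_guard_def t_def)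
  show "\<delta> \<le> t" "play_cost A h' = play_cost A h" using *(4,6) t by simp_all
  show "\<exists>n. (n = j \<and> \<nu> (qclk m) + t > 12 \<or> n = k \<and> \<nu> (qclk m) + t < 12) \<and>
       cur h' = (Loc (main_loc n (qclk m) 0), \<lambda>x. if x = 3 then 0 else \<nu> x + t + \<sigma>2 h (\<sigma>1 h))" if "\<nu> 3 + t = 8"
    using e *(5)[unfolded t] *(7)[unfolded t] that by (elim disjE) (simp_all add: sat_guard_def reset_def)
  show "cur h' = (Loc (check_loc f 0 m 0), \<lambda>x. \<nu> x + t + \<sigma>2 h (\<sigma>1 h))" if "\<nu> 3 + t > 8"
    using e *(5)[unfolded t] *(7)[unfolded t] that by (elim disjE) (simp_all add: sat_guard_def reset_def)
  show "cur h' = (Loc (check_loc f 1 m 0), \<lambda>x. \<nu> x + t + \<sigma>2 h (\<sigma>1 h))" if "\<nu> 3 + t < 8"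
    using e *(5)[unfolded t] *(7)[unfolded t] that by (elim disjE) (simp_all add: sat_guard_def reset_def)
qed

lemma step_goal:
  assumes "step A \<delta> \<sigma>1 \<sigma>2 h = Some h'" "cur h = (Loc (main_loc 0 m 0), \<nu>)" "m < 3"
  shows "\<delta> \<le> 1 - \<nu> 3" "play_cost A h' = play_cost A h" "is_tgt (fst (cur h'))"
proof -
  obtain l \<nu>' t i g r d \<epsilon> where *: "cur h = (Loc l, \<nu>')" "allowed A \<delta> l \<nu>' t (l, g, r, d)"
    "cur h' = (d, reset r (\<lambda>x. \<nu>' x + t + \<epsilon>))"
    "play_cost A h' = play_cost A h + (t + \<epsilon>) * of_int (prices A ! l)"
    using assms(1) by (rule step_SomeE) blast
  have l: "l = main_loc 0 m 0" "\<nu>' = \<nu>" using *(1) assms(2) by simp_all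
  have e: "(l, g, r, d) = goal_edge m"
    using edge_from_main[of "(l, g, r, d)" 0 m 0] *(2) l assms goal_not_in_Q by (auto simp: allowed_def Domain_iff)
  have "prices A ! l = 0" using price_main[of "(l, g, r, d)"] *(2) l by (auto simp: allowed_def)
  moreover have "t = 1 - \<nu> 3" using *(2) e l by (auto simp: allowed_def sat_guard_def goal_edge_def)
  ultimately show "\<delta> \<le> 1 - \<nu> 3" "play_cost A h' = play_cost A h" "is_tgt (fst (cur h'))"
    using * e l by (simp_all add: allowed_def goal_edge_def)
qed

lemma step_stuck:
  assumes "step A \<delta> \<sigma>1 \<sigma>2 h = Some h'" "cur h = (Loc (main_loc l m 0), \<nu>)" "m < 3"
  shows "l = 0 \<or> l \<in> Domain Q"
  using assms(1)
proof (rule step_SomeE)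
  fix l' \<nu>' t i g r d
  assume *: "cur h = (Loc l', \<nu>')" "allowed A \<delta> l' \<nu>' t (l', g, r, d)"
  have "l' = main_loc l m 0" using *(1) assms(2) by simp
  then show ?thesis
    using edge_from_main[of "(l', g, r, d)" l m 0] *(2) assms(3) unfolding allowed_def by (simp add: Domain_iff) blast
qed

lemma step_check:
  assumes "step A \<delta> \<sigma>1 \<sigma>2 h = Some h'" "cur h = (Loc (check_loc f s m k), \<nu>)"
    and "s < 2" "m < 3" "k < length (check_seq f s m)" "check_seq f s m ! k = (p, x, c)"
  shows "\<delta> \<le> c - \<nu> x"
    "play_cost A h' = play_cost A h + (c - \<nu> x + \<sigma>2 h (\<sigma>1 h)) * p"
    "cur h' = (if Suc k < length (check_seq f s m) then Loc (check_loc f s m (Suc k)) else Tgt 0,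
       \<lambda>y. \<nu> y + (c - \<nu> x) + \<sigma>2 h (\<sigma>1 h))"
proof -
  obtain l \<nu>' t i g r d \<epsilon> where *: "cur h = (Loc l, \<nu>')" "allowed A \<delta> l \<nu>' t (l, g, r, d)" "\<epsilon> = \<sigma>2 h (\<sigma>1 h)"
    "cur h' = (d, reset r (\<lambda>x. \<nu>' x + t + \<epsilon>))"
    "play_cost A h' = play_cost A h + (t + \<epsilon>) * of_int (prices A ! l)"
    using assms(1) by (rule step_SomeE)
  have l: "l = check_loc f s m k" "\<nu>' = \<nu>" using *(1) assms(2) by simp_all
  have e: "(l, g, r, d) = check_edge f s m k"
    by (rule edge_from_check[OF _ _ assms(3-5)]) (use *(2) l in \<open>simp_all add: allowed_def\<close>)
  have grd: "g = [(x, CEq, c)]" "r = []"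
    "d = (if Suc k < length (check_seq f s m) then Loc (check_loc f s m (Suc k)) else Tgt 0)"
    using e assms(6) by (simp_all add: check_edge_def)
  have p: "real_of_int (prices A ! l) = p" using price_check[OF assms(3-5)] l assms(6) by simp
  have t: "t = c - \<nu> x" "\<delta> \<le> t" using *(2) grd l by (simp_all add: allowed_def sat_guard_def)
  show "\<delta> \<le> c - \<nu> x" using t by simp
  show "play_cost A h' = play_cost A h + (c - \<nu> x + \<sigma>2 h (\<sigma>1 h)) * p"
      using *(5) unfolding p t(1) *(3) .
  show "cur h' = (if Suc k < length (check_seq f s m) then Loc (check_loc f s m (Suc k)) else Tgt 0,
       \<lambda>y. \<nu> y + (c - \<nu> x) + \<sigma>2 h (\<sigma>1 h))"
      using *(4) unfolding grd(2,3) t(1) *(3) l by (simp add: reset_def)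
qed

end

section \<open>Soundness\<close>

fun check_cost :: "valuation \<Rightarrow> (nat \<times> nat \<times> int) list \<Rightarrow> real" where
  "check_cost \<nu> [] = 0"
| "check_cost \<nu> ((p, x, c) # L) = p * (c - \<nu> x) + check_cost (\<lambda>y. \<nu> y + (c - \<nu> x)) L"

text \<open>The bounds are absolute and no clock is reset, so after the first wait all clocks are
  where they would have been without the shift.\<close>

lemma check_cost_shift:
  "check_cost (\<lambda>y. \<nu> y + a) L = check_cost \<nu> L - a * (case L of [] \<Rightarrow> 0 | q # _ \<Rightarrow> real (fst q))"
proof (cases L)
  case (Cons q L')
  obtain p x c where q: "q = (p, x, c)" by (cases q)
  show ?thesis by (simp add: Cons q algebra_simps)
qed simp

text \<open>The offset 1 matches the unit wait that closes a phase. The factor 4 puts zero at 5 and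
  every positive counter at 3 or below, a distance that small perturbations cannot blur. An
  increment halves the distance to 1 and a decrement doubles it.\<close>

definition counter_value :: "nat \<Rightarrow> real" where
  "counter_value c = 1 + 4 / 2 ^ c"

lemma counter_value_0: "counter_value 0 = 5"
  by (simp add: counter_value_def)

lemma counter_value_pos: "0 < c \<Longrightarrow> counter_value c \<le> 3"
  using power_increasing[of 1 c "2::real"] by (simp add: counter_value_def field_simps)

fun value_op :: "op \<Rightarrow> real \<Rightarrow> real" where
  "value_op Keep u = u"
| "value_op Up u = (u + 1) / 2"
| "value_op Down u = 2 * u - 1"

lemma counter_value_op:
  assumes "f = Down \<longrightarrow> 0 < c"
  shows "counter_value (app_op f c) = value_op f (counter_value c)"
proof (cases f)
  case Down
  then obtain c' where "c = Suc c'" using assms gr0_conv_Suc by blast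
  then show ?thesis using Down by (simp add: counter_value_def)
qed (simp_all add: counter_value_def)

lemma check_cost_seq:
  assumes "m < 3"
  shows "check_cost \<nu> (check_seq Keep 0 m) = 27 - \<nu> m + \<nu> (fclk m)"
    "check_cost \<nu> (check_seq Keep (Suc 0) m) = - 5 - \<nu> (fclk m) + \<nu> m"
    "check_cost \<nu> (check_seq Up 0 m) = 34 - \<nu> m - \<nu> 3 + 2 * \<nu> (fclk m)"
    "check_cost \<nu> (check_seq Up (Suc 0) m) = - 4 - 2 * \<nu> (fclk m) + \<nu> m"
    "check_cost \<nu> (check_seq Down 0 m) = 44 - 2 * \<nu> m + \<nu> (fclk m)"
    "check_cost \<nu> (check_seq Down (Suc 0) m) = - 14 - \<nu> (fclk m) + 2 * \<nu> m - \<nu> 3"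
  by simp_all

text \<open>The waits of price 1 add up to a linear form equal to 11 plus the signed error, taken
  twice for \<open>Up\<close>. The shift \<epsilon> common to the three clocks either cancels or
  enters with coefficient -1.\<close>

lemma check_cost_deviation:
  assumes "m < 3" "\<nu> (fclk m) = u' + \<epsilon>" "\<nu> m = 16 + u + \<epsilon>" "\<nu> 3 = 8 + \<epsilon>"
  shows "value_op f u \<le> u' \<Longrightarrow> 11 + (u' - value_op f u) - \<bar>\<epsilon>\<bar> \<le> check_cost \<nu> (check_seq f 0 m)"
    and "u' \<le> value_op f u \<Longrightarrow> 11 + (value_op f u - u') - \<bar>\<epsilon>\<bar> \<le> check_cost \<nu> (check_seq f (Suc 0) m)"
proof -
  have e: "\<epsilon> \<le> \<bar>\<epsilon>\<bar>" "- \<epsilon> \<le> \<bar>\<epsilon>\<bar>" by simp_all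
  show "11 + (u' - value_op f u) - \<bar>\<epsilon>\<bar> \<le> check_cost \<nu> (check_seq f 0 m)" if "value_op f u \<le> u'"
    using that e by (cases f) (simp_all only: check_cost_seq[OF assms(1)] value_op.simps assms(2-4), argo+)
  show "11 + (value_op f u - u') - \<bar>\<epsilon>\<bar> \<le> check_cost \<nu> (check_seq f (Suc 0) m)" if "u' \<le> value_op f u"
    using that e by (cases f) (simp_all only: check_cost_seq[OF assms(1)] value_op.simps assms(2-4), argo+)
qed

context swap_game
begin

text \<open>A perturbation is charged at the price of its own move, and the next equality guard
  takes it back at the price of the next wait. It thus contributes its product with a difference of
  two prices, and errors add up over the few remaining moves instead of propagating. Soundness uses
  \<beta> = 0, completeness \<beta> = \<delta>.\<close>

lemma check_run:
  assumes "run A \<delta> s0 \<sigma>1 \<sigma>2 N = Some hN" "is_tgt (fst (cur hN))"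
    and "s < 2" "m < 3"
    and "run A \<delta> s0 \<sigma>1 \<sigma>2 n = Some h" "cur h = (Loc (check_loc f s m k), \<nu>)" "k < length (check_seq f s m)"
    and "\<And>h' mv. n \<le> length (snd h') \<Longrightarrow> \<bar>\<sigma>2 h' mv\<bar> \<le> \<beta>"
  shows "\<bar>play_cost A hN - (play_cost A h + check_cost \<nu> (drop k (check_seq f s m)))\<bar>
           \<le> 2 * \<beta> * (length (check_seq f s m) - k)"
  using assms(5-8)
proof (induction "length (check_seq f s m) - k" arbitrary: n h \<nu> k)
  case 0
  then show ?case by simp
next
  case (Suc r)
  let ?L = "check_seq f s m"
  obtain p x c where pxc: "?L ! k = (p, x, c)" by (cases "?L ! k")
  have p2: "p < 2" using check_rate[OF Suc.prems(3)] pxc by simp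
  obtain h' where h': "run A \<delta> s0 \<sigma>1 \<sigma>2 (Suc n) = Some h'" "step A \<delta> \<sigma>1 \<sigma>2 h = Some h'"
    by (rule run_progress[OF assms(1,2) Suc.prems(1)]) (simp add: Suc.prems(2))
  define \<epsilon> where "\<epsilon> = \<sigma>2 h (\<sigma>1 h)"
  have \<epsilon>: "\<bar>\<epsilon>\<bar> \<le> \<beta>" unfolding \<epsilon>_def using Suc.prems(4)[of h] run_length[OF Suc.prems(1)] by simp
  define \<nu>1 where "\<nu>1 = (\<lambda>y. \<nu> y + (c - \<nu> x))"
  have st: "play_cost A h' = play_cost A h + (c - \<nu> x + \<epsilon>) * p"
    "cur h' = (if Suc k < length ?L then Loc (check_loc f s m (Suc k)) else Tgt 0, \<lambda>y. \<nu>1 y + \<epsilon>)"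
    using step_check[OF h'(2) Suc.prems(2) assms(3,4) Suc.prems(3) pxc] by (simp_all add: \<epsilon>_def \<nu>1_def)
  have dr: "check_cost \<nu> (drop k ?L) = p * (c - \<nu> x) + check_cost \<nu>1 (drop (Suc k) ?L)"
    unfolding Cons_nth_drop_Suc[OF Suc.prems(3), symmetric] pxc by (simp add: \<nu>1_def)
  show ?case
  proof (cases "Suc k < length ?L")
    case True
    have IH: "\<bar>play_cost A hN - (play_cost A h' + check_cost (\<lambda>y. \<nu>1 y + \<epsilon>) (drop (Suc k) ?L))\<bar>
        \<le> 2 * \<beta> * real (length ?L - Suc k)"
      by (rule Suc.hyps(1)[OF _ h'(1) _ True]) (use Suc.hyps(2) st(2) True Suc.prems(4) in auto)
    define p' where "p' = real (fst (?L ! Suc k))"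
    have p': "0 \<le> p'" "p' \<le> 1" using check_rate[OF True] unfolding p'_def by auto
    have sh: "check_cost (\<lambda>y. \<nu>1 y + \<epsilon>) (drop (Suc k) ?L) = check_cost \<nu>1 (drop (Suc k) ?L) - \<epsilon> * p'"
      unfolding check_cost_shift p'_def Cons_nth_drop_Suc[OF True, symmetric] by simp
    have len: "real (length ?L - k) = real (length ?L - Suc k) + 1" using Suc.prems(3) by (simp add: of_nat_diff)
    have pb: "\<bar>\<epsilon> * (p - p')\<bar> \<le> 2 * \<beta>"
    proof -
      have "\<bar>real p - p'\<bar> \<le> 2" using p' p2 by linarith
      then have "\<bar>\<epsilon>\<bar> * \<bar>real p - p'\<bar> \<le> \<beta> * 2" using \<epsilon> by (intro mult_mono) auto
      then show ?thesis by (simp add: abs_mult)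
    qed
    have "play_cost A hN - (play_cost A h + check_cost \<nu> (drop k ?L)) =
       (play_cost A hN - (play_cost A h' + check_cost (\<lambda>y. \<nu>1 y + \<epsilon>) (drop (Suc k) ?L))) + \<epsilon> * (p - p')"
      unfolding dr sh st(1) by (simp add: algebra_simps)
    then show ?thesis using IH pb unfolding len by (simp add: algebra_simps)
  next
    case False
    then have "is_tgt (fst (cur h'))" using st(2) by simp
    then have "reaches_at A \<delta> s0 \<sigma>1 \<sigma>2 (Suc n)" "reaches_at A \<delta> s0 \<sigma>1 \<sigma>2 N"
      using h'(1) assms(1,2) unfolding reaches_at_def by blast+
    then have "Suc n = N" by (rule reaches_at_unique)
    then have hN: "hN = h'" using assms(1) h'(1) by simp
    have "drop (Suc k) ?L = []" using False by simp
    then have "play_cost A hN - (play_cost A h + check_cost \<nu> (drop k ?L)) = \<epsilon> * p"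
      unfolding dr hN st(1) by (simp add: algebra_simps)
    moreover have "\<bar>\<epsilon> * p\<bar> \<le> 2 * \<beta>"
    proof -
      have "\<bar>\<epsilon>\<bar> * \<bar>real p\<bar> \<le> \<beta> * 2" using \<epsilon> p2 by (intro mult_mono) auto
      then show ?thesis by (simp add: abs_mult)
    qed
    moreover have "length ?L - k = 1" using False Suc.prems(3) by simp
    ultimately show ?thesis by simp
  qed
qed

abbreviation "init_state \<equiv> (Loc 144, \<lambda>_. 0 :: real)"

text \<open>An infinitesimal perturbation of the move at \<open>z = 7\<close> is a challenge by the perturbator: its
  sign selects whether the new clock value is checked for being too large or too small.\<close>

lemma challenge:
  assumes lim: "limcost A init_state \<sigma>1 \<le> 11" and "0 < \<delta>0"
    and h: "run A \<delta>0 init_state \<sigma>1 (\<lambda>_ _. 0) n = Some h" "cur h = (Loc (main_loc l m 1), \<nu>)" "play_cost A h = 0"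
    and Q: "(l, f, j, k) \<in> Q" "m < 3"
    and \<nu>: "\<nu> (fclk m) = 0" "\<nu> m = 8 + u + \<nu> 3"
  shows "8 - \<nu> 3 = value_op f u"
proof (rule ccontr)
  assume neq: "8 - \<nu> 3 \<noteq> value_op f u"
  define u' where "u' = 8 - \<nu> 3"
  \<comment> \<open>A third of the error suffices: the check will cost at least
    \<open>11 + 3 * \<eta> - \<delta>\<close> with \<open>\<delta> \<le> \<eta>\<close>, which
    exceeds the tolerated \<open>11 + \<eta>\<close>.\<close>
  define \<eta> where "\<eta> = \<bar>u' - value_op f u\<bar> / 3"
  have \<eta>: "0 < \<eta>" using neq by (simp add: \<eta>_def u'_def)
  obtain \<delta>1 where \<delta>1: "0 < \<delta>1" "\<And>\<delta> \<sigma>2. \<delta> \<le> \<delta>1 \<Longrightarrow> \<sigma>2 \<in> pert_strats \<delta> \<Longrightarrow> cost A \<delta> init_state \<sigma>1 \<sigma>2 \<le> ereal (11 + \<eta>)"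
    using limcost_le_imp[of A init_state \<sigma>1 11 \<eta>] lim \<eta> by auto
  define \<delta> where "\<delta> = min \<delta>0 (min \<delta>1 \<eta>)"
  have \<delta>: "0 < \<delta>" "\<delta> \<le> \<delta>0" "\<delta> \<le> \<delta>1" "\<delta> \<le> \<eta>" using \<open>0 < \<delta>0\<close> \<delta>1(1) \<eta> by (auto simp: \<delta>_def)
  define \<epsilon> where "\<epsilon> = (if value_op f u < u' then \<delta> else - \<delta>)"
  define s :: nat where "s = (if value_op f u < u' then 0 else Suc 0)"
  \<comment> \<open>Only the move after \<open>n\<close> steps is perturbed, so the play still
    begins with \<open>h\<close>, and the check that follows runs without error.\<close>
  define \<sigma>2 :: pert_strat where "\<sigma>2 = (\<lambda>h' _. if length (snd h') = n then \<epsilon> else 0)"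
  have "\<sigma>2 \<in> pert_strats \<delta>" using \<delta>(1) by (simp add: pert_strats_def \<sigma>2_def \<epsilon>_def)
  then have "cost A \<delta> init_state \<sigma>1 \<sigma>2 \<le> ereal (11 + \<eta>)" by (rule \<delta>1(2)[OF \<delta>(3)])
  then obtain N hN where N: "run A \<delta> init_state \<sigma>1 \<sigma>2 N = Some hN" "is_tgt (fst (cur hN))"
    "play_cost A hN \<le> 11 + \<eta>" by (rule cost_finiteE)
  have r: "run A \<delta> init_state \<sigma>1 \<sigma>2 n = Some h"
    by (rule run_cong[OF h(1) \<delta>(2)]) (simp add: \<sigma>2_def)
  obtain h1 where h1: "run A \<delta> init_state \<sigma>1 \<sigma>2 (Suc n) = Some h1" "step A \<delta> \<sigma>1 \<sigma>2 h = Some h1"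
    by (rule run_progress[OF N(1,2) r]) (simp add: h(2))
  have s2h: "\<sigma>2 h (\<sigma>1 h) = \<epsilon>" using run_length[OF r] by (simp add: \<sigma>2_def)
  define \<nu>1 where "\<nu>1 = (\<lambda>x. if x = 4 then 0 else \<nu> x + (7 - \<nu> 3) + \<epsilon>)"
  have c1: "play_cost A h1 = 0" "cur h1 = (Loc (main_loc l m 2), \<nu>1)"
    using step_B[OF h1(2) h(2) Q(2,1)] h(3) by (simp_all add: s2h \<nu>1_def cong: if_cong)
  obtain h2 where h2: "run A \<delta> init_state \<sigma>1 \<sigma>2 (Suc (Suc n)) = Some h2" "step A \<delta> \<sigma>1 \<sigma>2 h1 = Some h2"
    by (rule run_progress[OF N(1,2) h1(1)]) (simp add: c1(2))
  have s2h1: "\<sigma>2 h1 (\<sigma>1 h1) = 0" using run_length[OF h1(1)] by (simp add: \<sigma>2_def)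
  define \<nu>2 where "\<nu>2 = (\<lambda>x. \<nu>1 x + 1)"
  have z: "1 - \<nu>1 4 = 1" "\<nu>1 3 + 1 = 8 + \<epsilon>" by (simp_all add: \<nu>1_def)
  note D = step_D[OF h2(2) c1(2) Q(2,1), unfolded z(1) s2h1 z(2)]
  have c2: "play_cost A h2 = 0" using D(2) c1(1) by simp
  have c2': "cur h2 = (Loc (check_loc f s m 0), \<nu>2)"
  proof (cases "value_op f u < u'")
    case True
    then show ?thesis using D(4) \<delta>(1) by (simp add: \<nu>2_def s_def \<epsilon>_def)
  next
    case False
    then show ?thesis using D(5) \<delta>(1) by (simp add: \<nu>2_def s_def \<epsilon>_def)
  qed
  have clk: "fclk m \<noteq> 3" "fclk m \<noteq> 4" "m \<noteq> 3" "m \<noteq> 4" using clocks_distinct[OF Q(2)] Q(2) by linarith+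
  have vals: "\<nu>2 (fclk m) = u' + \<epsilon>" "\<nu>2 m = 16 + u + \<epsilon>" "\<nu>2 3 = 8 + \<epsilon>"
    using clk \<nu> by (simp_all add: \<nu>2_def \<nu>1_def u'_def)
  have "\<bar>play_cost A hN - (play_cost A h2 + check_cost \<nu>2 (drop 0 (check_seq f s m)))\<bar>
      \<le> 2 * 0 * real (length (check_seq f s m) - 0)"
    by (rule check_run[OF N(1,2) _ Q(2) h2(1) c2' length_check_seq(2)]) (simp_all add: s_def \<sigma>2_def)
  then have "play_cost A hN = check_cost \<nu>2 (check_seq f s m)" using c2 by simp
  moreover have "11 + \<bar>u' - value_op f u\<bar> - \<bar>\<epsilon>\<bar> \<le> check_cost \<nu>2 (check_seq f s m)"
    using check_cost_deviation[OF Q(2) vals] by (auto simp: s_def)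
  moreover have "\<bar>\<epsilon>\<bar> = \<delta>" using \<delta>(1) by (simp add: \<epsilon>_def)
  moreover have "\<bar>u' - value_op f u\<bar> = 3 * \<eta>" by (simp add: \<eta>_def)
  ultimately show False using N(3) \<delta>(4) \<eta> by linarith
qed

text \<open>Two initial moves and three moves per machine step give the index
  \<open>2 + 3 * i\<close>. In each phase \<open>challenge\<close> pins the guess down to the
  correct value, and the guards on the back clock then leave only the correct branch.\<close>

lemma sound_invariant:
  assumes lim: "limcost A init_state \<sigma>1 \<le> 11" and "0 < \<delta>0"
    and N: "run A \<delta>0 init_state \<sigma>1 (\<lambda>_ _. 0) N = Some hN" "is_tgt (fst (cur hN))"
    and conf: "conf 0 = (start, 0, 0)" "\<And>i. i < n \<Longrightarrow> mstep Q (conf i) (conf (Suc i))"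
    and "i \<le> n" "conf i = (l, a, b)"
  shows "\<exists>h \<nu>. run A \<delta>0 init_state \<sigma>1 (\<lambda>_ _. 0) (2 + 3 * i) = Some h \<and>
    cur h = (Loc (main_loc l (i mod 3) 0), \<nu>) \<and> play_cost A h = 0 \<and>
    \<nu> (i mod 3) = 8 + counter_value a \<and> \<nu> (qclk (i mod 3)) = counter_value b \<and> \<nu> 3 = 0"
  using assms(7,8)
proof (induction i arbitrary: l a b)
  case 0
  let ?R = "run A \<delta>0 init_state \<sigma>1 (\<lambda>_ _. 0)"
  have c0: "?R 0 = Some (init_state, [])" "cur (init_state, []) = init_state" by (simp_all add: cur_def)
  obtain h1 where h1: "?R (Suc 0) = Some h1" "step A \<delta>0 \<sigma>1 (\<lambda>_ _. 0) (init_state, []) = Some h1"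
    by (rule run_progress[OF N c0(1)]) (simp add: c0)
  have c1: "play_cost A h1 = 0" "cur h1 = (Loc 146, \<lambda>x. if x = 1 then 0 else 8)"
    using step_init[OF h1(2) c0(2)] by (simp_all add: play_cost_def cong: if_cong)
  obtain h2 where h2: "?R (Suc (Suc 0)) = Some h2" "step A \<delta>0 \<sigma>1 (\<lambda>_ _. 0) h1 = Some h2"
    by (rule run_progress[OF N h1(1)]) (simp add: c1)
  have c2: "play_cost A h2 = 0"
    "cur h2 = (Loc (main_loc start 0 0), \<lambda>x. if x = 3 then 0 else (if x = 1 then 0 else 8) + 5)"
    using step_start[OF h2(2) c1(2)] by (simp_all add: c1 cong: if_cong)
  have "l = start" "a = 0" "b = 0" using 0 conf(1) by auto
  then show ?case using h2(1) c2 by (auto simp: numeral_2_eq_2 counter_value_def qclk_def)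
next
  case (Suc i)
  let ?R = "run A \<delta>0 init_state \<sigma>1 (\<lambda>_ _. 0)"
  define m where "m = i mod 3"
  have m: "m < 3" "Suc i mod 3 = qclk m" by (simp_all add: m_def qclk_def mod_Suc_eq)
  note cd = clocks_distinct[OF m(1)]
  obtain l0 a0 b0 where ci: "conf i = (l0, a0, b0)" by (cases "conf i")
  have "mstep Q (l0, a0, b0) (l, a, b)" using conf(2)[of i] Suc.prems ci by simp
  then obtain f j k where q: "(l0, f, j, k) \<in> Q" "f = Down \<longrightarrow> 0 < a0"
    "l = (if b0 = 0 then j else k)" "a = b0" "b = app_op f a0" by (auto elim: mstep.cases)
  from Suc.IH[OF _ ci] Suc.prems(1) obtain h \<nu> where h: "?R (2 + 3 * i) = Some h"
    "cur h = (Loc (main_loc l0 m 0), \<nu>)" "play_cost A h = 0"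
    "\<nu> m = 8 + counter_value a0" "\<nu> (qclk m) = counter_value b0" "\<nu> 3 = 0" by (auto simp: m_def)
  obtain h1 where h1: "?R (Suc (2 + 3 * i)) = Some h1" "step A \<delta>0 \<sigma>1 (\<lambda>_ _. 0) h = Some h1"
    by (rule run_progress[OF N h(1)]) (simp add: h(2))
  obtain t where t: "\<delta>0 \<le> t" "play_cost A h1 = 0"
    "cur h1 = (Loc (main_loc l0 m 1), \<lambda>x. if x = fclk m then 0 else \<nu> x + t)"
    using step_A[OF h1(2) h(2) m(1) q(1)] h(3) by (auto cong: if_cong)
  define \<nu>1 where "\<nu>1 = (\<lambda>x. if x = fclk m then 0 else \<nu> x + t)"
  have \<nu>1: "\<nu>1 3 = t" "\<nu>1 (fclk m) = 0" "\<nu>1 m = 8 + counter_value a0 + t" "\<nu>1 (qclk m) = counter_value b0 + t"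
    using cd h by (auto simp: \<nu>1_def)
  have u': "8 - t = counter_value b"
    using challenge[OF lim \<open>0 < \<delta>0\<close> h1(1) t(3)[folded \<nu>1_def] t(2) q(1) m(1) \<nu>1(2), of "counter_value a0"]
      \<nu>1 counter_value_op[OF q(2)] q(5) by simp
  obtain h2 where h2: "?R (Suc (Suc (2 + 3 * i))) = Some h2" "step A \<delta>0 \<sigma>1 (\<lambda>_ _. 0) h1 = Some h2"
    by (rule run_progress[OF N h1(1)]) (simp add: t(3))
  define \<nu>2 where "\<nu>2 = (\<lambda>x. if x = 4 then 0 else \<nu>1 x + (7 - t))"
  have c2: "play_cost A h2 = 0" "cur h2 = (Loc (main_loc l0 m 2), \<nu>2)"
    using step_B[OF h2(2) t(3)[folded \<nu>1_def] m(1) q(1)] by (simp_all add: t(2) \<nu>1 \<nu>2_def cong: if_cong)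
  have \<nu>2: "\<nu>2 3 = 7" "\<nu>2 4 = 0" "\<nu>2 (fclk m) = 7 - t" "\<nu>2 (qclk m) = counter_value b0 + 7"
    using \<nu>1 cd by (auto simp: \<nu>2_def)
  obtain h3 where h3: "?R (Suc (Suc (Suc (2 + 3 * i)))) = Some h3" "step A \<delta>0 \<sigma>1 (\<lambda>_ _. 0) h2 = Some h3"
    by (rule run_progress[OF N h2(1)]) (simp add: c2(2))
  have z: "1 - \<nu>2 4 = 1" "\<nu>2 3 + 1 = 8" using \<nu>2 by simp_all
  note D = step_D[OF h3(2) c2(2) m(1) q(1), unfolded z(1)]
  have c3: "play_cost A h3 = 0" using D(2) c2(1) by simp
  have c3': "\<exists>n. (n = j \<and> counter_value b0 + 8 > 12 \<or> n = k \<and> counter_value b0 + 8 < 12) \<and>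
      cur h3 = (Loc (main_loc n (qclk m) 0), \<lambda>x. if x = 3 then 0 else \<nu>2 x + 1)"
    using D(3)[OF z(2)] \<nu>2(4) by (simp add: add.assoc cong: if_cong)
  have b0: "b0 = 0 \<longrightarrow> counter_value b0 = 5" "b0 \<noteq> 0 \<longrightarrow> counter_value b0 \<le> 3"
    using counter_value_pos by (auto simp: counter_value_0)
  have cur3: "cur h3 = (Loc (main_loc l (qclk m) 0), \<lambda>x. if x = 3 then 0 else \<nu>2 x + 1)"
    using c3' b0 q(3) by (cases "b0 = 0") auto
  have idx: "2 + 3 * Suc i = Suc (Suc (Suc (2 + 3 * i)))" by simp
  show ?case
    unfolding idx m(2)
    by (rule exI[of _ h3], rule exI[of _ "\<lambda>x. if x = 3 then 0 else \<nu>2 x + 1"])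
      (use h3(1) cur3 c3 \<nu>2 cd q(4) u' in auto)
qed

text \<open>A finite bound makes the unperturbed play reach a target, yet this play follows the
  machine into a location without outgoing edges.\<close>

theorem stuck_imp_limcost_gt:
  assumes "(mstep Q)\<^sup>*\<^sup>* (start, 0, 0) (l, a, b)" "l \<noteq> 0" "l \<notin> Domain Q"
  shows "\<not> limcost A init_state \<sigma>1 \<le> 11"
proof
  assume lim: "limcost A init_state \<sigma>1 \<le> 11"
  obtain \<delta>0 where \<delta>0: "0 < \<delta>0" "\<And>\<delta> \<sigma>2. \<delta> \<le> \<delta>0 \<Longrightarrow> \<sigma>2 \<in> pert_strats \<delta> \<Longrightarrow> cost A \<delta> init_state \<sigma>1 \<sigma>2 \<le> ereal (11 + 1)"
    using limcost_le_imp[of A init_state \<sigma>1 11 1] lim by auto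
  have "(\<lambda>_ _. 0) \<in> pert_strats \<delta>0" using \<delta>0(1) by (simp add: pert_strats_def)
  then have "cost A \<delta>0 init_state \<sigma>1 (\<lambda>_ _. 0) \<le> ereal (11 + 1)" by (rule \<delta>0(2)[OF order_refl])
  then obtain N hN where N: "run A \<delta>0 init_state \<sigma>1 (\<lambda>_ _. 0) N = Some hN"
    "is_tgt (fst (cur hN))" by (rule cost_finiteE)
  obtain n conf where conf: "conf 0 = (start, 0, 0)" "conf n = (l, a, b)" "\<And>i. i < n \<Longrightarrow> mstep Q (conf i) (conf (Suc i))"
    using assms(1) by (auto simp: rtranclp_power relpowp_fun_conv)
  obtain h \<nu> where h: "run A \<delta>0 init_state \<sigma>1 (\<lambda>_ _. 0) (2 + 3 * n) = Some h"
    "cur h = (Loc (main_loc l (n mod 3) 0), \<nu>)"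
    using sound_invariant[OF lim \<delta>0(1) N conf(1,3) order_refl conf(2)] by blast
  obtain h' where "step A \<delta>0 \<sigma>1 (\<lambda>_ _. 0) h = Some h'"
    by (rule run_progress[OF N h(1)]) (simp add: h(2))
  then show False using step_stuck[OF _ h(2)] assms(2,3) by simp
qed

end

section \<open>Completeness\<close>

text \<open>The margin in front of every wait of a check. With \<open>2 * \<delta>\<close> one of
  the two halves absorbs the perturbation of the preceding move and the other is the minimal
  delay.\<close>

fun check_sep :: "real \<Rightarrow> valuation \<Rightarrow> (nat \<times> nat \<times> int) list \<Rightarrow> bool" where
  "check_sep d \<nu> [] = True"
| "check_sep d \<nu> ((p, x, c) # L) = (d \<le> c - \<nu> x \<and> check_sep d (\<lambda>y. \<nu> y + (c - \<nu> x)) L)"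

lemma check_sep_seq:
  assumes "m < 3" "\<bar>\<nu> (fclk m) - 3\<bar> \<le> 5 / 2" "\<bar>\<nu> m - 19\<bar> \<le> 5 / 2" "\<bar>\<nu> 3 - 8\<bar> \<le> 1 / 2"
  shows "check_sep (1 / 4) \<nu> (check_seq f 0 m) \<and> check_sep (1 / 4) \<nu> (check_seq f (Suc 0) m)"
proof -
  have "1 / 2 \<le> \<nu> (fclk m)" "\<nu> (fclk m) \<le> 11 / 2" "33 / 2 \<le> \<nu> m" "\<nu> m \<le> 43 / 2" "15 / 2 \<le> \<nu> 3" "\<nu> 3 \<le> 17 / 2"
    using assms(2-4) unfolding abs_le_iff by linarith+
  then show ?thesis by (cases f) simp_all
qed

text \<open>The worst case is \<open>Down\<close> with sign 1, where the clock errors enter with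
  weights 1, 2 and 1: \<open>3 + 2 * 5 + 2 = 15\<close>.\<close>

lemma check_cost_honest:
  assumes "m < 3" "\<bar>\<nu> (fclk m) - value_op f u\<bar> \<le> 3 * \<delta>" "\<bar>\<nu> m - (16 + u)\<bar> \<le> 5 * \<delta>" "\<bar>\<nu> 3 - 8\<bar> \<le> 2 * \<delta>"
  shows "check_cost \<nu> (check_seq f 0 m) \<le> 11 + 15 * \<delta>" "check_cost \<nu> (check_seq f (Suc 0) m) \<le> 11 + 15 * \<delta>"
proof -
  have a: "\<nu> (fclk m) \<le> value_op f u + 3 * \<delta>" "value_op f u - 3 * \<delta> \<le> \<nu> (fclk m)"
    "\<nu> m \<le> 16 + u + 5 * \<delta>" "16 + u - 5 * \<delta> \<le> \<nu> m" "\<nu> 3 \<le> 8 + 2 * \<delta>" "8 - 2 * \<delta> \<le> \<nu> 3" "0 \<le> \<delta>"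
    using assms(2-4) unfolding abs_le_iff by linarith+
  show "check_cost \<nu> (check_seq f 0 m) \<le> 11 + 15 * \<delta>"
    using a by (cases f) (simp_all only: check_cost_seq[OF assms(1)] value_op.simps, argo+)
  show "check_cost \<nu> (check_seq f (Suc 0) m) \<le> 11 + 15 * \<delta>"
    using a by (cases f) (simp_all only: check_cost_seq[OF assms(1)] value_op.simps, argo+)
qed

lemma pert_strats_bound: "\<sigma>2 \<in> pert_strats \<delta> \<Longrightarrow> \<bar>\<sigma>2 h mv\<bar> \<le> \<delta>"
  unfolding pert_strats_def by blast

lemma sat_guard_CEq:
  fixes c :: int and \<nu> :: valuation
  assumes "sat_guard (\<lambda>y. \<nu> y + (t::real)) g" "(x, CEq, c) \<in> set g"
  shows "t = c - \<nu> x"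
  using bspec[OF assms(1)[unfolded sat_guard_def] assms(2)] by simp

context swap_game
begin

text \<open>The delay is only asked to be positive because a strategy cannot refer to \<delta>; that
  it is at least \<delta> along the plays considered is shown separately.\<close>

definition legal :: "(nat \<Rightarrow> real) \<Rightarrow> play \<Rightarrow> real \<times> nat \<Rightarrow> bool" where
  "legal W h mv \<longleftrightarrow> snd mv < length (edges A) \<and> 0 < fst mv \<and> Loc (fst (edges A ! snd mv)) = fst (cur h) \<and>
     sat_guard (\<lambda>x. snd (cur h) x + fst mv) (fst (snd (edges A ! snd mv))) \<and>
     (fst (snd (edges A ! snd mv)) = [] \<longrightarrow> fst mv = W (length (snd h)))"

text \<open>Outside the unguarded resets, whose delay is prescribed by \<open>W\<close>, every legal move is forced by an
  equality guard, so that an arbitrary choice suffices.\<close>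

definition strat :: "(nat \<Rightarrow> real) \<Rightarrow> ctrl_strat" where
  "strat W h = (SOME mv. legal W h mv)"

lemma strat_legal:
  assumes "cur h = (Loc (fst e), \<nu>)" "e \<in> set (edges A)" "0 < t" "sat_guard (\<lambda>x. \<nu> x + t) (fst (snd e))"
    and "fst (snd e) = [] \<Longrightarrow> t = W (length (snd h))"
  shows "legal W h (strat W h)"
proof -
  obtain i where "i < length (edges A)" "edges A ! i = e" using assms(2) by (auto simp: in_set_conv_nth)
  then have "legal W h (t, i)" using assms by (simp add: legal_def)
  then show ?thesis unfolding strat_def by (rule someI)
qed

lemma strat_step:
  assumes "legal W h (strat W h)" "\<delta> \<le> fst (strat W h)" "cur h = (Loc l, \<nu>)"
  obtains h' where "step A \<delta> (strat W) \<sigma>2 h = Some h'"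
proof (cases "step A \<delta> (strat W) \<sigma>2 h")
  case None
  obtain t i where ti: "strat W h = (t, i)" by (cases "strat W h")
  have "\<not> allowed A \<delta> l \<nu> t (edges A ! i)"
    by (rule step_NoneD[OF None assms(3) ti]) (use assms(1) ti in \<open>simp add: legal_def\<close>)
  then show ?thesis using assms ti by (simp add: legal_def allowed_def)
qed (use that in blast)

lemma strat_forced:
  fixes c :: int and \<nu> :: valuation
  assumes "cur h = (Loc l, \<nu>)" "0 < \<delta>" "\<delta> \<le> c - \<nu> x"
    and forced: "\<And>e'. e' \<in> set (edges A) \<Longrightarrow> fst e' = l \<Longrightarrow> (x, CEq, c) \<in> set (fst (snd e'))"
    and "e \<in> set (edges A)" "fst e = l" "sat_guard (\<lambda>y. \<nu> y + (c - \<nu> x)) (fst (snd e))"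
  obtains h' where "step A \<delta> (strat W) \<sigma>2 h = Some h'"
proof -
  have leg: "legal W h (strat W h)"
    by (rule strat_legal[of h e \<nu> "c - \<nu> x"]) (use assms(1-3,5-7) forced[of e] in auto)
  then have "edges A ! snd (strat W h) \<in> set (edges A)" "fst (edges A ! snd (strat W h)) = l"
    "sat_guard (\<lambda>y. \<nu> y + fst (strat W h)) (fst (snd (edges A ! snd (strat W h))))"
    using assms(1) by (simp_all add: legal_def)
  from sat_guard_CEq[OF this(3) forced[OF this(1,2)]] assms(3) have "\<delta> \<le> fst (strat W h)" by simp
  from strat_step[OF leg this assms(1)] that show ?thesis by blast
qed

lemma run_Suc: "run A \<delta> s \<sigma>1 \<sigma>2 n = Some h \<Longrightarrow> step A \<delta> \<sigma>1 \<sigma>2 h = Some h' \<Longrightarrow> run A \<delta> s \<sigma>1 \<sigma>2 (Suc n) = Some h'"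
  by simp

text \<open>The offset \<open>a\<close> is the perturbation of the preceding move alone: the next
  equality guard cancels it and a new one takes its place, so the bound \<delta> persists.\<close>

lemma check_reach:
  assumes "s < 2" "m < 3" "0 < \<delta>" "\<sigma>2 \<in> pert_strats \<delta>"
    and "run A \<delta> s0 (strat W) \<sigma>2 n = Some h" "cur h = (Loc (check_loc f s m k), \<lambda>y. \<nu> y + a)"
    and "k < length (check_seq f s m)" "\<bar>a\<bar> \<le> \<delta>" "check_sep (2 * \<delta>) \<nu> (drop k (check_seq f s m))"
  shows "\<exists>N hN. run A \<delta> s0 (strat W) \<sigma>2 N = Some hN \<and> is_tgt (fst (cur hN))"
  using assms(5-9)
proof (induction "length (check_seq f s m) - k" arbitrary: n h \<nu> k a)
  case 0
  then show ?case by simp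
next
  case (Suc r)
  let ?L = "check_seq f s m"
  obtain p x c where pxc: "?L ! k = (p, x, c)" by (cases "?L ! k")
  have sep: "2 * \<delta> \<le> c - \<nu> x" "check_sep (2 * \<delta>) (\<lambda>y. \<nu> y + (c - \<nu> x)) (drop (Suc k) ?L)"
    using Suc.prems(5) unfolding Cons_nth_drop_Suc[OF Suc.prems(3), symmetric] pxc by simp_all
  have edge: "check_edge f s m k \<in> set (edges A)" by (rule check_edge_mem[OF assms(1,2) Suc.prems(3)])
  obtain h' where h': "step A \<delta> (strat W) \<sigma>2 h = Some h'"
  proof (rule strat_forced[OF Suc.prems(2) assms(3), of c x "check_edge f s m k"])
    show "\<delta> \<le> c - (\<nu> x + a)" using sep(1) Suc.prems(4) by simp
    show "(x, CEq, c) \<in> set (fst (snd e'))" if "e' \<in> set (edges A)" "fst e' = check_loc f s m k" for e'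
      using edge_from_check[OF that assms(1,2) Suc.prems(3)] pxc by (simp add: check_edge_def)
  qed (use edge pxc in \<open>simp_all add: check_edge_def sat_guard_def\<close>)
  have r': "run A \<delta> s0 (strat W) \<sigma>2 (Suc n) = Some h'" by (rule run_Suc[OF Suc.prems(1) h'])
  define \<epsilon> where "\<epsilon> = \<sigma>2 h (strat W h)"
  have \<epsilon>: "\<bar>\<epsilon>\<bar> \<le> \<delta>" using pert_strats_bound[OF assms(4)] by (simp add: \<epsilon>_def)
  have c': "cur h' = (if Suc k < length ?L then Loc (check_loc f s m (Suc k)) else Tgt 0, \<lambda>y. \<nu> y + (c - \<nu> x) + \<epsilon>)"
    using step_check(3)[OF h' Suc.prems(2) assms(1,2) Suc.prems(3) pxc] by (simp add: \<epsilon>_def algebra_simps)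
  show ?case
  proof (cases "Suc k < length ?L")
    case True
    show ?thesis
      by (rule Suc.hyps(1)[OF _ r' _ True \<epsilon> sep(2)]) (use Suc.hyps(2) c' True in simp_all)
  next
    case False
    then show ?thesis using r' c' by (intro exI[of _ "Suc n"] exI[of _ h']) simp
  qed
qed

text \<open>The factor 23 consists of 15 for the inexact clocks at entry and 2 for each of at most
  four moves.\<close>

lemma check_bound:
  assumes "s < 2" "m < 3" "0 < \<delta>" "\<delta> \<le> 1 / 100" "\<sigma>2 \<in> pert_strats \<delta>"
    and r: "run A \<delta> s0 (strat W) \<sigma>2 n = Some h" and c: "cur h = (Loc (check_loc f s m 0), \<nu>)" and "play_cost A h = 0"
    and val: "\<bar>\<nu> (fclk m) - value_op f u\<bar> \<le> 3 * \<delta>" "\<bar>\<nu> m - (16 + u)\<bar> \<le> 5 * \<delta>" "\<bar>\<nu> 3 - 8\<bar> \<le> 2 * \<delta>"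
    and u: "1 \<le> u" "u \<le> 5" "1 \<le> value_op f u" "value_op f u \<le> 5"
  shows "cost A \<delta> s0 (strat W) \<sigma>2 \<le> ereal (11 + 23 * \<delta>)"
proof -
  have "\<bar>\<nu> (fclk m) - 3\<bar> \<le> 5 / 2" "\<bar>\<nu> m - 19\<bar> \<le> 5 / 2" "\<bar>\<nu> 3 - 8\<bar> \<le> 1 / 2"
    using val u assms(4) unfolding abs_le_iff by linarith+
  note seps = check_sep_seq[OF assms(2) this, of f]
  have s01: "s = 0 \<or> s = Suc 0" using assms(1) by auto
  have mono: "check_sep d \<nu>' L \<Longrightarrow> d' \<le> d \<Longrightarrow> check_sep d' \<nu>' L" for d d' \<nu>' L
    by (induction d \<nu>' L rule: check_sep.induct) auto
  have sep: "check_sep (2 * \<delta>) \<nu> (drop 0 (check_seq f s m))"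
    using seps s01 assms(4) mono[of "1 / 4"] by auto
  have "\<exists>N hN. run A \<delta> s0 (strat W) \<sigma>2 N = Some hN \<and> is_tgt (fst (cur hN))"
    by (rule check_reach[OF assms(1-3,5) r _ length_check_seq(2), of f \<nu> 0]) (use c sep assms(3) in simp_all)
  then obtain N hN where N: "run A \<delta> s0 (strat W) \<sigma>2 N = Some hN" "is_tgt (fst (cur hN))" by blast
  have "\<bar>play_cost A hN - (play_cost A h + check_cost \<nu> (drop 0 (check_seq f s m)))\<bar>
      \<le> 2 * \<delta> * real (length (check_seq f s m) - 0)"
    by (rule check_run[OF N assms(1,2) r c length_check_seq(2)]) (rule pert_strats_bound[OF assms(5)])
  moreover have "2 * \<delta> * real (length (check_seq f s m)) \<le> 8 * \<delta>"
    using length_check_seq(1)[of f s m] assms(3) mult_left_mono[of "real (length (check_seq f s m))" 4 "2 * \<delta>"] by simp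
  moreover have "check_cost \<nu> (check_seq f s m) \<le> 11 + 15 * \<delta>"
    using check_cost_honest[OF assms(2) val] s01 by auto
  ultimately have "play_cost A hN \<le> 11 + 23 * \<delta>" using assms(8) by (simp add: abs_le_iff)
  then show ?thesis using cost_reached[OF N] by simp
qed

lemma counter_value_bounds: "1 \<le> counter_value c" "counter_value c \<le> 5"
  by (simp_all add: counter_value_def field_simps)

text \<open>Error budget: the new value suffers the perturbations of its reset and of the last move,
  hence \<open>2 * \<delta>\<close>; the back value gains only that of the last move on its way to
  the front, hence \<open>3 * \<delta>\<close>. For the old values the guard at time 7 cancels the
  perturbation of the reset, and any nonzero perturbation at time 7 ends in a check. So the bounds
  reproduce themselves from phase to phase.\<close>

lemma complete_phase:
  assumes \<delta>: "0 < \<delta>" "\<delta> \<le> 1 / 100" "\<delta> \<le> 2 / 2 ^ b'" and \<sigma>2: "\<sigma>2 \<in> pert_strats \<delta>"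
    and h: "run A \<delta> s0 (strat W) \<sigma>2 n = Some h" "cur h = (Loc (main_loc l m 0), \<nu>)" "play_cost A h = 0"
    and W: "W n = 8 - counter_value b'"
    and Q: "(l, f, j, k) \<in> Q" "m < 3" "f = Down \<longrightarrow> 0 < a" "b' = app_op f a"
    and \<nu>: "\<bar>\<nu> m - (8 + counter_value a)\<bar> \<le> 3 * \<delta>" "\<bar>\<nu> (qclk m) - counter_value b\<bar> \<le> 2 * \<delta>" "\<nu> 3 = 0"
  shows "cost A \<delta> s0 (strat W) \<sigma>2 \<le> ereal (11 + 23 * \<delta>) \<or>
    (\<exists>h' \<nu>'. run A \<delta> s0 (strat W) \<sigma>2 (n + 3) = Some h' \<and>
       cur h' = (Loc (main_loc (if b = 0 then j else k) (qclk m) 0), \<nu>') \<and> play_cost A h' = 0 \<and>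
       \<bar>\<nu>' (qclk m) - (8 + counter_value b)\<bar> \<le> 3 * \<delta> \<and> \<bar>\<nu>' (fclk m) - counter_value b'\<bar> \<le> 2 * \<delta> \<and> \<nu>' 3 = 0)"
proof -
  note cd = clocks_distinct[OF Q(2)]
  have pert: "\<bar>\<sigma>2 x y\<bar> \<le> \<delta>" for x y by (rule pert_strats_bound[OF \<sigma>2])
  define t where "t = 8 - counter_value b'"
  have t: "3 \<le> t" "t \<le> 7" using counter_value_bounds[of b'] by (simp_all add: t_def)
  \<comment> \<open>Between the scheduled reset and phase time 7 there is \<open>4 / 2 ^ b'\<close>
    of time, enough for a perturbation and a minimal delay.\<close>
  have t7: "2 * \<delta> \<le> 7 - t"
    using \<delta>(3) by (simp add: t_def counter_value_def)
  have phase: "e \<in> set (phase_edges (l, f, j, k) m)" if "e \<in> set (edges A)" "fst e = main_loc l m ph" "ph < 3" for e ph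
    by (rule edge_from_instr[OF that(1,2) Q(2) that(3) Q(1)])
  note mem = instr_edge_mem[OF Q(1,2)]
  let ?eA = "(main_loc l m 0, [], [fclk m], Loc (main_loc l m 1)) :: edge"
  have leg: "legal W h (strat W h)"
    by (rule strat_legal[of h ?eA \<nu> t])
      (use mem[of ?eA] t h(2) W run_length[OF h(1)] in \<open>simp_all add: phase_edges_def sat_guard_def t_def\<close>)
  have "edges A ! snd (strat W h) \<in> set (edges A)" "fst (edges A ! snd (strat W h)) = main_loc l m 0"
    using leg h(2) by (simp_all add: legal_def)
  from phase[OF this] have "fst (snd (edges A ! snd (strat W h))) = []"
    using main_loc_phase_neq[of l m] \<open>fst (edges A ! snd (strat W h)) = main_loc l m 0\<close>
    by (auto simp: phase_edges_def)
  then have st: "fst (strat W h) = t" using leg W run_length[OF h(1)] by (simp add: legal_def t_def)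
  obtain h1 where h1: "step A \<delta> (strat W) \<sigma>2 h = Some h1"
  proof (rule strat_step[OF leg _ h(2)])
    show "\<delta> \<le> fst (strat W h)" using st t \<delta> by simp
  qed
  note r1 = run_Suc[OF h(1) h1]
  define \<epsilon>1 where "\<epsilon>1 = \<sigma>2 h (strat W h)"
  define \<nu>1 where "\<nu>1 = (\<lambda>x. if x = fclk m then 0 else \<nu> x + t + \<epsilon>1)"
  have c1: "play_cost A h1 = 0" "cur h1 = (Loc (main_loc l m 1), \<nu>1)"
  proof -
    obtain t' i where *: "strat W h = (t', i)" "play_cost A h1 = play_cost A h"
      "cur h1 = (Loc (main_loc l m 1), \<lambda>x. if x = fclk m then 0 else \<nu> x + t' + \<sigma>2 h (strat W h))"
      using step_A[OF h1 h(2) Q(2,1)] by blast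
    then have "t' = t" using st by simp
    then show "play_cost A h1 = 0" "cur h1 = (Loc (main_loc l m 1), \<nu>1)"
      using *(2,3) h(3) unfolding \<epsilon>1_def \<nu>1_def by (simp_all cong: if_cong)
  qed
  have z1: "\<nu>1 3 = t + \<epsilon>1" using cd \<nu>(3) by (simp add: \<nu>1_def)
  let ?eB = "(main_loc l m 1, [(3, CEq, 7)], [4], Loc (main_loc l m 2)) :: edge"
  obtain h2 where h2: "step A \<delta> (strat W) \<sigma>2 h1 = Some h2"
  proof (rule strat_forced[OF c1(2) \<delta>(1), of 7 3 ?eB])
    show "\<delta> \<le> real_of_int 7 - \<nu>1 3" using t7 pert[of h "strat W h"] z1 by (simp add: \<epsilon>1_def abs_le_iff)
    show "(3, CEq, 7) \<in> set (fst (snd e'))" if "e' \<in> set (edges A)" "fst e' = main_loc l m 1" for e'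
      using phase[OF that] that(2) main_loc_phase_neq[of l m] by (auto simp: phase_edges_def)
  qed (use mem[of ?eB] in \<open>simp_all add: phase_edges_def sat_guard_def\<close>)
  note r2 = run_Suc[OF r1 h2]
  define \<epsilon>2 where "\<epsilon>2 = \<sigma>2 h1 (strat W h1)"
  define \<nu>2 where "\<nu>2 = (\<lambda>x. if x = 4 then 0 else \<nu>1 x + (7 - \<nu>1 3) + \<epsilon>2)"
  have c2: "play_cost A h2 = 0" "cur h2 = (Loc (main_loc l m 2), \<nu>2)"
    using step_B[OF h2 c1(2) Q(2,1)] c1(1) by (simp_all add: \<epsilon>2_def \<nu>2_def cong: if_cong)
  have v2: "\<nu>2 4 = 0" "\<nu>2 3 = 7 + \<epsilon>2" "\<nu>2 (fclk m) = 7 - t - \<epsilon>1 + \<epsilon>2" "\<nu>2 m = \<nu> m + 7 + \<epsilon>2"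
    "\<nu>2 (qclk m) = \<nu> (qclk m) + 7 + \<epsilon>2"
    using cd Q(2) z1 by (simp_all add: \<nu>2_def) (simp_all add: \<nu>1_def)
  have eps: "\<bar>\<epsilon>1\<bar> \<le> \<delta>" "\<bar>\<epsilon>2\<bar> \<le> \<delta>" using pert by (simp_all add: \<epsilon>1_def \<epsilon>2_def)
  have b: "b = 0 \<longrightarrow> counter_value b = 5" "b \<noteq> 0 \<longrightarrow> counter_value b \<le> 3"
    using counter_value_pos by (auto simp: counter_value_0)
  let ?eD = "if \<epsilon>2 = 0 then (if b = 0
        then (main_loc l m 2, [(4, CEq, 1), (3, CEq, 8), (qclk m, CGt, 12)], [3], Loc (main_loc j (qclk m) 0))
        else (main_loc l m 2, [(4, CEq, 1), (3, CEq, 8), (qclk m, CLt, 12)], [3], Loc (main_loc k (qclk m) 0)))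
      else if 0 < \<epsilon>2 then (main_loc l m 2, [(4, CEq, 1), (3, CGt, 8)], [], Loc (check_loc f 0 m 0))
      else (main_loc l m 2, [(4, CEq, 1), (3, CLt, 8)], [], Loc (check_loc f 1 m 0)) :: edge"
  have q12: "b = 0 \<longrightarrow> 12 < \<nu> (qclk m) + 8" "b \<noteq> 0 \<longrightarrow> \<nu> (qclk m) + 8 < 12"
    using \<nu>(2) b \<delta>(2) unfolding abs_le_iff by linarith+
  obtain h3 where h3: "step A \<delta> (strat W) \<sigma>2 h2 = Some h3"
  proof (rule strat_forced[OF c2(2) \<delta>(1), of 1 4 ?eD])
    show "\<delta> \<le> real_of_int 1 - \<nu>2 4" using \<delta>(2) v2(1) by simp
    show "(4, CEq, 1) \<in> set (fst (snd e'))" if "e' \<in> set (edges A)" "fst e' = main_loc l m 2" for e'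
      using phase[OF that] that(2) main_loc_phase_neq[of l m] by (auto simp: phase_edges_def)
    show "?eD \<in> set (edges A)" by (rule mem) (simp add: phase_edges_def)
    show "fst ?eD = main_loc l m 2" by simp
    show "sat_guard (\<lambda>y. \<nu>2 y + (real_of_int 1 - \<nu>2 4)) (fst (snd ?eD))"
      using v2 q12 by (simp add: sat_guard_def)
  qed
  note r3 = run_Suc[OF r2 h3]
  define \<epsilon>3 where "\<epsilon>3 = \<sigma>2 h2 (strat W h2)"
  have e3: "\<bar>\<epsilon>3\<bar> \<le> \<delta>" using pert by (simp add: \<epsilon>3_def)
  have w: "1 - \<nu>2 4 = 1" using v2 by simp
  note D = step_D[OF h3 c2(2) Q(2,1), unfolded w, folded \<epsilon>3_def]
  have u': "value_op f (counter_value a) = counter_value b'" using counter_value_op[OF Q(3)] Q(4) by simp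
  show ?thesis
  proof (cases "\<epsilon>2 = 0")
    case True
    have z: "\<nu>2 3 + 1 = 8" using v2 True by simp
    let ?\<nu> = "\<lambda>x. if x = 3 then 0 else \<nu>2 x + 1 + \<epsilon>3"
    have "cur h3 = (Loc (main_loc (if b = 0 then j else k) (qclk m) 0), ?\<nu>)"
      using D(3)[OF z] v2 True q12 by (cases "b = 0") auto
    moreover have "\<bar>?\<nu> (qclk m) - (8 + counter_value b)\<bar> \<le> 3 * \<delta>"
      using cd \<nu>(2) e3 True v2(5) by (simp add: abs_le_iff)
    moreover have "\<bar>?\<nu> (fclk m) - counter_value b'\<bar> \<le> 2 * \<delta>"
      using cd eps e3 True v2(3) by (simp add: abs_le_iff t_def)
    moreover have "run A \<delta> s0 (strat W) \<sigma>2 (n + 3) = Some h3" using r3 by (simp add: numeral_3_eq_3)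
    ultimately show ?thesis using D(2) c2(1) by (intro disjI2 exI[of _ h3] exI[of _ ?\<nu>]) simp
  next
    case False
    define s :: nat where "s = (if 0 < \<epsilon>2 then 0 else 1)"
    have c3: "cur h3 = (Loc (check_loc f s m 0), \<lambda>x. \<nu>2 x + 1 + \<epsilon>3)"
      using D(4,5) False v2(2) by (auto simp: s_def)
    have v3: "\<bar>\<nu>2 (fclk m) + 1 + \<epsilon>3 - value_op f (counter_value a)\<bar> \<le> 3 * \<delta>"
      "\<bar>\<nu>2 m + 1 + \<epsilon>3 - (16 + counter_value a)\<bar> \<le> 5 * \<delta>" "\<bar>\<nu>2 3 + 1 + \<epsilon>3 - 8\<bar> \<le> 2 * \<delta>"
      using eps e3 \<nu>(1) unfolding v2 u' t_def abs_le_iff by linarith+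
    have "play_cost A h3 = 0" "s < 2" using D(2) c2(1) by (simp_all add: s_def)
    from check_bound[OF this(2) Q(2) \<delta>(1,2) \<sigma>2 r3 c3 this(1) v3 counter_value_bounds]
    have "cost A \<delta> s0 (strat W) \<sigma>2 \<le> ereal (11 + 23 * \<delta>)" using counter_value_bounds u' by simp
    then show ?thesis ..
  qed
qed

lemma complete_start:
  assumes \<delta>: "0 < \<delta>" "\<delta> \<le> 1 / 100" and \<sigma>2: "\<sigma>2 \<in> pert_strats \<delta>"
  shows "\<exists>h \<nu>. run A \<delta> init_state (strat W) \<sigma>2 2 = Some h \<and> cur h = (Loc (main_loc start 0 0), \<nu>) \<and>
    play_cost A h = 0 \<and> \<bar>\<nu> 0 - 13\<bar> \<le> \<delta> \<and> \<bar>\<nu> 1 - 5\<bar> \<le> 2 * \<delta> \<and> \<nu> 3 = 0"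
proof -
  note pert = pert_strats_bound[OF \<sigma>2]
  let ?h0 = "(init_state, []) :: play"
  have c0: "run A \<delta> init_state (strat W) \<sigma>2 0 = Some ?h0" "cur ?h0 = init_state" "play_cost A ?h0 = 0"
    by (simp_all add: cur_def play_cost_def)
  obtain h1 where h1: "step A \<delta> (strat W) \<sigma>2 ?h0 = Some h1"
  proof (rule strat_forced[OF c0(2) \<delta>(1), of 8 0 "(144, [(0, CEq, 8)], [1], Loc 146)"])
    show "(0, CEq, 8) \<in> set (fst (snd e'))" if "e' \<in> set (edges A)" "fst e' = 144" for e'
      using edge_from_init(1)[OF that] by simp
  qed (use \<delta> init_edge_mem in \<open>simp_all add: sat_guard_def\<close>)
  note r1 = run_Suc[OF c0(1) h1]
  define \<epsilon>1 where "\<epsilon>1 = \<sigma>2 ?h0 (strat W ?h0)"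
  define \<nu>1 where "\<nu>1 = (\<lambda>x::nat. if x = 1 then 0 else 8 + \<epsilon>1)"
  have c1: "play_cost A h1 = 0" "cur h1 = (Loc 146, \<nu>1)"
    using step_init[OF h1 c0(2)] c0(3) by (simp_all add: \<epsilon>1_def \<nu>1_def cong: if_cong)
  have e1: "\<bar>\<epsilon>1\<bar> \<le> \<delta>" unfolding \<epsilon>1_def by (rule pert)
  have z: "\<nu>1 0 = 8 + \<epsilon>1" "\<nu>1 1 = 0" by (simp_all add: \<nu>1_def)
  obtain h2 where h2: "step A \<delta> (strat W) \<sigma>2 h1 = Some h2"
  proof (rule strat_forced[OF c1(2) \<delta>(1), of 13 0 "start_edge start"])
    show "(0, CEq, 13) \<in> set (fst (snd e'))" if "e' \<in> set (edges A)" "fst e' = 146" for e'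
      using edge_from_init(2)[OF that] by (simp add: start_edge_def)
    show "\<delta> \<le> real_of_int 13 - \<nu>1 0" using z e1 \<delta>(2) by (simp add: abs_le_iff)
  qed (use init_edge_mem in \<open>simp_all add: sat_guard_def start_edge_def\<close>)
  note r2 = run_Suc[OF r1 h2]
  define \<epsilon>2 where "\<epsilon>2 = \<sigma>2 h1 (strat W h1)"
  have e2: "\<bar>\<epsilon>2\<bar> \<le> \<delta>" unfolding \<epsilon>2_def by (rule pert)
  let ?\<nu> = "\<lambda>x. if x = 3 then 0 else \<nu>1 x + (13 - \<nu>1 0) + \<epsilon>2"
  have "cur h2 = (Loc (main_loc start 0 0), ?\<nu>)" "play_cost A h2 = 0"
    using step_start[OF h2 c1(2)] c1(1) by (simp_all add: \<epsilon>2_def cong: if_cong)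
  moreover have "\<bar>?\<nu> 0 - 13\<bar> \<le> \<delta>" "\<bar>?\<nu> 1 - 5\<bar> \<le> 2 * \<delta>"
    using z e1 e2 by (simp_all add: abs_le_iff)
  moreover have "run A \<delta> init_state (strat W) \<sigma>2 2 = Some h2" using r2 by (simp only: numeral_2_eq_2)
  ultimately show ?thesis by (intro exI[of _ h2] exI[of _ ?\<nu>]) simp
qed

text \<open>All locations outside the checks are free, so a play that is never challenged ends with
  cost 0, and only the checks bring the cost near 11.\<close>

lemma complete_goal:
  assumes \<delta>: "0 < \<delta>" "\<delta> \<le> 1"
    and h: "run A \<delta> s0 (strat W) \<sigma>2 n = Some h" "cur h = (Loc (main_loc 0 m 0), \<nu>)" "play_cost A h = 0"
    and "m < 3" "\<nu> 3 = 0"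
  shows "cost A \<delta> s0 (strat W) \<sigma>2 = 0"
proof -
  obtain h' where h': "step A \<delta> (strat W) \<sigma>2 h = Some h'"
  proof (rule strat_forced[OF h(2) \<delta>(1), of 1 3 "goal_edge m"])
    show "(3, CEq, 1) \<in> set (fst (snd e'))" if "e' \<in> set (edges A)" "fst e' = main_loc 0 m 0" for e'
      using edge_from_main[OF that \<open>m < 3\<close>] goal_not_in_Q by (auto simp: goal_edge_def)
  qed (use \<delta> assms(6,7) goal_edge_mem in \<open>simp_all add: sat_guard_def goal_edge_def\<close>)
  have "is_tgt (fst (cur h'))" "play_cost A h' = 0" using step_goal[OF h' h(2) \<open>m < 3\<close>] h(3) by simp_all
  then show ?thesis using cost_reached[OF run_Suc[OF h(1) h']] by (simp add: zero_ereal_def)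
qed

theorem goal_imp_limcost_le:
  assumes "(mstep Q)\<^sup>*\<^sup>* (start, 0, 0) (0, a, b)"
  shows "\<exists>\<sigma>1. limcost A init_state \<sigma>1 \<le> 11"
proof -
  obtain n conf where conf: "conf 0 = (start, 0, 0)" "conf n = (0, a, b)" "\<And>i. i < n \<Longrightarrow> mstep Q (conf i) (conf (Suc i))"
    using assms by (auto simp: rtranclp_power relpowp_fun_conv)
  \<comment> \<open>\<open>V i\<close> is the counter value written by step \<open>i\<close>, which
    has become the back counter. The guess of step \<open>i\<close> is made after
    \<open>2 + 3 * i\<close> moves, and a clock reset at phase time \<open>8 - u\<close> reads
    \<open>u\<close> at time 8. The schedule \<open>W\<close> depends on the number of moves
    only.\<close>
  define V where "V i = snd (snd (conf (Suc i)))" for i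
  define W where "W k = 8 - counter_value (V ((k - 2) div 3))" for k
  \<comment> \<open>A common bound for all values written during the run, so that one \<delta>
    leaves room after every reset.\<close>
  define B where "B = (\<Sum>i<n. V i)"
  define \<delta>0 :: real where "\<delta>0 = min (1 / 100) (2 / 2 ^ B)"
  have \<delta>0: "0 < \<delta>0" by (simp add: \<delta>0_def)
  have "limcost A init_state (strat W) \<le> ereal 11"
  proof (rule limcost_leI[OF \<delta>0, of _ _ _ _ 23])
    fix \<delta> \<sigma>2 assume \<delta>: "0 < \<delta>" "\<delta> \<le> \<delta>0" and \<sigma>2: "\<sigma>2 \<in> pert_strats \<delta>"
    have \<delta>1: "\<delta> \<le> 1 / 100" "\<delta> \<le> 2 / 2 ^ B" using \<delta>(2) by (simp_all add: \<delta>0_def)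
    let ?C = "cost A \<delta> init_state (strat W) \<sigma>2 \<le> ereal (11 + 23 * \<delta>)"
    have inv: "?C \<or> (\<exists>h \<nu>. run A \<delta> init_state (strat W) \<sigma>2 (2 + 3 * i) = Some h \<and>
       cur h = (Loc (main_loc l (i mod 3) 0), \<nu>) \<and> play_cost A h = 0 \<and>
       \<bar>\<nu> (i mod 3) - (8 + counter_value a)\<bar> \<le> 3 * \<delta> \<and>
       \<bar>\<nu> (qclk (i mod 3)) - counter_value b\<bar> \<le> 2 * \<delta> \<and> \<nu> 3 = 0)"
      if "i \<le> n" "conf i = (l, a, b)" for i l a b
      using that
    proof (induction i arbitrary: l a b)
      case 0
      obtain h \<nu> where "run A \<delta> init_state (strat W) \<sigma>2 2 = Some h" "cur h = (Loc (main_loc start 0 0), \<nu>)"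
        "play_cost A h = 0" "\<bar>\<nu> 0 - 13\<bar> \<le> \<delta>" "\<bar>\<nu> 1 - 5\<bar> \<le> 2 * \<delta>" "\<nu> 3 = 0"
        using complete_start[OF \<delta>(1) \<delta>1(1) \<sigma>2] by blast
      then show ?case using 0 conf(1) \<delta>(1)
        by (intro disjI2 exI[of _ h] exI[of _ \<nu>]) (simp add: counter_value_0 qclk_def)
    next
      case (Suc i)
      define m where "m = i mod 3"
      have m: "m < 3" "Suc i mod 3 = qclk m" by (simp_all add: m_def qclk_def mod_Suc_eq)
      obtain l0 a0 b0 where ci: "conf i = (l0, a0, b0)" by (cases "conf i")
      have "mstep Q (l0, a0, b0) (l, a, b)" using conf(3)[of i] Suc.prems ci by simp
      then obtain f j k where q: "(l0, f, j, k) \<in> Q" "f = Down \<longrightarrow> 0 < a0"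
        "l = (if b0 = 0 then j else k)" "a = b0" "b = app_op f a0" by (auto elim: mstep.cases)
      have b: "V i = b" using Suc.prems by (simp add: V_def)
      have "b \<le> B" unfolding B_def b[symmetric] using Suc.prems(1) by (intro member_le_sum) auto
      then have "(2::real) / 2 ^ B \<le> 2 / 2 ^ b" by (intro divide_left_mono power_increasing) auto
      then have \<delta>b: "\<delta> \<le> 2 / 2 ^ b" using \<delta>1(2) by linarith
      have Wi: "W (2 + 3 * i) = 8 - counter_value b" by (simp add: W_def b)
      from Suc.IH[OF _ ci] Suc.prems(1) consider ?C | h \<nu> where
        "run A \<delta> init_state (strat W) \<sigma>2 (2 + 3 * i) = Some h"
        "cur h = (Loc (main_loc l0 m 0), \<nu>)" "play_cost A h = 0"
        "\<bar>\<nu> m - (8 + counter_value a0)\<bar> \<le> 3 * \<delta>" "\<bar>\<nu> (qclk m) - counter_value b0\<bar> \<le> 2 * \<delta>" "\<nu> 3 = 0"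
        unfolding m_def by auto
      then show ?case
      proof cases
        case 2
        have idx: "2 + 3 * Suc i = 2 + 3 * i + 3" by simp
        show ?thesis
          using complete_phase[OF \<delta>(1) \<delta>1(1) \<delta>b \<sigma>2 2(1-3) Wi q(1) m(1) q(2,5) 2(4-6)]
          unfolding m(2) idx q(3,4) clocks_distinct(6)[OF m(1)] by blast
      qed blast
    qed
    from inv[OF order_refl conf(2)] consider ?C | h \<nu> where
      "run A \<delta> init_state (strat W) \<sigma>2 (2 + 3 * n) = Some h"
      "cur h = (Loc (main_loc 0 (n mod 3) 0), \<nu>)" "play_cost A h = 0" "\<nu> 3 = 0" by blast
    then show ?C
    proof cases
      case 2
      have "cost A \<delta> init_state (strat W) \<sigma>2 = 0"
        by (rule complete_goal[OF \<delta>(1) _ 2(1-3) _ 2(4)]) (use \<delta>1(1) in auto)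
      then show ?C using \<delta>(1) by simp
    qed
  qed simp
  then show ?thesis by (intro exI[of _ "strat W"]) simp
qed

end

section \<open>Diagonalisation\<close>

lemma computable_edge:
  assumes "computable n l" "computable n d"
  shows "computable n (\<lambda>xs. enc_edge (l xs, g, r, Loc (d xs)))"
  unfolding enc_edge_def prod.case enc_node.simps
  by (intro computable_list_encode_Cons computable_list_encode_Nil computable_const computable_prod_encode assms)

lemma computable_main_loc: "computable n l \<Longrightarrow> computable n (\<lambda>xs. main_loc (l xs) m ph)"
  unfolding main_loc_def by (intro computable_add computable_mult_const computable_const)

lemma computable_instr_edges:
  assumes "computable n l" "computable n j" "computable n k" "computable n (\<lambda>xs. list_encode (H xs))"
  shows "computable n (\<lambda>xs. list_encode (map enc_edge (instr_edges (l xs, f, j xs, k xs)) @ H xs))"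
  unfolding instr_edges_def phase_edges_def prod.case append_Cons append_Nil list.map
  by (intro computable_list_encode_Cons computable_edge computable_main_loc computable_const assms)

text \<open>Labels \<open>4 * i + 1\<close> increment and labels \<open>4 * i + 3\<close> swap back,
  descending to label 1. They are odd and at least 5, which keeps them apart from compiled code,
  whose labels will be even, and from the linking labels 1 and 3.\<close>

primrec chain :: "nat \<Rightarrow> instr list" where
  "chain 0 = []"
| "chain (Suc i) = (4 * i + 5, Up, 4 * i + 7, 4 * i + 7) # (4 * i + 7, Keep, 4 * i + 1, 4 * i + 1) # chain i"

lemma chain_steps:
  assumes "set (chain n) \<subseteq> Q"
  shows "(mstep Q)\<^sup>*\<^sup>* (4 * n + 1, x, 0) (1, x + n, 0)"
  using assms
proof (induction n arbitrary: x)
  case (Suc n)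
  have "(4 * n + 5, Up, 4 * n + 7, 4 * n + 7) \<in> Q" "(4 * n + 7, Keep, 4 * n + 1, 4 * n + 1) \<in> Q"
    using Suc.prems by simp_all
  from mstep_Up[OF this(1), of x 0] mstep_Keep[OF this(2), of 0 "Suc x"]
  have "(mstep Q)\<^sup>*\<^sup>* (4 * n + 5, x, 0) (4 * n + 1, Suc x, 0)"
    by (simp add: converse_rtranclp_into_rtranclp[of "mstep Q"] r_into_rtranclp)
  moreover have "(mstep Q)\<^sup>*\<^sup>* (4 * n + 1, Suc x, 0) (1, Suc x + n, 0)" by (rule Suc.IH) (use Suc.prems in auto)
  ultimately show ?case by (simp add: algebra_simps)
qed simp

lemma chain_label:
  "(l, q) \<in> set (chain n) \<Longrightarrow> odd l \<and> 5 \<le> l \<and> l \<le> 4 * n + 3 \<and> (\<exists>f j. q = (f, j, j) \<and> j \<le> 4 * n + 3)"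
  by (induction n) auto

lemma single_valued_chain: "single_valued (set (chain n))"
proof (induction n)
  case (Suc n)
  have "\<not> (\<exists>q. (4 * n + 5, q) \<in> set (chain n))" "\<not> (\<exists>q. (4 * n + 7, q) \<in> set (chain n))"
    using chain_label by fastforce+
  with Suc show ?case unfolding single_valued_def by auto
qed simp

text \<open>Half the number of locations. The code \<open>a\<close> of the given edges bounds the
  location numbers in them, and labels up to \<open>4 * n + 3\<close> occupy locations below
  \<open>72 * n + 240\<close>.\<close>

definition size_bound :: "nat \<Rightarrow> nat \<Rightarrow> nat" where
  "size_bound n a = a + 36 * n + 120"

text \<open>Since prices are parities, the price list depends on its length alone. The chain edges
  precede \<open>es\<close> so that they can be consed onto the code of \<open>es\<close>.\<close>

definition chain_rpta :: "nat \<Rightarrow> nat \<Rightarrow> edge list \<Rightarrow> rpta" where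
  "chain_rpta n a es = \<lparr>nlocs = 2 * size_bound n a, ntargets = 1, inits = [144],
     edges = start_edge (4 * n + 1) # concat (map instr_edges (chain n)) @ es,
     prices = concat (replicate (size_bound n a) [0, 1])\<rparr>"

definition chain_inst :: "nat \<Rightarrow> nat \<Rightarrow> edge list \<Rightarrow> inst" where
  "chain_inst n a es = Inst (chain_rpta n a es) 144 11 1"

text \<open>The recursion starts from the code \<open>a\<close> instead of the empty list, so no
  append on codes is required; \<open>list_decode\<close> disappears under the outer
  \<open>list_encode\<close>.\<close>

lemma enc_chain_edges:
  "rec_nat a (\<lambda>i r. list_encode (map enc_edge (instr_edges (4 * i + 5, Up, 4 * i + 7, 4 * i + 7)) @
       map enc_edge (instr_edges (4 * i + 7, Keep, 4 * i + 1, 4 * i + 1)) @ list_decode r)) n =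
     list_encode (map enc_edge (concat (map instr_edges (chain n))) @ list_decode a)"
  by (induction n) simp_all

lemma computable_enc_chain_edges:
  assumes "computable k g" "computable k h"
  shows "computable k (\<lambda>xs. list_encode (map enc_edge (concat (map instr_edges (chain (g xs)))) @ list_decode (h xs)))"
proof -
  let ?G = "\<lambda>xs. list_encode (map enc_edge (instr_edges (4 * (xs ! 0) + 5, Up, 4 * (xs ! 0) + 7, 4 * (xs ! 0) + 7)) @
       map enc_edge (instr_edges (4 * (xs ! 0) + 7, Keep, 4 * (xs ! 0) + 1, 4 * (xs ! 0) + 1)) @ list_decode (xs ! 1))"
  have "computable 3 (\<lambda>xs. list_encode (list_decode (xs ! 1)))" by (simp add: computable_nth)
  then have "computable (Suc (Suc 1)) ?G"
    unfolding numeral_3_eq_3 One_nat_def[symmetric]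
    by (intro computable_instr_edges computable_add computable_mult_const computable_nth computable_const) simp_all
  from computable_rec[OF computable_nth[of 0 1] this]
  have "computable 2 (\<lambda>xs. list_encode (map enc_edge (concat (map instr_edges (chain (hd xs)))) @ list_decode (tl xs ! 0)))"
    by (simp only: nth_Cons_0 nth_Cons_Suc One_nat_def numeral_2_eq_2 enc_chain_edges[unfolded One_nat_def] zero_less_Suc simp_thms)
  from computable_comp2[OF this assms] show ?thesis by simp
qed

lemma computable_enc_prices:
  assumes "computable k g"
  shows "computable k (\<lambda>xs. list_encode (map int_encode (concat (replicate (g xs) [0, 1]))))"
proof -
  have "rec_nat 0 (\<lambda>i r. list_encode (int_encode 0 # int_encode 1 # list_decode ([i, r] ! 1))) n =
      list_encode (map int_encode (concat (replicate n [0, 1])))" for n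
    by (induction n) simp_all
  moreover have "computable 2 (\<lambda>xs. list_encode (int_encode 0 # int_encode 1 # list_decode (xs ! 1)))"
    by (intro computable_list_encode_Cons computable_const) (simp add: computable_nth)
  ultimately show ?thesis
    using computable_rec1[OF _ assms, of "\<lambda>xs. list_encode (int_encode 0 # int_encode 1 # list_decode (xs ! 1))" 0] by simp
qed

text \<open>One function \<open>r\<close> serves all edge lists, because it sees an edge list only
  through its code. It is therefore available before the list containing its own compiled code
  exists, and self-reference arises by feeding that code in as input.\<close>

lemma computable_chain_inst:
  "\<exists>r. \<forall>es. reval r [list_encode (map enc_edge es)]
     (enc_inst (chain_inst (p ^ list_encode (map enc_edge es)) (list_encode (map enc_edge es)) es))"
proof -
  let ?n = "\<lambda>xs :: nat list. p ^ (xs ! 0)"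
  have b: "computable 1 (\<lambda>xs. size_bound (?n xs) (xs ! 0))"
    unfolding size_bound_def
    by (intro computable_add computable_mult_const computable_power computable_nth computable_const) simp_all
  have e: "computable 1 (\<lambda>xs. list_encode (enc_edge (start_edge (4 * ?n xs + 1)) #
      map enc_edge (concat (map instr_edges (chain (?n xs)))) @ list_decode (xs ! 0)))"
    unfolding start_edge_def
    by (intro computable_list_encode_Cons computable_edge computable_main_loc computable_enc_chain_edges
        computable_add computable_mult_const computable_power computable_nth computable_const) simp_all
  have "computable 1 (\<lambda>xs. list_encode
     [2 * size_bound (?n xs) (xs ! 0), 1, list_encode [144],
      list_encode (enc_edge (start_edge (4 * ?n xs + 1)) #
        map enc_edge (concat (map instr_edges (chain (?n xs)))) @ list_decode (xs ! 0)),
      list_encode (map int_encode (concat (replicate (size_bound (?n xs) (xs ! 0)) [0, 1]))),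
      144, int_encode 11, 1])"
    by (intro computable_list_encode_Cons computable_list_encode_Nil computable_const computable_mult_const
        computable_enc_prices b e)
  then obtain r where r: "\<And>xs. length xs = 1 \<Longrightarrow> reval r xs (list_encode
     [2 * size_bound (?n xs) (xs ! 0), 1, list_encode [144],
      list_encode (enc_edge (start_edge (4 * ?n xs + 1)) #
        map enc_edge (concat (map instr_edges (chain (?n xs)))) @ list_decode (xs ! 0)),
      list_encode (map int_encode (concat (replicate (size_bound (?n xs) (xs ! 0)) [0, 1]))),
      144, int_encode 11, 1])" unfolding computable_def by blast
  have "reval r [list_encode (map enc_edge es)]
     (enc_inst (chain_inst (p ^ list_encode (map enc_edge es)) (list_encode (map enc_edge es)) es))" for es
    using r[of "[list_encode (map enc_edge es)]"]
    by (simp add: chain_inst_def chain_rpta_def del: list_encode.simps)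
  then show ?thesis by blast
qed

section \<open>Well-formedness of the instances\<close>

fun edge_shape :: "edge \<Rightarrow> bool" where
  "edge_shape (l, g, r, d) \<longleftrightarrow>
     (\<forall>(x, c, k)\<in>set g. x < nclocks) \<and> (\<forall>x\<in>set r. x < nclocks) \<and> (\<forall>i. d = Tgt i \<longrightarrow> i = 0)"

fun edge_below :: "nat \<Rightarrow> edge \<Rightarrow> bool" where
  "edge_below n (l, g, r, d) \<longleftrightarrow> l < n \<and> (\<forall>i. d = Loc i \<longrightarrow> i < n)"

lemma edge_okI: "edge_shape e \<Longrightarrow> edge_below (nlocs A) e \<Longrightarrow> 0 < ntargets A \<Longrightarrow> edge_ok A e"
  by (cases e; cases "snd (snd (snd e))") (auto simp: edge_ok_def)

lemma edge_below_enc: "e \<in> set es \<Longrightarrow> edge_below (list_encode (map enc_edge es)) e"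
proof -
  assume "e \<in> set es"
  then have less: "enc_edge e < list_encode (map enc_edge es)" by (intro list_encode_mem) simp
  obtain l g r d where e: "e = (l, g, r, d)" by (cases e)
  have "l < enc_edge e" "enc_node d < enc_edge e" unfolding e enc_edge_def prod.case by (intro list_encode_mem; simp)+
  then have "l < list_encode (map enc_edge es)" "enc_node d < list_encode (map enc_edge es)"
    using less by linarith+
  moreover have "i \<le> enc_node d" if "d = Loc i" for i using that le_prod_encode_2[of i 0] by simp
  ultimately show ?thesis unfolding e edge_below.simps using le_less_trans by blast
qed

lemma edge_below_mono: "edge_below n e \<Longrightarrow> n \<le> n' \<Longrightarrow> edge_below n' e"
  by (cases e) (auto intro: less_le_trans)

lemma edge_shape_instr:
  assumes "e \<in> set (instr_edges q)"
  shows "edge_shape e"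
proof -
  have s: "edge_shape e" if "e \<in> set (phase_edges q m)" "m < 3" for m
  proof -
    obtain l f j k where q: "q = (l, f, j, k)" by (cases q)
    show ?thesis using that(1) clocks_distinct(1,2)[OF that(2)] unfolding q phase_edges_def
      by (auto simp: nclocks_def)
  qed
  show ?thesis using assms s[of 0] s[of 1] s[of 2] unfolding instr_edges_def by auto
qed

lemma edge_shape_common: "e \<in> set common_edges \<Longrightarrow> edge_shape e"
proof -
  have c: "edge_shape (check_edge f s m k)" if "m < 3" "k < length (check_seq f s m)" for f s m k
  proof -
    obtain p x c where pxc: "check_seq f s m ! k = (p, x, c)" by (cases "check_seq f s m ! k")
    have "(p, x, c) \<in> set (check_seq f s m)" using that(2) pxc nth_mem by metis
    then have "x < 5" using clocks_distinct(1)[OF that(1)] that(1) by (cases f) (auto split: if_splits)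
    then show ?thesis using pxc by (simp add: check_edge_def nclocks_def)
  qed
  show "e \<in> set common_edges \<Longrightarrow> edge_shape e"
    unfolding common_edges_def using c set_check_edges[of e] by (auto simp: goal_edge_def nclocks_def)
qed

lemma edge_below_chain:
  assumes "e \<in> set (concat (map instr_edges (chain n)))"
  shows "edge_below (72 * n + 240) e"
proof -
  from assms obtain q where q: "q \<in> set (chain n)" "e \<in> set (instr_edges q)" by auto
  obtain l f j k where qq: "q = (l, f, j, k)" by (cases q)
  have b: "l \<le> 4 * n + 3" "k = j" "j \<le> 4 * n + 3" using chain_label[of l "(f, j, k)" n] q(1) qq by auto
  have e: "edge_below (72 * n + 240) e" if "e \<in> set (phase_edges q m)" "m < 3" for m
  proof -
    have "qclk m < 3" using clocks_distinct(2)[OF that(2)] .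
    then have m: "main_loc i m' ph < 72 * n + 240" if "i \<le> 4 * n + 3" "m' < 3" "ph \<le> 2" for i m' ph
      using that by (simp add: main_loc_def algebra_simps)
    have c: "check_loc f 0 m 0 < 72 * n + 240" "check_loc f 1 m 0 < 72 * n + 240"
      using check_loc_less[OF _ that(2) length_check_seq(2), of 0 f] check_loc_less[OF _ that(2) length_check_seq(2), of 1 f] by simp_all
    show ?thesis
      using that(1) m[OF b(1) that(2)] m[OF b(3) \<open>qclk m < 3\<close>] c b(2) unfolding qq phase_edges_def
      by auto
  qed
  show ?thesis using q(2) e[of 0] e[of 1] e[of 2] unfolding instr_edges_def by auto
qed

lemma valid_chain_inst:
  assumes "\<And>e. e \<in> set es \<Longrightarrow> edge_shape e" "list_encode (map enc_edge es) \<le> a"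
  shows "valid_inst (chain_inst n a es)" "\<And>e. e \<in> set (edges (chain_rpta n a es)) \<Longrightarrow> edge_below (2 * size_bound n a) e"
proof -
  let ?A = "chain_rpta n a es"
  have below: "edge_below (2 * size_bound n a) e \<and> edge_shape e" if e: "e \<in> set (edges ?A)" for e
  proof -
    consider "e = start_edge (4 * n + 1)" | "e \<in> set (concat (map instr_edges (chain n)))" | "e \<in> set es"
      using e by (auto simp: chain_rpta_def)
    then show ?thesis
    proof cases
      case 1
      then show ?thesis by (simp add: start_edge_def main_loc_def size_bound_def nclocks_def)
    next
      case 2
      have "edge_below (2 * size_bound n a) e"
        by (rule edge_below_mono[OF edge_below_chain[OF 2]]) (simp add: size_bound_def)
      moreover obtain q where "e \<in> set (instr_edges q)" using 2 by auto
      ultimately show ?thesis using edge_shape_instr by blast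
    next
      case 3
      have "edge_below (2 * size_bound n a) e"
        by (rule edge_below_mono[OF edge_below_enc[OF 3]]) (use assms(2) in \<open>simp add: size_bound_def\<close>)
      then show ?thesis using 3 assms(1) by blast
    qed
  qed
  then show "\<And>e. e \<in> set (edges ?A) \<Longrightarrow> edge_below (2 * size_bound n a) e" by blast
  have "edge_ok ?A e" if "e \<in> set (edges ?A)" for e
    by (rule edge_okI) (use below[OF that] in \<open>simp_all add: chain_rpta_def\<close>)
  moreover have "length (concat (replicate m [0::int, 1])) = 2 * m" for m by (induction m) auto
  ultimately show "valid_inst (chain_inst n a es)"
    by (auto simp: chain_inst_def chain_rpta_def size_bound_def)
qed

lemma nth_alternating: "i < 2 * n \<Longrightarrow> concat (replicate n [0::int, 1]) ! i = (if odd i then 1 else 0)"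
proof (induction n arbitrary: i)
  case (Suc n)
  show ?case
  proof (cases "i < 2")
    case True
    then have "i = 0 \<or> i = 1" by auto
    then show ?thesis by auto
  next
    case False
    then have "i = Suc (Suc (i - 2))" by simp
    then obtain k where "i = Suc (Suc k)" by blast
    then show ?thesis using Suc by simp
  qed
qed simp

lemma swap_game_chain:
  assumes es: "set es = set common_edges \<union> (\<Union>q\<in>P. set (instr_edges q))"
    and a: "list_encode (map enc_edge es) \<le> a"
    and sv: "single_valued (P \<union> set (chain n))" "0 \<notin> Domain P"
  shows "swap_game (chain_rpta n a es) (P \<union> set (chain n)) (4 * n + 1)" "valid_inst (chain_inst n a es)"
proof -
  let ?A = "chain_rpta n a es"
  have shape: "edge_shape e" if "e \<in> set es" for e
    using that edge_shape_common edge_shape_instr unfolding es by blast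
  note v = valid_chain_inst[where n = n, OF shape a]
  show "valid_inst (chain_inst n a es)" by (rule v(1))
  show "swap_game ?A (P \<union> set (chain n)) (4 * n + 1)"
  proof
    show "set (edges ?A) = insert (start_edge (4 * n + 1)) (set common_edges) \<union> (\<Union>q\<in>P \<union> set (chain n). set (instr_edges q))"
      by (auto simp: chain_rpta_def es)
    show "single_valued (P \<union> set (chain n))" by (rule sv(1))
    show "0 \<notin> Domain (P \<union> set (chain n))" using sv(2) chain_label by fastforce
    fix e assume "e \<in> set (edges ?A)"
    then have "edge_below (2 * size_bound n a) e" by (rule v(2)[rotated])
    then have "fst e < 2 * size_bound n a" by (cases e) simp
    then show "prices ?A ! fst e = (if odd (fst e) then 1 else 0)"
      using nth_alternating by (simp add: chain_rpta_def)
  qed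
qed

text \<open>Doubling frees the odd labels for the chain and the link, and turns the exits 0 and 1 of
  compiled code into the goal label 0 and the label 2, which carries no instruction.\<close>

fun double_labels :: "instr \<Rightarrow> instr" where
  "double_labels (l, f, j, k) = (2 * l, f, 2 * j, 2 * k)"

lemma msteps_double_labels:
  "(mstep Q)\<^sup>*\<^sup>* (l, a, b) (l', a', b') \<Longrightarrow> (mstep (double_labels ` Q))\<^sup>*\<^sup>* (2 * l, a, b) (2 * l', a', b')"
proof (induction "(l', a', b')" arbitrary: l' a' b' rule: rtranclp_induct)
  case (step c)
  obtain l1 a1 b1 where c: "c = (l1, a1, b1)" by (cases c)
  from step(2) obtain f j k where q: "(l1, f, j, k) \<in> Q" "f = Down \<longrightarrow> 0 < a1"
    "l' = (if b1 = 0 then j else k)" "a' = b1" "b' = app_op f a1" unfolding c by (auto elim: mstep.cases)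
  have "(2 * l1, f, 2 * j, 2 * k) \<in> double_labels ` Q" using q(1) by force
  then have "mstep (double_labels ` Q) (2 * l1, a1, b1) (2 * l', a', b')"
    using mstep.intros[of "2 * l1" f "2 * j" "2 * k" "double_labels ` Q" a1 b1] q by auto
  with step(3)[OF c] show ?case by (rule rtranclp.rtrancl_into_rtrancl)
qed simp

lemma single_valued_double_labels:
  assumes "single_valued Q"
  shows "single_valued (double_labels ` Q)"
proof (rule single_valuedI)
  fix x y z assume "(x, y) \<in> double_labels ` Q" "(x, z) \<in> double_labels ` Q"
  then obtain q q' where q: "q \<in> Q" "(x, y) = double_labels q" "q' \<in> Q" "(x, z) = double_labels q'" by blast
  obtain l f j k where l: "q = (l, f, j, k)" by (cases q)
  obtain l' f' j' k' where l': "q' = (l', f', j', k')" by (cases q')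
  have "l' = l" using q(2,4) unfolding l l' by simp
  then have "(f, j, k) = (f', j', k')" using single_valuedD[OF assms] q(1,3) unfolding l l' by blast
  then show "y = z" using q(2,4) unfolding l l' by simp
qed

text \<open>Register 0 holds the input and register 1 the output, so the start value is a power of
  the first prime, and a last divisibility test by the second prime reads off the answer. Its exits
  are crossed: a positive answer gets stuck, the answer 0 halts.\<close>

lemma recf_machine:
  "\<exists>P. finite P \<and> single_valued P \<and> Domain P \<subseteq> {l. even l \<and> 4 \<le> l} \<and>
     (\<forall>a v. reval h [a] v \<longrightarrow> (\<exists>x. (mstep P)\<^sup>*\<^sup>* (4, nth_prime 0 ^ a, 0) (if 0 < v then 2 else 0, x, 0)))"
proof -
  obtain c where c: "implements h [0] 1 2 c" using recf_implementable[of "[0]" 2 1 h] by auto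
  obtain k0 where "regs_below k0 c" using regs_below_exists by blast
  then have k: "regs_below (max k0 2) c" by (rule regs_below_mono) simp
  define k where "k = max k0 2"
  from com_compilable[OF k, of 2] obtain m Q where m: "2 \<le> m" "code_in 2 m Q" "compiles k c 2 m Q"
    unfolding k_def by blast
  define T where "T = test_block (nth_prime 1) m 1 0"
  define m' where "m' = m + (2 * nth_prime 1 + 2)"
  have "code_in m m' T" unfolding T_def test_block_def m'_def by (rule code_in_block) simp
  then have QT: "code_in 2 m' (Q \<union> T)" by (rule code_in_Un[OF m(2) _ m(1)]) (simp add: m'_def)
  let ?P = "double_labels ` (Q \<union> T)"
  show ?thesis
  proof (intro exI[of _ ?P] conjI allI impI)
    show "finite ?P" "single_valued ?P" using QT by (simp_all add: code_in_def single_valued_double_labels)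
    show "Domain ?P \<subseteq> {l. even l \<and> 4 \<le> l}" using QT by (fastforce simp: code_in_def)
    fix a v assume "reval h [a] v"
    define s0 :: "nat \<Rightarrow> nat" where "s0 = (\<lambda>x. if x = 0 then a else 0)"
    have "reval h (map s0 [0]) v" using \<open>reval h [a] v\<close> by (simp add: s0_def)
    with c obtain t where t: "exec c s0 t" "t 1 = v" by (rule implementsD) blast
    have "goedel k s0 = (\<Prod>r<k. if r = 0 then nth_prime 0 ^ a else 1)"
      unfolding goedel_def by (rule prod.cong) (auto simp: s0_def)
    also have "\<dots> = nth_prime 0 ^ a" by (subst prod.delta) (auto simp: k_def)
    finally have g: "goedel k s0 = nth_prime 0 ^ a" .
    have "(mstep (Q \<union> T))\<^sup>*\<^sup>* (2, goedel k s0, 0) (m, goedel k t, 0)"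
      using compiles_mono[OF m(3), of "Q \<union> T"] t(1) by (simp add: compiles_def)
    also have "(mstep (Q \<union> T))\<^sup>*\<^sup>* (m, goedel k t, 0) (if 0 < v then 1 else 0, goedel k t, 0)"
      using test_block_goedel[of 1 m 1 0 "Q \<union> T" k t] t(2) by (simp add: T_def k_def)
    finally have "(mstep ?P)\<^sup>*\<^sup>* (2 * 2, nth_prime 0 ^ a, 0) (2 * (if 0 < v then 1 else 0), goedel k t, 0)"
      unfolding g by (rule msteps_double_labels)
    then have "(mstep ?P)\<^sup>*\<^sup>* (4, nth_prime 0 ^ a, 0) (if 0 < v then 2 else 0, goedel k t, 0)"
      by (cases "0 < v") simp_all
    then show "\<exists>x. (mstep ?P)\<^sup>*\<^sup>* (4, nth_prime 0 ^ a, 0) (if 0 < v then 2 else 0, x, 0)" ..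
  qed
qed

theorem theorem4:
  shows "\<not> decidable_on enc_inst {I. valid_inst I} {I. valid_inst I \<and> yes_inst I}"
proof
  assume "decidable_on enc_inst {I. valid_inst I} {I. valid_inst I \<and> yes_inst I}"
  then obtain f where f: "\<And>I. valid_inst I \<Longrightarrow> reval f [enc_inst I] (if yes_inst I then 1 else 0)"
    unfolding decidable_on_def by auto
  let ?p = "nth_prime 0"
  obtain r where r: "\<And>es. reval r [list_encode (map enc_edge es)]
     (enc_inst (chain_inst (?p ^ list_encode (map enc_edge es)) (list_encode (map enc_edge es)) es))"
    using computable_chain_inst[of ?p] by blast
  obtain P0 where P0: "finite P0" "single_valued P0" "Domain P0 \<subseteq> {l. even l \<and> 4 \<le> l}"
    "\<And>a v. reval (Comp f [r]) [a] v \<Longrightarrow> \<exists>x. (mstep P0)\<^sup>*\<^sup>* (4, ?p ^ a, 0) (if 0 < v then 2 else 0, x, 0)"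
    using recf_machine[of "Comp f [r]"] by blast
  \<comment> \<open>Labels 1 and 3 link the end of the chain to the entry 4 of the compiled code;
    two \<open>Keep\<close> steps preserve the order of the counters.\<close>
  define P where "P = insert (1, Keep, 3, 3) (insert (3, Keep, 4, 4) P0)"
  obtain L where L: "set L = P" using P0(1) finite_list[of P] by (auto simp: P_def)
  define es where "es = common_edges @ concat (map instr_edges L)"
  \<comment> \<open>The code of a list that already contains the compiled procedure. Loading
    \<open>?p ^ a\<close> amounts to starting that procedure with \<open>a\<close> in register 0 and
    all other registers empty.\<close>
  define a where "a = list_encode (map enc_edge es)"
  define n where "n = ?p ^ a"
  let ?Q = "P \<union> set (chain n)"
  have DP: "Domain P \<subseteq> {l. l = 1 \<or> l = 3 \<or> even l \<and> 4 \<le> l}" using P0(3) by (auto simp: P_def)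
  have Dc: "Domain (set (chain n)) \<subseteq> {l. odd l \<and> 5 \<le> l}" using chain_label by fastforce
  have svP: "single_valued P"
  proof -
    let ?B = "{(1, Keep, 3, 3), (3, Keep, 4, 4)} :: instr set"
    have "single_valued ?B" by (simp add: single_valued_def)
    moreover have "Domain ?B \<inter> Domain P0 = {}"
    proof -
      have "Domain ?B = {1, 3}" by simp
      moreover have "1 \<notin> Domain P0" "3 \<notin> Domain P0" using subsetD[OF P0(3)] by fastforce+
      ultimately show ?thesis by blast
    qed
    ultimately have "single_valued (?B \<union> P0)" by (intro single_valued_Un_disjoint P0(2))
    then show ?thesis by (simp add: P_def)
  qed
  have "Domain P \<inter> Domain (set (chain n)) = {}"
  proof -
    have "{l. l = 1 \<or> l = 3 \<or> even l \<and> 4 \<le> l} \<inter> {l. odd l \<and> 5 \<le> l} = ({}::nat set)" by auto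
    then show ?thesis using DP Dc by blast
  qed
  then have sv: "single_valued ?Q" by (rule single_valued_Un_disjoint[OF svP single_valued_chain])
  have es: "set es = set common_edges \<union> (\<Union>q\<in>P. set (instr_edges q))" by (auto simp: es_def L)
  have zero: "0 \<notin> Domain P" using DP by auto
  have game: "swap_game (chain_rpta n a es) ?Q (4 * n + 1)" "valid_inst (chain_inst n a es)"
    using swap_game_chain[OF es _ sv zero] by (simp_all add: a_def)
  define v :: nat where "v = (if yes_inst (chain_inst n a es) then 1 else 0)"
  have "reval (Comp f [r]) [a] v"
    using r[of es] f[OF game(2)] unfolding v_def n_def a_def
    by (auto intro!: reval_comp[where ys = "[_]"] simp: list_all2_Cons1)
  from P0(4)[OF this] obtain x where "(mstep P0)\<^sup>*\<^sup>* (4, n, 0) (if 0 < v then 2 else 0, x, 0)"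
    unfolding n_def by blast
  then have run: "(mstep ?Q)\<^sup>*\<^sup>* (4, n, 0) (if 0 < v then 2 else 0, x, 0)"
    by (rule msteps_mono[rotated]) (auto simp: P_def)
  have "(mstep ?Q)\<^sup>*\<^sup>* (4 * n + 1, 0, 0) (1, n, 0)" using chain_steps[of n ?Q 0] by simp
  also have "mstep ?Q (1, n, 0) (3, 0, n)" by (rule mstep_Keep) (simp add: P_def)
  also have "mstep ?Q (3, 0, n) (4, n, 0)" by (rule mstep_Keep) (simp add: P_def)
  also note run
  finally have main: "(mstep ?Q)\<^sup>*\<^sup>* (4 * n + 1, 0, 0) (if 0 < v then 2 else 0, x, 0)" .
  have yes: "yes_inst (chain_inst n a es) \<longleftrightarrow> (\<exists>\<sigma>1. limcost (chain_rpta n a es) (Loc 144, \<lambda>_. 0) \<sigma>1 \<le> 11)"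
    by (simp add: chain_inst_def)
  show False
  proof (cases "yes_inst (chain_inst n a es)")
    case True
    then have "(mstep ?Q)\<^sup>*\<^sup>* (4 * n + 1, 0, 0) (2, x, 0)" using main by (simp add: v_def)
    from swap_game.stuck_imp_limcost_gt[OF game(1) this] have "2 \<in> Domain ?Q" using True yes by auto
    then show False using DP Dc by auto
  next
    case False
    then have "(mstep ?Q)\<^sup>*\<^sup>* (4 * n + 1, 0, 0) (0, x, 0)" using main by (simp add: v_def)
    from swap_game.goal_imp_limcost_le[OF game(1) this] show False using False yes by blast
  qed
qed

end
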